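(* Let $A_1$ be bounded, let $l\in\{+1,-1\}$, let $\Gamma^l\subset D^l$ be an admissible contour with $\mathcal{V}_0(B,\Gamma^l)<\frac14 d^2(\Gamma^l)$, let $Z^{(l)}=A_1+X^{(l)}$, suppose that $\operatorname{dist}\bigl(\operatorname{spec}(Z^{(l)}),D^l\bigr)>0$, and let $$Y^{(l)}=\int_{\Delta_0}\mathsf{E}_0(d\mu)\,B\,(Z^{(l)}-\mu)^{-1}\in\mathcal{B}(\mathfrak{A}_1,\mathfrak{A}_0),\qquad \widehat{Y}^{(l)}=(Y^{(l)})^*.$$ Then $\|Y^{(l)}\|\ge1$ (and, hence, $\|\widehat{Y}^{(l)}\|=\|Y^{(l)}\|\ge1$).
   Context: Let $A_0$, $A_1$ be self-adjoint operators in nonzero complex Hilbert spaces $\mathfrak{A}_0$, $\mathfrak{A}_1$, with spectra $\sigma_0$, $\sigma_1$, and let $B$ be a bounded operator from $\mathfrak{A}_1$ to $\mathfrak{A}_0$. $\mathcal{B}(\mathfrak{M},\mathfrak{N})$ denotes the bounded operators from $\mathfrak{M}$ to $\mathfrak{N}$, $\mathcal{B}(\mathfrak{M})=\mathcal{B}(\mathfrak{M},\mathfrak{M})$. Standing assumptions: the whole spectrum $\sigma_0$ is absolutely continuous and equals the closure of a single interval $\Delta_0=(\mu_0^{(1)},\mu_0^{(2)})$, $-\infty\le\mu_0^{(1)}<\mu_0^{(2)}\le\infty$, and $\sigma_1\subset\Delta_0$. Let $\mathsf{E}_0$ be the spectral measure of $A_0$, $\mathsf{E}^0(\mu)=\mathsf{E}_0((-\infty,\mu))$,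 and $K_B(\mu)=B^*\mathsf{E}^0(\mu)B$. It is assumed that $K_B$ is differentiable on $\Delta_0$ in operator norm and that its derivative $K_B'$ admits analytic continuation from $\Delta_0$ to a simply connected domain $D^-\subset\mathbb{C}^-$ (lower half-plane) whose boundary includes $\Delta_0$. Then $K_B'$ also continues analytically to the domain $D^+\subset\mathbb{C}^+$ symmetric to $D^-$ about the real axis, with $[K_B'(\mu)]^*=K_B'(\bar\mu)$ on $D^\pm$. If an end point $\mu_0^{(k)}$ is finite, it is assumed that $\|K_B'(\mu)\|\le C|\mu-\mu_0^{(k)}|^\gamma$ for $\mu\in D^\pm$ near $\mu_0^{(k)}$, with some $C>0$, $\gamma\in(-1,0]$. The index $l=\pm1$ in $D^l$ is identified with the sign $\pm$. A contour $\Gamma^l$ is a rectifiable Jordan curve obtained by a continuous deformation of $\Delta_0$, lying in $D^l$, with the (finite) end points fixed, oriented from $\mu_0^{(1)}$ to $\mu_0^{(2)}$. It is called admissible if $\mathcal{V}_0(B,\Gamma^l):=\int_{\Gamma^l}|d\mu|\,\|K_B'(\mu)\|<\infty$ ($|d\mu|$ is arc length). Put $d(\Gamma^l)=\operatorname{dist}(\sigma_1,\Gamma^l)$. For $Z=A_1+X$, $X\in\mathcal{B}(\mathfrak{A}_1)$, with spectrum not intersecting $\Gamma^l$, set $W_1(Z,\Gamma^l)=-\int_{\Gamma^l}d\mu\,K_B'(\mu)(Z-\mu)^{-1}$. If $\mathcal{V}_0(B,\Gamma^l)<\frac14d^2(\Gamma^l)$, the operator $X^{(l)}$ is the unique solution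 $X\in\mathcal{B}(\mathfrak{A}_1)$ of $X=W_1(A_1+X,\Gamma^l)$ with $\|X\|\le\frac{d(\Gamma^l)}2-\sqrt{\frac{d^2(\Gamma^l)}4-\mathcal{V}_0(B,\Gamma^l)}$; for fixed $l$ it does not depend on the choice of such a contour. The integral defining $Y^{(l)}$ is understood in the strong sense.
   Formalization: If an end point of Δ_0 is infinite, it is additionally assumed that ‖K_B'(μ)‖ ≤ C exp(|μ|^α) with some α<1 for large |μ| in D^±; without a growth bound the integrals over Δ_0 and Γ^l can differ and the claim can fail. *)

theory Defs
  imports "HOL-Analysis.Analysis"
begin

section \<open>Complex Hilbert spaces and bounded operators\<close>

class complex_hilbert = real_normed_vector + complete_space +
  fixes scaleC :: "complex \<Rightarrow> 'a \<Rightarrow> 'a" (infixr "*\<^sub>C" 75)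
    and cinner :: "'a \<Rightarrow> 'a \<Rightarrow> complex"
  assumes scaleC_add_right: "c *\<^sub>C (x + y) = c *\<^sub>C x + c *\<^sub>C y"
    and scaleC_add_left: "(c + d) *\<^sub>C x = c *\<^sub>C x + d *\<^sub>C x"
    and scaleC_scaleC: "c *\<^sub>C d *\<^sub>C x = (c * d) *\<^sub>C x"
    and scaleR_scaleC: "r *\<^sub>R x = complex_of_real r *\<^sub>C x"
    and cinner_commute: "cinner x y = cnj (cinner y x)"
    and cinner_add_left: "cinner (x + y) z = cinner x z + cinner y z"
    and cinner_scaleC_left: "cinner (c *\<^sub>C x) y = c * cinner x y"
    \<comment> \<open>This also gives \<open>\<langle>x,x\<rangle> > 0\<close> for \<open>x \<noteq> 0\<close>, since \<open>sqrt\<close> is odd on the real line.\<close>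
    and norm_eq_sqrt_cinner: "norm x = sqrt (Re (cinner x x))"

instantiation complex :: complex_hilbert
begin

definition scaleC_complex :: "complex \<Rightarrow> complex \<Rightarrow> complex" where
  "scaleC_complex c x = c * x"

definition cinner_complex :: "complex \<Rightarrow> complex \<Rightarrow> complex" where
  "cinner_complex x y = x * cnj y"

instance
proof
  fix x :: complex
  show "norm x = sqrt (Re (cinner x x))"
    unfolding cinner_complex_def complex_norm_square [symmetric] by simp
qed (simp_all add: scaleC_complex_def cinner_complex_def scaleR_conv_of_real distrib_left
      distrib_right mult.assoc mult.commute)

end

text \<open>The type \<open>'a \<Rightarrow>\<^sub>L 'b\<close> consists of the bounded \<^emph>\<open>real\<close>-linear operators with the operator norm;
  the elements of \<open>\<B>(\<MM>,\<NN>)\<close> are those which are complex linear.\<close>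

definition clin :: "('a::complex_hilbert \<Rightarrow>\<^sub>L 'b::complex_hilbert) \<Rightarrow> bool" where
  "clin T \<longleftrightarrow> (\<forall>c x. T (c *\<^sub>C x) = c *\<^sub>C T x)"

text \<open>The scalar operator \<open>c I\<close>.\<close>

definition cmul :: "complex \<Rightarrow> 'a::complex_hilbert \<Rightarrow>\<^sub>L 'a" where
  "cmul c = Blinfun (\<lambda>x. c *\<^sub>C x)"

lemma norm_scaleC: "norm (c *\<^sub>C x) = cmod c * norm (x :: 'a::complex_hilbert)"
proof -
  have "cinner x (c *\<^sub>C x) = cnj c * cinner x x"
    by (subst cinner_commute, subst cinner_scaleC_left, subst complex_cnj_mult,
        subst cinner_commute [of x x, symmetric], rule refl)
  then have "cinner (c *\<^sub>C x) (c *\<^sub>C x) = (c * cnj c) * cinner x x"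
    by (simp only: cinner_scaleC_left mult.assoc)
  also have "c * cnj c = complex_of_real ((cmod c)\<^sup>2)"
    by (rule complex_norm_square [symmetric])
  finally have "Re (cinner (c *\<^sub>C x) (c *\<^sub>C x)) = (cmod c)\<^sup>2 * Re (cinner x x)"
    by simp
  then show ?thesis
    unfolding norm_eq_sqrt_cinner [where 'a = 'a] by (simp add: real_sqrt_mult)
qed

lemma cmul_apply [simp]: "blinfun_apply (cmul c) x = c *\<^sub>C x"
proof -
  have "bounded_linear (\<lambda>x::'a. c *\<^sub>C x)"
    by (rule bounded_linear_intro [where K = "cmod c"])
      (auto simp: scaleC_add_right scaleR_scaleC scaleC_scaleC norm_scaleC mult.commute)
  then show ?thesis
    by (simp add: cmul_def bounded_linear_Blinfun_apply)
qed

definition adj :: "('a::complex_hilbert \<Rightarrow>\<^sub>L 'b::complex_hilbert) \<Rightarrow> 'b \<Rightarrow>\<^sub>L 'a" where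
  "adj T = (THE S :: 'b \<Rightarrow>\<^sub>L 'a. \<forall>x y. cinner (T x) y = cinner x (S y))"

definition inv_op :: "('a::complex_hilbert \<Rightarrow>\<^sub>L 'a) \<Rightarrow> 'a \<Rightarrow>\<^sub>L 'a" where
  "inv_op T = (THE S. S o\<^sub>L T = id_blinfun \<and> T o\<^sub>L S = id_blinfun)"

text \<open>Complex differentiability, in operator norm, near every point of \<open>S\<close>
  (\<open>analytic_on\<close> is restricted to scalar functions).\<close>

definition op_analytic_on ::
  "(complex \<Rightarrow> 'a::complex_hilbert \<Rightarrow>\<^sub>L 'b::complex_hilbert) \<Rightarrow> complex set \<Rightarrow> bool" where
  "op_analytic_on F S \<longleftrightarrow>
    (\<forall>z\<in>S. \<exists>e>0. \<forall>w\<in>ball z e. clin (F w) \<and>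
       (\<exists>F'. (F has_derivative (\<lambda>h. cmul h o\<^sub>L F')) (at w)))"

section \<open>Self-adjoint operators and spectral measures\<close>

text \<open>A possibly unbounded operator is a pair of a domain \<open>d\<close> and a function \<open>A\<close>, whose values outside
  \<open>d\<close> are irrelevant. The last conjunct says that the graph of the adjoint is the graph of \<open>A\<close>.\<close>

definition self_adjoint :: "'a::complex_hilbert set \<Rightarrow> ('a \<Rightarrow> 'a) \<Rightarrow> bool" where
  "self_adjoint d A \<longleftrightarrow>
     0 \<in> d \<and>
     (\<forall>x\<in>d. \<forall>y\<in>d. x + y \<in> d \<and> A (x + y) = A x + A y) \<and>
     (\<forall>c. \<forall>x\<in>d. c *\<^sub>C x \<in> d \<and> A (c *\<^sub>C x) = c *\<^sub>C A x) \<and>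
     closure d = UNIV \<and>
     (\<forall>y z. (\<forall>x\<in>d. cinner (A x) y = cinner x z) \<longleftrightarrow> y \<in> d \<and> A y = z)"

definition spectrum :: "'a::complex_hilbert set \<Rightarrow> ('a \<Rightarrow> 'a) \<Rightarrow> complex set" where
  "spectrum d A = {z. \<not> (\<exists>R :: 'a \<Rightarrow>\<^sub>L 'a. clin R \<and>
      (\<forall>y. R y \<in> d \<and> A (R y) - z *\<^sub>C R y = y) \<and>
      (\<forall>x\<in>d. R (A x - z *\<^sub>C x) = x))}"

abbreviation spec :: "('a::complex_hilbert \<Rightarrow>\<^sub>L 'a) \<Rightarrow> complex set" where
  "spec T \<equiv> spectrum UNIV (blinfun_apply T)"

definition projection_valued_measure :: "(real set \<Rightarrow> 'a::complex_hilbert \<Rightarrow>\<^sub>L 'a) \<Rightarrow> bool" where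
  "projection_valued_measure E \<longleftrightarrow>
     (\<forall>M\<in>sets borel. clin (E M) \<and> E M o\<^sub>L E M = E M \<and>
        (\<forall>x y. cinner (E M x) y = cinner x (E M y))) \<and>
     E UNIV = id_blinfun \<and>
     (\<forall>(M :: nat \<Rightarrow> real set) x. range M \<subseteq> sets borel \<longrightarrow> disjoint_family M \<longrightarrow>
        (\<lambda>n. E (M n) x) sums E (\<Union>n. M n) x)"

definition scalar_measure :: "(real set \<Rightarrow> 'a::complex_hilbert \<Rightarrow>\<^sub>L 'a) \<Rightarrow> 'a \<Rightarrow> real measure" where
  "scalar_measure E x = measure_of UNIV (sets borel) (\<lambda>M. ennreal (Re (cinner (E M x) x)))"

text \<open>\<open>A = \<integral> t E(dt)\<close>, stated for the quadratic form; by polarization this determines \<open>A\<close>.\<close>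

definition spectral_measure_of ::
  "'a::complex_hilbert set \<Rightarrow> ('a \<Rightarrow> 'a) \<Rightarrow> (real set \<Rightarrow> 'a \<Rightarrow>\<^sub>L 'a) \<Rightarrow> bool" where
  "spectral_measure_of d A E \<longleftrightarrow>
     projection_valued_measure E \<and>
     (\<forall>x. x \<in> d \<longleftrightarrow> integrable (scalar_measure E x) (\<lambda>t. t\<^sup>2)) \<and>
     (\<forall>x\<in>d. cinner (A x) x = complex_of_real (\<integral>t. t \<partial>scalar_measure E x))"

definition abs_continuous_spectral :: "(real set \<Rightarrow> 'a::complex_hilbert \<Rightarrow>\<^sub>L 'a) \<Rightarrow> bool" where
  "abs_continuous_spectral E \<longleftrightarrow> (\<forall>x. absolutely_continuous lborel (scalar_measure E x))"

section \<open>Strong operator integrals with respect to a spectral measure\<close>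

text \<open>\<open>J = \<integral>\<^bsub>[a,b)\<^esub> E(d\<mu>) F(\<mu>)\<close> as the strong limit of Riemann--Stieltjes sums when the mesh of the
  tagged partition tends to \<open>0\<close>.\<close>

definition has_strong_integral_compact ::
  "(real set \<Rightarrow> 'a::complex_hilbert \<Rightarrow>\<^sub>L 'a) \<Rightarrow> (real \<Rightarrow> 'b::complex_hilbert \<Rightarrow>\<^sub>L 'a) \<Rightarrow>
    real \<Rightarrow> real \<Rightarrow> ('b \<Rightarrow>\<^sub>L 'a) \<Rightarrow> bool" where
  "has_strong_integral_compact E F a b J \<longleftrightarrow>
    (\<forall>u. \<forall>e>0. \<exists>\<delta>>0. \<forall>(n::nat) (t :: nat \<Rightarrow> real) (\<xi> :: nat \<Rightarrow> real).
       t 0 = a \<and> t n = b \<and>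
       (\<forall>i<n. t i \<le> \<xi> i \<and> \<xi> i < t (Suc i) \<and> t (Suc i) - t i < \<delta>) \<longrightarrow>
       norm ((\<Sum>i<n. E {t i..<t (Suc i)} (F (\<xi> i) u)) - J u) < e)"

definition has_strong_integral ::
  "(real set \<Rightarrow> 'a::complex_hilbert \<Rightarrow>\<^sub>L 'a) \<Rightarrow> (real \<Rightarrow> 'b::complex_hilbert \<Rightarrow>\<^sub>L 'a) \<Rightarrow>
    ereal \<Rightarrow> ereal \<Rightarrow> ('b \<Rightarrow>\<^sub>L 'a) \<Rightarrow> bool" where
  "has_strong_integral E F m1 m2 Y \<longleftrightarrow>
    (\<exists>J :: real \<Rightarrow> real \<Rightarrow> 'b \<Rightarrow>\<^sub>L 'a.
      (\<forall>a b. m1 < ereal a \<and> a < b \<and> ereal b < m2 \<longrightarrow>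
         has_strong_integral_compact E F a b (J a b)) \<and>
      (\<forall>u. \<forall>e>0. \<exists>a0 b0. m1 < ereal a0 \<and> a0 < b0 \<and> ereal b0 < m2 \<and>
         (\<forall>a b. m1 < ereal a \<and> a \<le> a0 \<and> b0 \<le> b \<and> ereal b < m2 \<longrightarrow>
            norm (J a b u - Y u) < e)))"

section \<open>The operator function \<open>K\<^sub>B\<close>\<close>

definition K_B :: "('b::complex_hilbert \<Rightarrow>\<^sub>L 'a::complex_hilbert) \<Rightarrow>
    (real set \<Rightarrow> 'a \<Rightarrow>\<^sub>L 'a) \<Rightarrow> real \<Rightarrow> 'b \<Rightarrow>\<^sub>L 'b" where
  "K_B B E \<mu> = adj B o\<^sub>L E {..<\<mu>} o\<^sub>L B"

definition interval0 :: "ereal \<Rightarrow> ereal \<Rightarrow> real set" where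
  "interval0 m1 m2 = {\<mu>. m1 < ereal \<mu> \<and> ereal \<mu> < m2}"

definition domain_side :: "complex set \<Rightarrow> int \<Rightarrow> complex set" where
  "domain_side D l = (if l = 1 then cnj ` D else D)"

text \<open>\<open>K'\<close> is a single function carrying the derivative of \<open>K\<^sub>B\<close> on \<open>\<Delta>\<^sub>0\<close> and its continuation to
  \<open>D\<^sup>-\<close> and \<open>D\<^sup>+\<close>; its values elsewhere are irrelevant. Here \<open>D\<close> is \<open>D\<^sup>-\<close>.\<close>

definition K_continuation :: "('b::complex_hilbert \<Rightarrow>\<^sub>L 'a::complex_hilbert) \<Rightarrow>
    (real set \<Rightarrow> 'a \<Rightarrow>\<^sub>L 'a) \<Rightarrow> ereal \<Rightarrow> ereal \<Rightarrow> complex set \<Rightarrow> (complex \<Rightarrow> 'b \<Rightarrow>\<^sub>L 'b) \<Rightarrow> bool" where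
  "K_continuation B E m1 m2 D K' \<longleftrightarrow>
     (\<forall>t\<in>interval0 m1 m2. (K_B B E has_vector_derivative K' (complex_of_real t)) (at t)) \<and>
     op_analytic_on K' (complex_of_real ` interval0 m1 m2 \<union> D \<union> cnj ` D) \<and>
     (\<forall>\<mu>\<in>D \<union> cnj ` D. adj (K' \<mu>) = K' (cnj \<mu>))"

definition endpoint_bound ::
  "(complex \<Rightarrow> 'b::complex_hilbert \<Rightarrow>\<^sub>L 'b) \<Rightarrow> complex set \<Rightarrow> ereal \<Rightarrow> bool" where
  "endpoint_bound K' D m \<longleftrightarrow>
     (\<bar>m\<bar> \<noteq> \<infinity> \<longrightarrow>
       (\<exists>C>0. \<exists>g. -1 < g \<and> g \<le> 0 \<and> (\<exists>\<delta>>0. \<forall>\<mu>\<in>D \<union> cnj ` D.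
          dist \<mu> (complex_of_real (real_of_ereal m)) < \<delta> \<longrightarrow>
          norm (K' \<mu>) \<le> C * dist \<mu> (complex_of_real (real_of_ereal m)) powr g)))"

text \<open>Only relevant at an infinite end point: the Phragmen--Lindelof growth condition for a half-plane.
  Without a bound of this kind the contour integrals over \<open>\<Delta>\<^sub>0\<close> and over an admissible contour can
  differ, although both converge absolutely, because a function holomorphic between two curves tending
  to infinity may be integrable on each of them and still grow doubly exponentially in between.\<close>

definition infinity_bound ::
  "(complex \<Rightarrow> 'b::complex_hilbert \<Rightarrow>\<^sub>L 'b) \<Rightarrow> complex set \<Rightarrow> ereal \<Rightarrow> bool" where
  "infinity_bound K' D m \<longleftrightarrow>
     (\<bar>m\<bar> = \<infinity> \<longrightarrow>
       (\<exists>C>0. \<exists>\<alpha><1. \<exists>R. \<forall>\<mu>\<in>D \<union> cnj ` D.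
          R < cmod \<mu> \<longrightarrow> norm (K' \<mu>) \<le> C * exp (cmod \<mu> powr \<alpha>)))"

section \<open>Admissible contours\<close>

definition end_filter :: "ereal \<Rightarrow> complex filter" where
  "end_filter m = (if \<bar>m\<bar> = \<infinity> then at_infinity else nhds (complex_of_real (real_of_ereal m)))"

text \<open>Every locally rectifiable open arc has a locally Lipschitz parametrization by \<open>(0,1)\<close>,
  namely arc length followed by a smooth change of parameter. The arc has finite length inside every disk,
  hence finite total length if both end points are finite. The homotopy \<open>h\<close> starts from a monotone
  parametrization of \<open>\<Delta>\<^sub>0\<close>, fixes the end points, and stays in \<open>D \<union> \<Delta>\<^sub>0\<close>, where \<open>K\<^sub>B'\<close> is analytic.\<close>

definition deformation_of_interval ::
  "complex set \<Rightarrow> ereal \<Rightarrow> ereal \<Rightarrow> (real \<Rightarrow> complex) \<Rightarrow> bool" where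
  "deformation_of_interval D m1 m2 \<gamma> \<longleftrightarrow>
     (\<exists>(h :: real \<times> real \<Rightarrow> complex) (\<phi> :: real \<Rightarrow> real).
        continuous_on ({0<..<1} \<times> {0..1}) h \<and>
        h ` ({0<..<1} \<times> {0..1}) \<subseteq> D \<union> complex_of_real ` interval0 m1 m2 \<and>
        strict_mono_on {0<..<1} \<phi> \<and> \<phi> ` {0<..<1} = interval0 m1 m2 \<and>
        (\<forall>s\<in>{0<..<1}. h (s, 0) = complex_of_real (\<phi> s) \<and> h (s, 1) = \<gamma> s) \<and>
        filterlim h (end_filter m1) (at_right 0 \<times>\<^sub>F principal {0..1}) \<and>
        filterlim h (end_filter m2) (at_left 1 \<times>\<^sub>F principal {0..1}))"

definition contour :: "complex set \<Rightarrow> ereal \<Rightarrow> ereal \<Rightarrow> (real \<Rightarrow> complex) \<Rightarrow> bool" where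
  "contour D m1 m2 \<gamma> \<longleftrightarrow>
     (\<forall>a b. 0 < a \<and> b < 1 \<longrightarrow> (\<exists>L. L-lipschitz_on {a..b} \<gamma>)) \<and>
     (\<forall>R. (\<lambda>t. norm (vector_derivative \<gamma> (at t))) integrable_on {t\<in>{0<..<1}. norm (\<gamma> t) \<le> R}) \<and>
     inj_on \<gamma> {0<..<1} \<and>
     \<gamma> ` {0<..<1} \<subseteq> D \<and>
     deformation_of_interval D m1 m2 \<gamma>"

definition V0_integrand ::
  "(complex \<Rightarrow> 'b::complex_hilbert \<Rightarrow>\<^sub>L 'b) \<Rightarrow> (real \<Rightarrow> complex) \<Rightarrow> real \<Rightarrow> real" where
  "V0_integrand K' \<gamma> t = norm (K' (\<gamma> t)) * norm (vector_derivative \<gamma> (at t))"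

definition V0 :: "(complex \<Rightarrow> 'b::complex_hilbert \<Rightarrow>\<^sub>L 'b) \<Rightarrow> (real \<Rightarrow> complex) \<Rightarrow> real" where
  "V0 K' \<gamma> = integral {0<..<1} (V0_integrand K' \<gamma>)"

definition admissible_contour :: "(complex \<Rightarrow> 'b::complex_hilbert \<Rightarrow>\<^sub>L 'b) \<Rightarrow>
    complex set \<Rightarrow> ereal \<Rightarrow> ereal \<Rightarrow> (real \<Rightarrow> complex) \<Rightarrow> bool" where
  "admissible_contour K' D m1 m2 \<gamma> \<longleftrightarrow>
     contour D m1 m2 \<gamma> \<and> V0_integrand K' \<gamma> integrable_on {0<..<1}"

definition contour_dist :: "('b::complex_hilbert \<Rightarrow>\<^sub>L 'b) \<Rightarrow> (real \<Rightarrow> complex) \<Rightarrow> real" where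
  "contour_dist A1 \<gamma> = setdist (spec A1) (\<gamma> ` {0<..<1})"

text \<open>\<open>W = W\<^sub>1(Z,\<Gamma>)\<close>. The integral converges in operator norm.\<close>

definition has_W1 :: "(complex \<Rightarrow> 'b::complex_hilbert \<Rightarrow>\<^sub>L 'b) \<Rightarrow> (real \<Rightarrow> complex) \<Rightarrow>
    ('b \<Rightarrow>\<^sub>L 'b) \<Rightarrow> ('b \<Rightarrow>\<^sub>L 'b) \<Rightarrow> bool" where
  "has_W1 K' \<gamma> Z W \<longleftrightarrow>
     spec Z \<inter> \<gamma> ` {0<..<1} = {} \<and>
     ((\<lambda>t. cmul (vector_derivative \<gamma> (at t)) o\<^sub>L K' (\<gamma> t) o\<^sub>L inv_op (Z - cmul (\<gamma> t)))
        has_integral (- W)) {0<..<1}"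

definition basic_solution :: "(complex \<Rightarrow> 'b::complex_hilbert \<Rightarrow>\<^sub>L 'b) \<Rightarrow> (real \<Rightarrow> complex) \<Rightarrow>
    ('b \<Rightarrow>\<^sub>L 'b) \<Rightarrow> ('b \<Rightarrow>\<^sub>L 'b) \<Rightarrow> bool" where
  "basic_solution K' \<gamma> A1 X \<longleftrightarrow>
     clin X \<and> has_W1 K' \<gamma> (A1 + X) X \<and>
     norm X \<le> contour_dist A1 \<gamma> / 2 - sqrt ((contour_dist A1 \<gamma>)\<^sup>2 / 4 - V0 K' \<gamma>)"

end

theory Submission
  imports Defs "HOL-Complex_Analysis.Complex_Analysis" "HOL-Real_Asymp.Real_Asymp"
begin

text \<open>
  Write \<open>\<langle>x,y\<rangle>\<close> for the inner product and suppose that \<open>\<parallel>Y\<parallel> < 1\<close>. Formally \<open>Y\<close> solves the Riccati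
  equation \<open>Y Z - A\<^sub>0 Y = B\<close>, and \<open>X = - B\<^sup>* Y\<close>. Both facts enter through quadratic forms:

    (1)  \<open>Im \<langle>Y Z x, Y x\<rangle> = Im \<langle>B x, Y x\<rangle>\<close>,      (2)  \<open>\<langle>X x, x\<rangle> = - \<langle>Y x, B x\<rangle>\<close>.

  Since \<open>Z = A\<^sub>1 + X\<close> with \<open>A\<^sub>1\<close> self-adjoint, they say that \<open>\<langle>Z x, x\<rangle> - \<langle>Y Z x, Y x\<rangle>\<close> is real, that is,
  \<open>Z\<close> is symmetric for the form \<open>\<langle>x,y\<rangle> - \<langle>Y x,Y y\<rangle>\<close>. This form is an equivalent inner product because
  \<open>\<parallel>Y\<parallel> < 1\<close>, so \<open>Z\<close> has real spectrum (\<open>spec_real_if_contractive_graph\<close>). On the other hand \<open>X\<close> is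
  smaller than the distance from \<open>\<sigma>\<^sub>1\<close> to the contour, hence to each finite end point of \<open>\<Delta>\<^sub>0\<close>, so a real
  spectral point of \<open>Z\<close> cannot leave \<open>\<Delta>\<^sub>0\<close> (\<open>real_spec_in_interval\<close>). But \<open>\<Delta>\<^sub>0\<close> lies in the closure
  of \<open>D\<^sup>l\<close>, from which the spectrum of \<open>Z\<close> has positive distance; and this spectrum is not empty, since
  the distance to the empty set is \<open>0\<close> by convention. The contradiction proves the theorem.

  Identity (1) is seen on the Riemann sums of \<open>Y\<close> (\<open>strong_integral_form_real\<close>): the spectral projections
  of disjoint intervals are orthogonal and \<open>(Z - \<xi>)\<^sup>-\<^sup>1 Z = 1 + \<xi> (Z - \<xi>)\<^sup>-\<^sup>1\<close>, so the two inner
  products differ by a real combination of squared norms.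

  Identity (2) is Cauchy's theorem for \<open>f(\<mu>) = \<langle>K'(\<mu>) (Z - \<mu>)\<^sup>-\<^sup>1 x, x\<rangle>\<close>, which is analytic on
  \<open>D\<^sup>l \<union> \<Delta>\<^sub>0\<close>: its integral along \<open>\<Delta>\<^sub>0\<close> is \<open>\<langle>Y x, B x\<rangle>\<close> (\<open>strong_integral_eq_integral\<close>) and its integral
  along the contour is \<open>- \<langle>X x, x\<rangle>\<close>. The two paths are joined by a homotopy \<open>h\<close> which is only
  continuous. A primitive of \<open>f\<close> is continued along \<open>h\<close> (\<open>primitive_along_rectangle_exists\<close>); its
  increment along the contour is the contour integral, because Lipschitz curves are differentiable
  almost everywhere and satisfy the fundamental theorem of calculus (\<open>contour_integral_primitive_along\<close>).

  The real difficulty is at the ends, where the paths \<open>t \<mapsto> h(s,t)\<close> may be arbitrarily long and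
  entangled. There the contour and the interval are compared along a circle \<open>\<bar>w - c\<bar> = r\<close> about a
  finite end point, or about \<open>0\<close> if the end is infinite: the level set \<open>\<bar>h - c\<bar> = r\<close> joins the two
  horizontal sides of the rectangle, and along it the continued primitive is the integral of \<open>f\<close>
  over a part of a half circle (\<open>crosscut_estimate\<close>). At a finite end point this tends to \<open>0\<close> with \<open>r\<close>.
  At an infinite one, \<open>f\<close> may grow like \<open>exp (\<bar>\<mu>\<bar>\<^sup>\<alpha>)\<close> with \<open>\<alpha> < 1\<close>; as in the Phragmen--Lindelof
  principle it is multiplied by a factor \<open>exp (- \<epsilon> u\<^sup>\<beta>)\<close> with \<open>\<alpha> < \<beta> < 1\<close>, and \<open>\<epsilon>\<close> tends to \<open>0\<close> in the end.
  On the contour this limit is harmless since \<open>f\<close> is absolutely integrable there. On \<open>\<Delta>\<^sub>0\<close> the integral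
  is only known to converge conditionally, and Abel's argument is used (\<open>abel_estimate\<close>).
\<close>

section \<open>Lipschitz functions of a real variable\<close>

text \<open>The points with arbitrarily short chords of slope below \<open>p\<close> and of slope above \<open>q\<close> around them. A
  function with bounded slopes is differentiable wherever no pair \<open>p < q\<close> of rationals has this property.\<close>

definition crossing_slopes :: "(real \<Rightarrow> real) \<Rightarrow> real \<Rightarrow> real \<Rightarrow> real set" where
  "crossing_slopes g p q = {x. \<forall>d>0.
     (\<exists>u v. u < x \<and> x < v \<and> v - u < d \<and> g v - g u < p * (v - u)) \<and>
     (\<exists>u v. u < x \<and> x < v \<and> v - u < d \<and> g v - g u > q * (v - u))}"

lemma ball_real: "ball (c::real) r = {c - r<..<c + r}"
  by (auto simp: dist_real_def)

text \<open>Vitali's covering theorem, with the intervals given by their end points and kept inside an open set.\<close>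

lemma slopes_cover:
  fixes S :: "real set"
  assumes S: "\<And>x d. x \<in> S \<Longrightarrow> d > 0 \<Longrightarrow> \<exists>u v. u < x \<and> x < v \<and> v - u < d \<and> P u v"
    and "open U" "S \<subseteq> U"
  obtains C :: "(real \<times> real) set" where "countable C" 
    "disjoint_family_on (\<lambda>(u,v). {u<..<v}) C"
    "\<And>u v. (u,v) \<in> C \<Longrightarrow> u < v \<and> P u v \<and> {u<..<v} \<subseteq> U"
    "negligible (S - (\<Union>(u,v)\<in>C. {u<..<v}))"
proof -
  let ?K = "{(u,v). u < v \<and> P u v \<and> {u<..<v} \<subseteq> U}"
  let ?a = "\<lambda>(u::real,v). (u+v)/2" and ?r = "\<lambda>(u::real,v). (v-u)/2"
  have bl: "ball (?a i) (?r i) = (case i of (u,v) \<Rightarrow> {u<..<v})" for i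
  proof (cases i)
    case (Pair u v)
    have "(u+v)/2 - (v-u)/2 = u" "(u+v)/2 + (v-u)/2 = v" by argo+
    then show ?thesis by (simp add: Pair ball_real)
  qed
  have cov: "\<exists>i. i \<in> ?K \<and> x \<in> ball (?a i) (?r i) \<and> ?r i < d" if xd: "x \<in> S" "d > 0" for x d
  proof -
    obtain e where e: "e > 0" "ball x e \<subseteq> U" using openE[OF assms(2), of x] assms(3) xd(1) by blast
    obtain u v where uv: "u < x" "x < v" "v - u < min d e" "P u v"
      using S[OF xd(1), of "min d e"] e(1) xd(2) by auto
    have "{u<..<v} \<subseteq> ball x e" using uv by (auto simp: ball_real)
    then have "(u,v) \<in> ?K" using uv e by auto
    moreover have "x \<in> ball (?a (u,v)) (?r (u,v))" unfolding bl using uv by auto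
    moreover have "?r (u,v) < d" using uv by auto
    ultimately show ?thesis by blast
  qed
  obtain C where C: "countable C" "C \<subseteq> ?K"
     "pairwise (\<lambda>i j. disjnt (ball (?a i) (?r i)) (ball (?a j) (?r j))) C"
     "negligible (S - (\<Union>i \<in> C. ball (?a i) (?r i)))"
    by (rule Vitali_covering_theorem_balls [OF cov])
  show thesis
  proof (rule that[OF C(1)])
    show "disjoint_family_on (\<lambda>(u,v). {u<..<v}) C"
      using C(3) unfolding bl disjoint_family_on_def pairwise_def disjnt_def by auto
    show "negligible (S - (\<Union>(u,v)\<in>C. {u<..<v}))" using C(4) unfolding bl by simp
    show "\<And>u v. (u,v) \<in> C \<Longrightarrow> u < v \<and> P u v \<and> {u<..<v} \<subseteq> U" using C(2) by auto
  qed
qed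

lemma lmeasurable_outer_open:
  fixes T :: "'a::euclidean_space set"
  assumes "T \<in> lmeasurable" "e > 0"
  obtains U where "open U" "T \<subseteq> U" "U \<in> lmeasurable" "measure lebesgue U < measure lebesgue T + e"
proof -
  obtain U where U: "open U" "T \<subseteq> U" "U - T \<in> lmeasurable" "emeasure lebesgue (U - T) < ennreal e"
    using sets_lebesgue_outer_open[OF fmeasurableD[OF assms(1)] assms(2)] by metis
  have "U = T \<union> (U - T)" using U(2) by blast
  then have mU: "U \<in> lmeasurable" using fmeasurable.Un[OF assms(1) U(3)] by simp
  have "measure lebesgue (U - T) < e"
    using U(3,4) assms(2) by (simp add: emeasure_eq_measure2 ennreal_less_iff)
  moreover have "measure lebesgue (U - T) = measure lebesgue U - measure lebesgue T"
    by (rule measurable_measure_Diff) (use mU assms(1) U(2) in auto)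
  ultimately show thesis using that[OF U(1,2) mU] by linarith
qed

text \<open>The hypothesis bounds the outer measure \<open>m\<close> of \<open>E\<close> by \<open>c * (m + \<epsilon>)\<close>. Outer measure is used because the
  measurability of the set where a derivative fails to exist would require a separate argument.\<close>

lemma negligible_if_outer_contraction:
  fixes E :: "real set"
  assumes fin: "\<exists>T\<in>lmeasurable. E \<subseteq> T"
    and c: "0 \<le> c" "c < 1"
    and step: "\<And>U. open U \<Longrightarrow> U \<in> lmeasurable \<Longrightarrow> E \<subseteq> U \<Longrightarrow>
       \<exists>T\<in>lmeasurable. E \<subseteq> T \<and> measure lebesgue T \<le> c * measure lebesgue U"
  shows "negligible E"
proof -
  define m where "m = Inf (measure lebesgue ` {T\<in>lmeasurable. E \<subseteq> T})"
  have ne: "measure lebesgue ` {T\<in>lmeasurable. E \<subseteq> T} \<noteq> {}" using fin by auto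
  have bd: "bdd_below (measure lebesgue ` {T\<in>lmeasurable. E \<subseteq> T})"
    by (auto intro!: bdd_belowI[of _ 0])
  have mle: "m \<le> measure lebesgue T" if "T\<in>lmeasurable" "E \<subseteq> T" for T
    unfolding m_def using that bd by (auto intro!: cInf_lower)
  have m0: "m \<ge> 0" unfolding m_def using ne by (auto intro!: cInf_greatest)
  have approx: "\<exists>T. T \<in> lmeasurable \<and> E \<subseteq> T \<and> measure lebesgue T < m + e" if "e > 0" for e
  proof -
    have "Inf (measure lebesgue ` {T\<in>lmeasurable. E \<subseteq> T}) < m + e" using that m_def by linarith
    from cInf_lessD[OF ne this] show ?thesis by blast
  qed
  have *: "m \<le> c * (m + e)" if "e > 0" for e
  proof -
    have e2: "e/2 > 0" using that by simp
    obtain T where T: "T \<in> lmeasurable" "E \<subseteq> T" "measure lebesgue T < m + e/2"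
      using approx[OF e2] by blast
    obtain U where U: "open U" "T \<subseteq> U" "U \<in> lmeasurable" "measure lebesgue U < measure lebesgue T + e/2"
      by (rule lmeasurable_outer_open[OF T(1) e2])
    have "E \<subseteq> U" using T(2) U(2) by (rule subset_trans)
    then obtain T' where T': "T' \<in> lmeasurable" "E \<subseteq> T'" "measure lebesgue T' \<le> c * measure lebesgue U"
      using step[OF U(1,3)] by blast
    have "m \<le> c * measure lebesgue U" using mle[OF T'(1,2)] T'(3) by linarith
    also have "\<dots> \<le> c * (m + e)" by (rule mult_left_mono) (use U(4) T(3) c(1) in linarith)+
    finally show ?thesis .
  qed
  have "m \<le> c * m + e" if "e > 0" for e
  proof -
    have "m \<le> c * m + c * e" using *[OF that] by (simp add: distrib_left)
    moreover have "c * e \<le> 1 * e" using c that by (intro mult_right_mono) auto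
    ultimately show ?thesis by simp
  qed
  then have "m \<le> c * m" by (rule field_le_epsilon)
  then have "(1 - c) * m \<le> 0" by (simp add: algebra_simps)
  then have "m = 0" using m0 c by (simp add: mult_le_0_iff)
  show ?thesis unfolding negligible_outer
  proof (intro allI impI)
    fix e :: real assume "e > 0"
    then show "\<exists>T. E \<subseteq> T \<and> T \<in> lmeasurable \<and> measure lebesgue T < e"
      using approx[of e] \<open>m = 0\<close> by auto
  qed
qed

lemma emeasure_interval_measure_open:
  assumes "mono g" "continuous_on UNIV g" "u < v"
  shows "emeasure (interval_measure g) {u<..<v} = ennreal (g v - g u)"
proof -
  have rc: "\<And>a. continuous (at_right a) g"
    using assms(2) by (simp add: continuous_on_eq_continuous_at continuous_at_imp_continuous_at_within)
  have "emeasure (interval_measure g) {u<..v} = ennreal (g v - g u)"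
    by (rule emeasure_interval_measure_Ioc[of u v g]) (use assms rc in \<open>auto simp: mono_def\<close>)
  moreover have "emeasure (interval_measure g) {v} = 0"
  proof -
    have "emeasure (interval_measure g) {v..v} = ennreal (g v - g v)"
      by (rule emeasure_interval_measure_Icc[of v v g]) (use assms in \<open>auto simp: mono_def intro: continuous_on_subset\<close>)
    then show ?thesis by simp
  qed
  moreover have "emeasure (interval_measure g) {u<..v} = emeasure (interval_measure g) {u<..<v} + emeasure (interval_measure g) {v}"
    using assms by (subst plus_emeasure) (auto intro!: arg_cong[where f="emeasure _"])
  ultimately show ?thesis by simp
qed

text \<open>Lebesgue's argument. Cover the set by disjoint intervals of slope below \<open>p\<close>, then, inside these, by
  disjoint intervals of slope above \<open>q\<close>. The increments of \<open>g\<close> over the second family have a sum at most that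
  over the first, so the outer measure decreases at least by the factor \<open>p / q\<close>. The Stieltjes measure of \<open>g\<close>
  does the bookkeeping of the increments.\<close>

lemma negligible_crossing_slopes:
  fixes g :: "real \<Rightarrow> real"
  assumes mono: "mono g" and cont: "continuous_on UNIV g" and "0 < p" "p < q"
  shows "negligible (crossing_slopes g p q)"
proof -
  let ?\<nu> = "interval_measure g"
  have neg: "negligible (crossing_slopes g p q \<inter> {a<..<b})" for a b
  proof (rule negligible_if_outer_contraction[where c = "p/q"])
    let ?E = "crossing_slopes g p q \<inter> {a<..<b}"
    show "\<exists>T\<in>lmeasurable. ?E \<subseteq> T" by (rule bexI[of _ "{a<..<b}"]) auto
    show "0 \<le> p/q" "p/q < 1" using assms by auto
    fix U :: "real set" assume U: "open U" "U \<in> lmeasurable" "?E \<subseteq> U"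
    have "\<exists>u v. u < x \<and> x < v \<and> v - u < d \<and> g v - g u < p * (v - u)" if "x \<in> ?E" "d > 0" for x d
      using that unfolding crossing_slopes_def by blast
    then obtain C where C: "countable C" "disjoint_family_on (\<lambda>(u,v). {u<..<v}) C"
      "\<And>u v. (u,v) \<in> C \<Longrightarrow> u < v \<and> g v - g u < p * (v - u) \<and> {u<..<v} \<subseteq> U"
      "negligible (?E - (\<Union>(u,v)\<in>C. {u<..<v}))"
      by (rule slopes_cover[OF _ U(1,3)]) blast+
    define V where "V = (\<Union>(u,v)\<in>C. {u<..<v})"
    have V: "open V" "V \<subseteq> U" using C(3) unfolding V_def by (auto intro!: open_UN)
    have "\<exists>u v. u < x \<and> x < v \<and> v - u < d \<and> g v - g u > q * (v - u)" if "x \<in> ?E \<inter> V" "d > 0" for x d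
      using that unfolding crossing_slopes_def by blast
    then obtain C' where C': "countable C'" "disjoint_family_on (\<lambda>(u,v). {u<..<v}) C'"
      "\<And>u v. (u,v) \<in> C' \<Longrightarrow> u < v \<and> g v - g u > q * (v - u) \<and> {u<..<v} \<subseteq> V"
      "negligible (?E \<inter> V - (\<Union>(u,v)\<in>C'. {u<..<v}))"
      by (rule slopes_cover[OF _ V(1), of "?E \<inter> V"]) blast+
    define W where "W = (\<Union>(u,v)\<in>C'. {u<..<v})"
    have W: "open W" "W \<subseteq> V" using C'(3) unfolding W_def by (auto intro!: open_UN)
    have sb: "V \<in> sets borel" "W \<in> sets borel" "U \<in> sets borel" using V W U by auto
    have emV: "emeasure M V = (\<integral>\<^sup>+i. emeasure M (case i of (u,v) \<Rightarrow> {u<..<v}) \<partial>count_space C)"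
      and emW: "emeasure M W = (\<integral>\<^sup>+i. emeasure M (case i of (u,v) \<Rightarrow> {u<..<v}) \<partial>count_space C')"
      if [simp]: "sets M = sets borel" for M :: "real measure"
      unfolding V_def W_def using C(1,2) C'(1,2) by (auto intro!: emeasure_UN_countable)
    have "ennreal q * emeasure lborel W = (\<integral>\<^sup>+i. ennreal q * emeasure lborel (case i of (u,v) \<Rightarrow> {u<..<v}) \<partial>count_space C')"
      unfolding emW[OF sets_lborel] by (simp add: nn_integral_cmult)
    also have "\<dots> \<le> (\<integral>\<^sup>+i. emeasure ?\<nu> (case i of (u,v) \<Rightarrow> {u<..<v}) \<partial>count_space C')"
    proof (rule nn_integral_mono, clarsimp)
      fix u v assume "(u,v) \<in> C'"
      note uv = C'(3)[OF this]
      have "ennreal q * emeasure lborel {u<..<v} = ennreal (q * (v - u))"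
        using uv assms by (simp add: ennreal_mult)
      also have "\<dots> \<le> emeasure ?\<nu> {u<..<v}"
        using uv by (simp add: emeasure_interval_measure_open[OF mono cont] ennreal_leI)
      finally show "ennreal q * emeasure lborel {u<..<v} \<le> emeasure ?\<nu> {u<..<v}" .
    qed
    also have "\<dots> = emeasure ?\<nu> W" by (rule emW[symmetric]) simp
    also have "\<dots> \<le> emeasure ?\<nu> V" using W sb by (intro emeasure_mono) auto
    also have "\<dots> = (\<integral>\<^sup>+i. emeasure ?\<nu> (case i of (u,v) \<Rightarrow> {u<..<v}) \<partial>count_space C)"
      by (rule emV) simp
    also have "\<dots> \<le> (\<integral>\<^sup>+i. ennreal p * emeasure lborel (case i of (u,v) \<Rightarrow> {u<..<v}) \<partial>count_space C)"
    proof (rule nn_integral_mono, clarsimp)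
      fix u v assume "(u,v) \<in> C"
      note uv = C(3)[OF this]
      have "emeasure ?\<nu> {u<..<v} \<le> ennreal (p * (v - u))"
        using uv by (simp add: emeasure_interval_measure_open[OF mono cont] ennreal_leI)
      also have "\<dots> = ennreal p * emeasure lborel {u<..<v}"
        using uv assms by (simp add: ennreal_mult)
      finally show "emeasure ?\<nu> {u<..<v} \<le> ennreal p * emeasure lborel {u<..<v}" .
    qed
    also have "\<dots> = ennreal p * emeasure lborel V"
      unfolding emV[OF sets_lborel] by (simp add: nn_integral_cmult)
    also have "\<dots> \<le> ennreal p * emeasure lborel U"
      using V sb by (intro mult_left_mono emeasure_mono) auto
    finally have le: "ennreal q * emeasure lborel W \<le> ennreal p * emeasure lborel U" .
    have WU: "W \<in> lmeasurable"
      by (rule fmeasurableI2[OF U(2)]) (use W V sb in auto)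
    have "ennreal (q * measure lebesgue W) \<le> ennreal (p * measure lebesgue U)"
      using le assms sb emeasure_eq_measure2[OF WU] emeasure_eq_measure2[OF U(2)]
      by (simp add: ennreal_mult emeasure_completion)
    then have "q * measure lebesgue W \<le> p * measure lebesgue U"
      using assms by (subst (asm) ennreal_le_iff) auto
    then have meas: "measure lebesgue W \<le> p / q * measure lebesgue U"
      using assms by (simp add: field_simps)
    define N where "N = (?E - V) \<union> (?E \<inter> V - W)"
    have N: "negligible N" using C(4) C'(4) unfolding N_def V_def W_def by (intro negligible_Un)
    have WN: "W \<union> N \<in> lmeasurable" "measure lebesgue (W \<union> N) = measure lebesgue W"
      using measure_Un_null_set[of W lebesgue N] WU N
      by (auto simp: negligible_iff_null_sets negligible_imp_measurable intro!: fmeasurable.Un)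
    show "\<exists>T\<in>lmeasurable. ?E \<subseteq> T \<and> measure lebesgue T \<le> p / q * measure lebesgue U"
      by (rule bexI[of _ "W \<union> N"]) (use WN meas in \<open>auto simp: N_def\<close>)
  qed
  have "negligible (\<Union>n::nat. crossing_slopes g p q \<inter> {-real n<..<real n})"
    by (intro negligible_Union_nat neg)
  moreover have "crossing_slopes g p q \<subseteq> (\<Union>n::nat. crossing_slopes g p q \<inter> {-real n<..<real n})"
  proof
    fix x assume "x \<in> crossing_slopes g p q"
    moreover obtain n where "\<bar>x\<bar> < real n" using reals_Archimedean2 by blast
    ultimately show "x \<in> (\<Union>n::nat. crossing_slopes g p q \<inter> {-real n<..<real n})"
      by (intro UN_I[of n]) auto
  qed
  ultimately show ?thesis by (rule negligible_subset)
qed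

text \<open>Chords with \<open>x\<close> strictly inside suffice: one end may be moved to \<open>x\<close> by continuity.\<close>

lemma DERIV_if_slopes_converge:
  fixes g :: "real \<Rightarrow> real"
  assumes cont: "isCont g x"
    and slopes: "\<And>e. e > 0 \<Longrightarrow> \<exists>d>0. \<forall>u v. u < x \<and> x < v \<and> v - u < d \<longrightarrow> \<bar>g v - g u - l * (v - u)\<bar> \<le> e * (v - u)"
  shows "(g has_real_derivative l) (at x)"
proof -
  have "\<exists>d>0. \<forall>y. y \<noteq> x \<and> \<bar>y - x\<bar> < d \<longrightarrow> \<bar>(g y - g x) / (y - x) - l\<bar> < e" if e: "e > 0" for e
  proof -
    obtain d where d: "d > 0" "\<And>u v. u < x \<Longrightarrow> x < v \<Longrightarrow> v - u < d \<Longrightarrow> \<bar>g v - g u - l * (v - u)\<bar> \<le> e/2 * (v - u)"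
      using slopes[of "e/2"] e by auto
    have lim: "(g \<longlongrightarrow> g x) (at_left x)" "(g \<longlongrightarrow> g x) (at_right x)"
      using cont by (auto simp: isCont_def intro: filterlim_at_split[THEN iffD1, THEN conjunct1] filterlim_at_split[THEN iffD1, THEN conjunct2])
    have R: "\<bar>g v - g x - l * (v - x)\<bar> \<le> e/2 * (v - x)" if v: "x < v" "v - x < d" for v
    proof (rule tendsto_le[OF _ _ _ ])
      show "at_left x \<noteq> bot" by simp
      show "((\<lambda>u. \<bar>g v - g u - l * (v - u)\<bar>) \<longlongrightarrow> \<bar>g v - g x - l * (v - x)\<bar>) (at_left x)"
        by (intro tendsto_intros lim)
      show "((\<lambda>u. e/2 * (v - u)) \<longlongrightarrow> e/2 * (v - x)) (at_left x)" by (intro tendsto_intros)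
      have "\<forall>\<^sub>F u in at_left x. u \<in> {v - d<..<x}" using v by (intro eventually_at_left_real) auto
      then show "\<forall>\<^sub>F u in at_left x. \<bar>g v - g u - l * (v - u)\<bar> \<le> e/2 * (v - u)"
        by eventually_elim (use d v in auto)
    qed
    have L: "\<bar>g x - g u - l * (x - u)\<bar> \<le> e/2 * (x - u)" if u: "u < x" "x - u < d" for u
    proof (rule tendsto_le[OF _ _ _ ])
      show "at_right x \<noteq> bot" by simp
      show "((\<lambda>v. \<bar>g v - g u - l * (v - u)\<bar>) \<longlongrightarrow> \<bar>g x - g u - l * (x - u)\<bar>) (at_right x)"
        by (intro tendsto_intros lim)
      show "((\<lambda>v. e/2 * (v - u)) \<longlongrightarrow> e/2 * (x - u)) (at_right x)" by (intro tendsto_intros)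
      have "\<forall>\<^sub>F v in at_right x. v \<in> {x<..<u + d}" using u by (intro eventually_at_right_real) auto
      then show "\<forall>\<^sub>F v in at_right x. \<bar>g v - g u - l * (v - u)\<bar> \<le> e/2 * (v - u)"
        by eventually_elim (use d u in auto)
    qed
    have "\<bar>(g y - g x) / (y - x) - l\<bar> < e" if y: "y \<noteq> x" "\<bar>y - x\<bar> < d" for y
    proof -
      have b: "\<bar>g y - g x - l * (y - x)\<bar> \<le> e/2 * \<bar>y - x\<bar>"
        using R[of y] L[of y] y by (cases "x < y") (auto simp: abs_if algebra_simps split: if_splits)
      have "(g y - g x) / (y - x) - l = (g y - g x - l * (y - x)) / (y - x)" using y by (simp add: field_simps)
      then have "\<bar>(g y - g x) / (y - x) - l\<bar> = \<bar>g y - g x - l * (y - x)\<bar> / \<bar>y - x\<bar>" by (simp add: abs_divide)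
      also have "\<dots> \<le> e/2" using b y by (simp add: divide_le_eq)
      finally show ?thesis using e by linarith
    qed
    then show ?thesis using d(1) by blast
  qed
  then show ?thesis
    unfolding has_field_derivative_iff LIM_def by (simp add: dist_real_def) 
qed

text \<open>Adding \<open>(L + 1) x\<close> makes \<open>g\<close> increasing, with slopes between \<open>1\<close> and \<open>2 L + 1\<close>. The derivative at a point
  outside the exceptional set is the supremum of the rational lower bounds for the nearby slopes.\<close>

lemma lipschitz_ae_differentiable_real:
  fixes g :: "real \<Rightarrow> real"
  assumes lip: "L-lipschitz_on UNIV g"
  shows "negligible {x. \<not> g differentiable (at x)}"
proof -
  define h where "h x = g x + (L + 1) * x" for x
  have bd: "v - u \<le> h v - h u" "h v - h u \<le> (2 * L + 1) * (v - u)" if "u \<le> v" for u v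
  proof -
    have "\<bar>g v - g u\<bar> \<le> L * (v - u)"
      using lipschitz_onD[OF lip, of v u] that by (simp add: dist_real_def)
    then show "v - u \<le> h v - h u" "h v - h u \<le> (2 * L + 1) * (v - u)"
      unfolding h_def by (auto simp: algebra_simps abs_le_iff)
  qed
  have mono: "mono h" using bd(1) by (intro monoI) (smt (verit))
  have cg: "continuous_on UNIV g" by (rule lipschitz_on_continuous_on[OF lip])
  have ch: "continuous_on UNIV h" unfolding h_def by (intro continuous_intros cg)
  define N where "N = (\<Union>(p,q)\<in>{(p,q). p \<in> \<rat> \<and> q \<in> \<rat> \<and> 0 < p \<and> p < q}. crossing_slopes h p q)"
  have "negligible N" unfolding N_def
  proof (rule negligible_countable_Union)
    have "countable (\<rat> \<times> \<rat> :: (real \<times> real) set)" by (intro countable_SIGMA countable_rat)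
    then have "countable {(p,q). p \<in> \<rat> \<and> q \<in> \<rat> \<and> 0 < p \<and> p < (q::real)}"
      by (rule countable_subset[rotated]) auto
    then show "countable ((\<lambda>(p,q). crossing_slopes h p q) ` {(p,q). p \<in> \<rat> \<and> q \<in> \<rat> \<and> 0 < p \<and> p < q})"
      by (rule countable_image)
  qed (auto intro: negligible_crossing_slopes[OF mono ch])
  moreover have "g differentiable (at x)" if x: "x \<notin> N" for x
  proof -
    define A where "A = {p. p \<in> \<rat> \<and> 0 < p \<and> (\<exists>d>0. \<forall>u v. u < x \<and> x < v \<and> v - u < d \<longrightarrow> p * (v - u) \<le> h v - h u)}"
    have dich: "(\<exists>d>0. \<forall>u v. u < x \<and> x < v \<and> v - u < d \<longrightarrow> h v - h u \<le> q * (v - u))"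
      if "p \<in> \<rat>" "q \<in> \<rat>" "0 < p" "p < q" "p \<notin> A" for p q
    proof -
      have "x \<notin> crossing_slopes h p q" using x that unfolding N_def by auto
      then show ?thesis using that unfolding crossing_slopes_def A_def by (smt (verit) mem_Collect_eq)
    qed
    have one: "1 \<in> A" unfolding A_def using bd(1) by (auto intro!: exI[of _ 1])
    have up: "p \<le> 2 * L + 1" if p: "p \<in> A" for p
    proof -
      obtain d where d: "d > 0" "\<And>u v. u < x \<Longrightarrow> x < v \<Longrightarrow> v - u < d \<Longrightarrow> p * (v - u) \<le> h v - h u"
        using p unfolding A_def by auto
      have "p * ((x + d/3) - (x - d/3)) \<le> h (x + d/3) - h (x - d/3)" using d by (intro d(2)) auto
      also have "\<dots> \<le> (2 * L + 1) * ((x + d/3) - (x - d/3))" using d by (intro bd(2)) auto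
      finally show ?thesis using d(1) by (simp add: mult_le_cancel_right)
    qed
    have bdd: "bdd_above A" using up by (auto intro!: bdd_aboveI)
    define l where "l = Sup A"
    have l1: "1 \<le> l" unfolding l_def by (rule cSup_upper[OF one bdd])
    have "(h has_real_derivative l) (at x)"
    proof (rule DERIV_if_slopes_converge)
      show "isCont h x" using ch by (simp add: continuous_on_eq_continuous_at)
      fix e :: real assume e: "e > 0"
      obtain p where p: "p \<in> A" "l - e < p"
        using less_cSupD[of A "l - e"] one e unfolding l_def by auto
      obtain d1 where d1: "d1 > 0" "\<And>u v. u < x \<Longrightarrow> x < v \<Longrightarrow> v - u < d1 \<Longrightarrow> p * (v - u) \<le> h v - h u"
        using p unfolding A_def by auto
      obtain p' where p': "p' \<in> \<rat>" "l < p'" "p' < l + e" using Rats_dense_in_real[of l "l + e"] e by auto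
      obtain q' where q': "q' \<in> \<rat>" "p' < q'" "q' < l + e" using Rats_dense_in_real[of p' "l + e"] p' by auto
      have "p' \<notin> A" using cSup_upper[OF _ bdd, of p'] p' unfolding l_def by auto
      then obtain d2 where d2: "d2 > 0" "\<And>u v. u < x \<Longrightarrow> x < v \<Longrightarrow> v - u < d2 \<Longrightarrow> h v - h u \<le> q' * (v - u)"
        using dich[OF p'(1) q'(1)] p' q' l1 by auto
      have "\<bar>h v - h u - l * (v - u)\<bar> \<le> e * (v - u)" if uv: "u < x" "x < v" "v - u < min d1 d2" for u v
      proof -
        have "(l - e) * (v - u) \<le> p * (v - u)" "q' * (v - u) \<le> (l + e) * (v - u)"
          using p q' uv by (auto intro!: mult_right_mono)
        then show ?thesis using d1(2)[of u v] d2(2)[of u v] uv by (simp add: algebra_simps abs_le_iff)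
      qed
      then show "\<exists>d>0. \<forall>u v. u < x \<and> x < v \<and> v - u < d \<longrightarrow> \<bar>h v - h u - l * (v - u)\<bar> \<le> e * (v - u)"
        using d1(1) d2(1) by (intro exI[of _ "min d1 d2"]) auto
    qed
    then have "((\<lambda>x. h x - (L + 1) * x) has_real_derivative l - (L + 1)) (at x)"
      by (auto intro!: derivative_eq_intros)
    moreover have "(\<lambda>x. h x - (L + 1) * x) = g" by (simp add: h_def fun_eq_iff)
    ultimately show ?thesis using real_differentiable_def by auto
  qed
  ultimately show ?thesis by (rule_tac negligible_subset[of N]) auto
qed

lemma lipschitz_ae_differentiable_complex:
  fixes g :: "real \<Rightarrow> complex"
  assumes lip: "L-lipschitz_on {a..b} g"
  shows "negligible {x\<in>{a<..<b}. \<not> g differentiable (at x)}"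
proof (cases "a < b")
  case True
  define r where "r x = max a (min b x)" for x :: real
  have rr: "r x \<in> {a..b}" "\<bar>r x - r y\<bar> \<le> \<bar>x - y\<bar>" for x y using True unfolding r_def by auto
  have L0: "0 \<le> L" using lip by (rule lipschitz_on_nonneg)
  have lipG: "cmod (g (r x) - g (r y)) \<le> L * \<bar>x - y\<bar>" for x y
  proof -
    have "cmod (g (r x) - g (r y)) \<le> L * \<bar>r x - r y\<bar>"
      using lipschitz_onD[OF lip rr(1) rr(1), of x y] by (simp add: dist_norm)
    also have "\<dots> \<le> L * \<bar>x - y\<bar>" using rr(2) L0 by (rule mult_left_mono)
    finally show ?thesis .
  qed
  have "L-lipschitz_on UNIV (\<lambda>x. Re (g (r x)))"
    by (rule lipschitz_onI[OF _ L0])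
      (metis abs_Re_le_cmod dist_real_def lipG minus_complex.simps(1) order_trans)
  then have n1: "negligible {x. \<not> (\<lambda>x. Re (g (r x))) differentiable (at x)}"
    by (rule lipschitz_ae_differentiable_real)
  have "L-lipschitz_on UNIV (\<lambda>x. Im (g (r x)))"
    by (rule lipschitz_onI[OF _ L0])
      (metis abs_Im_le_cmod dist_real_def lipG minus_complex.simps(2) order_trans)
  then have n2: "negligible {x. \<not> (\<lambda>x. Im (g (r x))) differentiable (at x)}"
    by (rule lipschitz_ae_differentiable_real)
  have "g differentiable (at x)" if x: "x \<in> {a<..<b}"
    and d: "(\<lambda>x. Re (g (r x))) differentiable (at x)" "(\<lambda>x. Im (g (r x))) differentiable (at x)" for x
  proof -
    obtain p q where pq: "((\<lambda>x. Re (g (r x))) has_real_derivative p) (at x)" "((\<lambda>x. Im (g (r x))) has_real_derivative q) (at x)"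
      using d by (auto simp: real_differentiable_def)
    have "((\<lambda>x. complex_of_real (Re (g (r x))) + \<i> * complex_of_real (Im (g (r x)))) has_vector_derivative (of_real p + \<i> * of_real q)) (at x)"
      using pq
      by (intro has_vector_derivative_add has_vector_derivative_mult_right has_vector_derivative_of_real)
    then have "((\<lambda>x. g (r x)) has_vector_derivative (of_real p + \<i> * of_real q)) (at x)"
      by (simp add: complex_eq[symmetric])
    then have "(g has_vector_derivative (of_real p + \<i> * of_real q)) (at x)"
      by (rule has_vector_derivative_transform_within_open[of _ _ _ "{a<..<b}"]) (use x in \<open>auto simp: r_def\<close>)
    then show ?thesis by (rule differentiableI_vector)
  qed
  then show ?thesis
    by (intro negligible_subset[OF negligible_Un[OF n1 n2]]) auto
qed auto

text \<open>The difference quotients are bounded by \<open>L\<close> and converge almost everywhere to \<open>k\<close>. By dominated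
  convergence, the integral of \<open>k\<close> is the limit of their integrals, which are difference quotients of a
  primitive \<open>P\<close> of \<open>g\<close> at \<open>b\<close> and \<open>a\<close>.\<close>

lemma fundamental_theorem_of_calculus_lipschitz:
  fixes g :: "real \<Rightarrow> 'a::euclidean_space"
  assumes ab: "a \<le> b" and lip: "L-lipschitz_on {a..b} g" and N: "negligible N"
    and der: "\<And>t. t \<in> {a<..<b} - N \<Longrightarrow> (g has_vector_derivative k t) (at t)"
  shows "(k has_integral (g b - g a)) {a..b}"
proof -
  define G where "G x = g (max a (min b x))" for x :: real
  have L0: "0 \<le> L" using lip by (rule lipschitz_on_nonneg)
  have lipG: "norm (G x - G y) \<le> L * \<bar>x - y\<bar>" for x y
  proof -
    have "norm (G x - G y) \<le> L * \<bar>max a (min b x) - max a (min b y)\<bar>"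
      using lipschitz_onD[OF lip, of "max a (min b x)" "max a (min b y)"] ab by (simp add: dist_norm G_def)
    also have "\<dots> \<le> L * \<bar>x - y\<bar>" by (rule mult_left_mono[OF _ L0]) auto
    finally show ?thesis .
  qed
  have "L-lipschitz_on UNIV G" by (rule lipschitz_onI[OF _ L0]) (simp add: dist_norm lipG)
  then have contG: "continuous_on S G" for S by (rule continuous_on_subset[OF lipschitz_on_continuous_on]) simp
  define P where "P t = integral {a - 1..t} G" for t
  have derP: "(P has_vector_derivative G t) (at t)" if t: "t \<in> {a - 1<..<b + 2}" for t
  proof -
    have "(P has_vector_derivative G t) (at t within {a - 1..b + 2})"
      unfolding P_def using t by (intro integral_has_vector_derivative contG) auto
    then show ?thesis using t at_within_Icc_at[of "a - 1" t "b + 2"] by simp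
  qed
  define h where "h n = inverse (real (Suc n))" for n
  have h1: "0 < h n" for n unfolding h_def by (rule positive_imp_inverse_positive) (rule of_nat_0_less_iff[THEN iffD2, OF zero_less_Suc])
  have h2: "h n \<le> 1" for n unfolding h_def by (rule inverse_le_1_iff[THEN iffD2]) simp
  note h = h1 h2
  have h0: "h \<longlonglongrightarrow> 0" unfolding h_def by (rule LIMSEQ_inverse_real_of_nat)
  have hn: "h n \<noteq> 0" for n using h(1)[of n] by (rule less_imp_neq[symmetric])
  have h_at: "filterlim h (at 0) sequentially"
    by (rule filterlim_atI[OF h0]) (rule always_eventually, rule allI, rule hn)
  have quot: "(\<lambda>n. (F (t + h n) - F t) /\<^sub>R h n) \<longlonglongrightarrow> F'" if "(F has_vector_derivative F') (at t)" for F :: "real \<Rightarrow> 'a" and F' t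
  proof -
    have "((\<lambda>x. (F (t + x) - F t) /\<^sub>R x) \<longlongrightarrow> F') (at 0)"
    proof -
      have "((\<lambda>h. norm (F (t + h) - F t - h *\<^sub>R F') / norm h) \<longlongrightarrow> 0) (at 0)"
        using that unfolding has_vector_derivative_def has_derivative_at by blast
      moreover have "norm (F (t + h) - F t - h *\<^sub>R F') / norm h = norm ((F (t + h) - F t) /\<^sub>R h - F')" if "h \<noteq> 0" for h
      proof -
        have "(F (t + h) - F t) /\<^sub>R h - F' = (F (t + h) - F t - h *\<^sub>R F') /\<^sub>R h"
          using that by (simp add: scaleR_diff_right)
        then show ?thesis by (simp add: divide_inverse mult.commute)
      qed
      ultimately have "((\<lambda>h. norm ((F (t + h) - F t) /\<^sub>R h - F')) \<longlongrightarrow> 0) (at 0)"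
        by (simp cong: LIM_cong)
      then show ?thesis by (simp add: tendsto_norm_zero_iff LIM_zero_iff)
    qed
    then show ?thesis by (rule filterlim_compose[OF _ h_at])
  qed
  define f where "f n t = (G (t + h n) - G t) /\<^sub>R h n" for n t
  define A where "A = {a<..<b} - N"
  define f' where "f' n t = (if t \<in> A then f n t else 0)" for n t
  define k' where "k' t = (if t \<in> A then k t else 0)" for t
  have negA: "negligible ({a..b} - A)"
    by (rule negligible_subset[of "N \<union> {a,b}"]) (use N in \<open>auto simp: A_def\<close>)
  have intf: "(f n has_integral ((P (b + h n) - P b) /\<^sub>R h n - (P (a + h n) - P a) /\<^sub>R h n)) {a..b}" for n
  proof -
    have sh: "((\<lambda>t. P (t + h n)) has_vector_derivative G (t + h n)) (at t within {a..b})" if t: "t \<in> {a..b}" for t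
    proof -
      have "t + h n \<in> {a - 1<..<b + 2}" using h1[of n] h2[of n] t by simp
      then have "(P has_vector_derivative G (t + h n)) (at (t + h n) within (\<lambda>t. t + h n) ` {a..b})"
        by (rule has_vector_derivative_at_within[OF derP])
      moreover have "((\<lambda>t. t + h n) has_vector_derivative 1 + 0) (at t within {a..b})"
        by (intro has_vector_derivative_add has_vector_derivative_id has_vector_derivative_const)
      ultimately have "((P \<circ> (\<lambda>t. t + h n)) has_vector_derivative ((1 + 0) *\<^sub>R G (t + h n))) (at t within {a..b})"
        by (intro vector_diff_chain_within)
      then show ?thesis by (simp add: o_def)
    qed
    have "((\<lambda>t. G (t + h n)) has_integral (P (b + h n) - P (a + h n))) {a..b}"
      by (rule fundamental_theorem_of_calculus[OF ab sh])
    moreover have "(G has_integral (P b - P a)) {a..b}"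
      by (rule fundamental_theorem_of_calculus[OF ab has_vector_derivative_at_within[OF derP]]) auto
    ultimately have "((\<lambda>t. (G (t + h n) - G t) /\<^sub>R h n) has_integral (((P (b + h n) - P (a + h n)) - (P b - P a)) /\<^sub>R h n)) {a..b}"
      by (intro has_integral_cmul has_integral_diff)
    then show ?thesis unfolding f_def by (simp add: algebra_simps)
  qed
  have spike: "(f' n has_integral I) {a..b} \<longleftrightarrow> (f n has_integral I) {a..b}" for n I
    by (rule has_integral_spike_eq[OF negA]) (auto simp: f'_def)
  have f'_int: "f' n integrable_on {a..b}" for n using spike intf by blast
  have f'_le: "norm (f' n t) \<le> L" for n t
  proof -
    have "norm (f n t) = norm (G (t + h n) - G t) / h n"
      unfolding f_def using h1[of n] by (simp add: divide_inverse mult.commute)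
    also have "\<dots> \<le> L * \<bar>h n\<bar> / h n"
      using lipG[of "t + h n" t] h1[of n] by (intro divide_right_mono) auto
    finally show ?thesis using h1[of n] L0 by (simp add: f'_def)
  qed
  have f'_lim: "(\<lambda>n. f' n t) \<longlonglongrightarrow> k' t" for t
  proof (cases "t \<in> A")
    case True
    have "(g has_vector_derivative k t) (at t)" using der True unfolding A_def by blast
    then have "(G has_vector_derivative k t) (at t)"
      by (rule has_vector_derivative_transform_within_open[of _ _ _ "{a<..<b}"]) (use True in \<open>auto simp: G_def A_def\<close>)
    from quot[OF this] show ?thesis using True by (simp add: f'_def k'_def f_def)
  qed (simp add: f'_def k'_def)
  have Lint: "(\<lambda>_::real. L) integrable_on {a..b}" by (rule integrable_const_ivl)
  note lims = dominated_convergence[OF f'_int Lint f'_le f'_lim]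
  have "integral {a..b} (f' n) = (P (b + h n) - P b) /\<^sub>R h n - (P (a + h n) - P a) /\<^sub>R h n" for n
    using spike intf by (blast intro: integral_unique)
  moreover have "(\<lambda>n. (P (b + h n) - P b) /\<^sub>R h n - (P (a + h n) - P a) /\<^sub>R h n) \<longlonglongrightarrow> G b - G a"
    using ab by (intro tendsto_diff quot derP) auto
  ultimately have "integral {a..b} k' = G b - G a"
    using lims(2) LIMSEQ_unique by auto
  then have "(k' has_integral (g b - g a)) {a..b}"
    using lims(1) ab by (simp add: has_integral_iff G_def)
  then show ?thesis
    by (rule has_integral_spike[OF negA, rotated]) (auto simp: k'_def)
qed

section \<open>Primitives along a homotopy\<close>

text \<open>\<open>\<Phi>\<close> is a branch of the primitive of \<open>f\<close>, continued along the map \<open>h\<close>. It need not be a function of the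
  value of \<open>h\<close>.\<close>

definition primitive_along ::
  "(complex \<Rightarrow> complex) \<Rightarrow> ('p::metric_space \<Rightarrow> complex) \<Rightarrow> 'p set \<Rightarrow> ('p \<Rightarrow> complex) \<Rightarrow> bool" where
  "primitive_along f h A \<Phi> \<longleftrightarrow> continuous_on A h \<and>
     (\<forall>p\<in>A. \<exists>F. (\<forall>\<^sub>F w in nhds (h p). (F has_field_derivative f w) (at w)) \<and>
       (\<forall>\<^sub>F q in nhds p. q \<in> A \<longrightarrow> \<Phi> q = F (h q)))"

lemma eventually_continuous_on:
  assumes "continuous_on A h" "p \<in> A" "\<forall>\<^sub>F w in nhds (h p). P w"
  shows "\<forall>\<^sub>F q in nhds p. q \<in> A \<longrightarrow> P (h q)"
proof -
  have "(h \<longlongrightarrow> h p) (at p within A)" using assms(1,2) by (simp add: continuous_on_def)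
  then have "\<forall>\<^sub>F q in at p within A. P (h q)"
    using assms(3) by (auto simp: filterlim_iff)
  then have "\<forall>\<^sub>F q in nhds p. q \<noteq> p \<longrightarrow> q \<in> A \<longrightarrow> P (h q)" by (simp add: eventually_at_filter)
  moreover have "P (h p)" using assms(3) by (rule eventually_nhds_x_imp_x)
  ultimately show ?thesis by (auto elim!: eventually_mono)
qed

lemma local_primitives_differ_by_constant:
  assumes "\<forall>\<^sub>F w in nhds w0. (F has_field_derivative f w) (at w)"
    and "\<forall>\<^sub>F w in nhds w0. (G has_field_derivative f w) (at w)"
  shows "\<forall>\<^sub>F w in nhds w0. F w - G w = F w0 - G w0"
proof -
  have "\<forall>\<^sub>F w in nhds w0. (F has_field_derivative f w) (at w) \<and> (G has_field_derivative f w) (at w)"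
    using assms by (rule eventually_conj)
  then obtain r where r: "r > 0" "\<And>w. dist w w0 < r \<Longrightarrow> (F has_field_derivative f w) (at w) \<and> (G has_field_derivative f w) (at w)"
    by (auto simp: eventually_nhds_metric)
  have "((\<lambda>w. F w - G w) has_field_derivative 0) (at w within ball w0 r)" if "w \<in> ball w0 r" for w
  proof -
    have "((\<lambda>w. F w - G w) has_field_derivative f w - f w) (at w)"
      using r(2)[of w] that by (intro DERIV_diff) (auto simp: dist_commute)
    then show ?thesis by (simp add: has_field_derivative_at_within)
  qed
  then obtain c where "\<And>w. w \<in> ball w0 r \<Longrightarrow> F w - G w = c"
    using has_field_derivative_zero_constant[OF convex_ball, of w0 r "\<lambda>w. F w - G w"] by blast
  then have "F w - G w = F w0 - G w0" if "dist w w0 < r" for w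
    using r(1) that by (metis centre_in_ball dist_commute mem_ball)
  then show ?thesis unfolding eventually_nhds_metric using r(1) by blast
qed

lemma primitive_along_compose:
  assumes "primitive_along f h A \<Phi>" "continuous_on B j" "j ` B \<subseteq> A"
  shows "primitive_along f (\<lambda>x. h (j x)) B (\<lambda>x. \<Phi> (j x))"
  unfolding primitive_along_def
proof (intro conjI ballI)
  show "continuous_on B (\<lambda>x. h (j x))"
    by (rule continuous_on_compose2[OF _ assms(2,3)]) (use assms(1) in \<open>simp add: primitive_along_def\<close>)
  fix p assume p: "p \<in> B"
  then obtain F where F: "\<forall>\<^sub>F w in nhds (h (j p)). (F has_field_derivative f w) (at w)"
    "\<forall>\<^sub>F q in nhds (j p). q \<in> A \<longrightarrow> \<Phi> q = F (h q)"
    using assms unfolding primitive_along_def by blast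
  have "\<forall>\<^sub>F q in nhds p. q \<in> B \<longrightarrow> \<Phi> (j q) = F (h (j q))"
    using eventually_continuous_on[OF assms(2) p F(2)] by eventually_elim (use assms(3) in auto)
  then show "\<exists>F. (\<forall>\<^sub>F w in nhds (h (j p)). (F has_field_derivative f w) (at w)) \<and>
      (\<forall>\<^sub>F q in nhds p. q \<in> B \<longrightarrow> \<Phi> (j q) = F (h (j q)))" using F(1) by blast
qed

lemma primitive_along_subset:
  "primitive_along f h A \<Phi> \<Longrightarrow> B \<subseteq> A \<Longrightarrow> primitive_along f h B \<Phi>"
  using primitive_along_compose[of f h A \<Phi> B "\<lambda>x. x"] by simp

text \<open>The two branches differ by a locally constant function on \<open>A \<inter> B\<close>, hence by a constant.\<close>

lemma primitive_along_glue:
  assumes A: "closed A" and B: "closed B" and con: "connected (A \<inter> B)"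
    and \<Phi>: "primitive_along f h A \<Phi>1" "primitive_along f h B \<Phi>2"
  shows "\<exists>\<Phi>. primitive_along f h (A \<union> B) \<Phi>"
proof -
  note cont = \<Phi>[unfolded primitive_along_def, THEN conjunct1]
  have data: "\<exists>F G. (\<forall>\<^sub>F w in nhds (h p). (F has_field_derivative f w) (at w)) \<and>
      (\<forall>\<^sub>F q in nhds p. q \<in> A \<longrightarrow> \<Phi>1 q = F (h q)) \<and> (\<forall>\<^sub>F q in nhds p. q \<in> B \<longrightarrow> \<Phi>2 q = G (h q)) \<and>
      (\<forall>\<^sub>F q in nhds p. q \<in> A \<longrightarrow> F (h q) - G (h q) = \<Phi>1 p - \<Phi>2 p) \<and>
      (\<forall>\<^sub>F q in nhds p. q \<in> B \<longrightarrow> F (h q) - G (h q) = \<Phi>1 p - \<Phi>2 p)" if p: "p \<in> A \<inter> B" for p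
  proof -
    obtain F where F: "\<forall>\<^sub>F w in nhds (h p). (F has_field_derivative f w) (at w)"
      "\<forall>\<^sub>F q in nhds p. q \<in> A \<longrightarrow> \<Phi>1 q = F (h q)"
      using \<Phi>(1) p unfolding primitive_along_def by blast
    obtain G where G: "\<forall>\<^sub>F w in nhds (h p). (G has_field_derivative f w) (at w)"
      "\<forall>\<^sub>F q in nhds p. q \<in> B \<longrightarrow> \<Phi>2 q = G (h q)"
      using \<Phi>(2) p unfolding primitive_along_def by blast
    have "\<forall>\<^sub>F w in nhds (h p). F w - G w = F (h p) - G (h p)"
      by (rule local_primitives_differ_by_constant[OF F(1) G(1)])
    moreover have "F (h p) = \<Phi>1 p" using eventually_nhds_x_imp_x[OF F(2)] p by simp
    moreover have "G (h p) = \<Phi>2 p" using eventually_nhds_x_imp_x[OF G(2)] p by simp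
    ultimately have d: "\<forall>\<^sub>F w in nhds (h p). F w - G w = \<Phi>1 p - \<Phi>2 p" by simp
    show ?thesis
      using F G eventually_continuous_on[OF cont(1) _ d] eventually_continuous_on[OF cont(2) _ d] p by blast
  qed
  have "\<exists>c. \<forall>p\<in>A \<inter> B. \<Phi>1 p - \<Phi>2 p = c"
  proof (cases "A \<inter> B = {}")
    case False
    then obtain p0 where p0: "p0 \<in> A \<inter> B" by blast
    have "\<Phi>1 p - \<Phi>2 p = \<Phi>1 p0 - \<Phi>2 p0" if "p \<in> A \<inter> B" for p
    proof (rule connected_local_const[where f = "\<lambda>p. \<Phi>1 p - \<Phi>2 p", OF con that p0], rule ballI)
      fix p assume p: "p \<in> A \<inter> B"
      obtain F G where FG: "\<forall>\<^sub>F q in nhds p. q \<in> A \<longrightarrow> \<Phi>1 q = F (h q)" "\<forall>\<^sub>F q in nhds p. q \<in> B \<longrightarrow> \<Phi>2 q = G (h q)"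
        "\<forall>\<^sub>F q in nhds p. q \<in> A \<longrightarrow> F (h q) - G (h q) = \<Phi>1 p - \<Phi>2 p" using data[OF p] by blast
      have "\<forall>\<^sub>F q in nhds p. q \<in> A \<inter> B \<longrightarrow> \<Phi>1 p - \<Phi>2 p = \<Phi>1 q - \<Phi>2 q"
        using FG by eventually_elim auto
      then show "\<forall>\<^sub>F q in at p within A \<inter> B. \<Phi>1 p - \<Phi>2 p = \<Phi>1 q - \<Phi>2 q"
        unfolding eventually_at_filter by eventually_elim auto
    qed
    then show ?thesis by blast
  qed auto
  then obtain c where c: "\<And>p. p \<in> A \<Longrightarrow> p \<in> B \<Longrightarrow> \<Phi>1 p - \<Phi>2 p = c" by blast
  define \<Phi> where "\<Phi> p = (if p \<in> A then \<Phi>1 p else \<Phi>2 p + c)" for p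
  have \<Phi>A: "\<Phi> p = \<Phi>1 p" if "p \<in> A" for p using that by (simp add: \<Phi>_def)
  have \<Phi>B: "\<Phi> p = \<Phi>2 p + c" if "p \<in> B" for p using that c[of p] by (auto simp: \<Phi>_def)
  have "primitive_along f h (A \<union> B) \<Phi>" unfolding primitive_along_def
  proof (intro conjI ballI)
    show "continuous_on (A \<union> B) h" by (rule continuous_on_closed_Un[OF A B cont])
    fix p assume "p \<in> A \<union> B"
    then consider "p \<in> A \<inter> B" | "p \<in> A" "p \<notin> B" | "p \<in> B" "p \<notin> A" by blast
    then show "\<exists>F. (\<forall>\<^sub>F w in nhds (h p). (F has_field_derivative f w) (at w)) \<and>
       (\<forall>\<^sub>F q in nhds p. q \<in> A \<union> B \<longrightarrow> \<Phi> q = F (h q))"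
    proof cases
      case 1
      obtain F G where FG: "\<forall>\<^sub>F w in nhds (h p). (F has_field_derivative f w) (at w)"
        "\<forall>\<^sub>F q in nhds p. q \<in> A \<longrightarrow> \<Phi>1 q = F (h q)" "\<forall>\<^sub>F q in nhds p. q \<in> B \<longrightarrow> \<Phi>2 q = G (h q)"
        "\<forall>\<^sub>F q in nhds p. q \<in> B \<longrightarrow> F (h q) - G (h q) = \<Phi>1 p - \<Phi>2 p" using data[OF 1] by blast
      have "\<forall>\<^sub>F q in nhds p. q \<in> A \<union> B \<longrightarrow> \<Phi> q = F (h q)"
        using FG(2-4)
      proof eventually_elim
        case (elim q)
        then show ?case using c[of p] 1 \<Phi>A[of q] \<Phi>B[of q] by (auto simp: algebra_simps)
      qed
      then show ?thesis using FG(1) by blast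
    next
      case 2
      then obtain F where F: "\<forall>\<^sub>F w in nhds (h p). (F has_field_derivative f w) (at w)"
        "\<forall>\<^sub>F q in nhds p. q \<in> A \<longrightarrow> \<Phi>1 q = F (h q)"
        using \<Phi>(1) unfolding primitive_along_def by blast
      have "\<forall>\<^sub>F q in nhds p. q \<in> - B" using 2 B by (intro eventually_nhds_in_open) auto
      with F(2) have "\<forall>\<^sub>F q in nhds p. q \<in> A \<union> B \<longrightarrow> \<Phi> q = F (h q)"
        by eventually_elim (auto simp: \<Phi>A)
      then show ?thesis using F(1) by blast
    next
      case 3
      then obtain F where F: "\<forall>\<^sub>F w in nhds (h p). (F has_field_derivative f w) (at w)"
        "\<forall>\<^sub>F q in nhds p. q \<in> B \<longrightarrow> \<Phi>2 q = F (h q)"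
        using \<Phi>(2) unfolding primitive_along_def by blast
      have "\<forall>\<^sub>F q in nhds p. q \<in> - A" using 3 A by (intro eventually_nhds_in_open) auto
      with F(2) have "\<forall>\<^sub>F q in nhds p. q \<in> A \<union> B \<longrightarrow> \<Phi> q = F (h q) + c"
        by eventually_elim (auto simp: \<Phi>B)
      moreover have "\<forall>\<^sub>F w in nhds (h p). ((\<lambda>w. F w + c) has_field_derivative f w) (at w)"
        using F(1) by eventually_elim (auto intro!: derivative_eq_intros)
      ultimately show ?thesis by (intro exI[of _ "\<lambda>w. F w + c"] conjI)
    qed
  qed
  then show ?thesis by blast
qed

lemma primitive_along_local:
  assumes U: "open U" "f holomorphic_on U" and cont: "continuous_on R h" and hR: "h ` R \<subseteq> U" and p: "p \<in> R"
  shows "\<exists>e>0. \<forall>A. A \<subseteq> R \<inter> ball p e \<longrightarrow> (\<exists>\<Phi>. primitive_along f h A \<Phi>)"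
proof -
  have "h p \<in> U" using hR p by blast
  then obtain r where r: "r > 0" "ball (h p) r \<subseteq> U" by (rule openE[OF U(1)])
  have "f holomorphic_on ball (h p) r" using U(2) r(2) by (rule holomorphic_on_subset)
  then obtain F where F: "\<And>w. w \<in> ball (h p) r \<Longrightarrow> (F has_field_derivative f w) (at w within ball (h p) r)"
    using holomorphic_convex_primitive'[of "ball (h p) r" f] by auto
  have F': "(F has_field_derivative f w) (at w)" if "w \<in> ball (h p) r" for w
    using F[OF that] at_within_open[OF that open_ball] by simp
  obtain e where e: "e > 0" "\<And>q. q \<in> R \<Longrightarrow> dist q p < e \<Longrightarrow> dist (h q) (h p) < r"
    using cont p r(1) unfolding continuous_on_iff by blast
  have "primitive_along f h A (\<lambda>q. F (h q))" if A: "A \<subseteq> R \<inter> ball p e" for A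
    unfolding primitive_along_def
  proof (intro conjI ballI exI[of _ F])
    show "continuous_on A h" using cont A by (auto intro: continuous_on_subset)
    fix q assume q: "q \<in> A"
    then have "h q \<in> ball (h p) r" using A e(2)[of q] q by (auto simp: dist_commute subset_iff)
    then have "\<forall>\<^sub>F w in nhds (h q). w \<in> ball (h p) r" by (intro eventually_nhds_in_open) auto
    then show "\<forall>\<^sub>F w in nhds (h q). (F has_field_derivative f w) (at w)"
      by eventually_elim (rule F')
  qed auto
  then show ?thesis using e(1) by blast
qed

text \<open>Small rectangles are mapped into disks on which \<open>f\<close> has a primitive. They are glued first to
  thin vertical strips and then to the whole rectangle, both times by a Bolzano (bisection) argument.\<close>

lemma primitive_along_rectangle_exists:
  fixes h :: "real \<times> real \<Rightarrow> complex"
  assumes ab: "a \<le> b" and U: "open U" "f holomorphic_on U"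
    and cont: "continuous_on ({a..b} \<times> {0..1}) h" and hU: "h ` ({a..b} \<times> {0..1}) \<subseteq> U"
  shows "\<exists>\<Phi>. primitive_along f h ({a..b} \<times> {0..1}) \<Phi>"
proof -
  define box where "box s1 s2 t1 t2 = ({a..b} \<inter> {s1..s2}) \<times> ({0..1} \<inter> {t1..t2})" for s1 s2 t1 t2 :: real
  define Q where "Q s1 s2 t1 t2 \<longleftrightarrow> (\<exists>\<Phi>. primitive_along f h (box s1 s2 t1 t2) \<Phi>)" for s1 s2 t1 t2
  have cl: "closed (box s1 s2 t1 t2)" and cv: "convex (box s1 s2 t1 t2)" for s1 s2 t1 t2
    unfolding box_def by (auto intro!: closed_Times convex_Times convex_Int)
  have glue: "Q s1 s2 t1 t2 \<Longrightarrow> Q s1' s2' t1' t2' \<Longrightarrow> 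
      box s1 s2 t1 t2 \<inter> box s1' s2' t1' t2' = box x1 x2 y1 y2 \<Longrightarrow>
      box s1 s2 t1 t2 \<union> box s1' s2' t1' t2' = box u1 u2 v1 v2 \<Longrightarrow> Q u1 u2 v1 v2"
    for s1 s2 t1 t2 s1' s2' t1' t2' x1 x2 y1 y2 u1 u2 v1 v2
    unfolding Q_def using primitive_along_glue[OF cl cl, of s1 s2 t1 t2 s1' s2' t1' t2' f h]
    by (metis convex_connected cv)
  have strip: "\<exists>d>0. \<forall>s1 s2. s1 \<le> s \<and> s \<le> s2 \<and> s2 - s1 < d \<longrightarrow> Q s1 s2 0 1" if s: "a \<le> s" "s \<le> b" for s
  proof -
    define P where "P t1 t2 \<longleftrightarrow> (\<exists>d>0. \<forall>s1 s2. s1 \<le> s \<and> s \<le> s2 \<and> s2 - s1 < d \<longrightarrow> Q s1 s2 t1 t2)" for t1 t2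
    have "(0::real) \<le> 1" by simp
    then have "P 0 1"
    proof (induction rule: Bolzano)
      case trans: (trans t1 t2 t3)
      then obtain d1 d2 where d: "d1 > 0" "d2 > 0" "\<And>s1 s2. s1 \<le> s \<Longrightarrow> s \<le> s2 \<Longrightarrow> s2 - s1 < d1 \<Longrightarrow> Q s1 s2 t1 t2"
        "\<And>s1 s2. s1 \<le> s \<Longrightarrow> s \<le> s2 \<Longrightarrow> s2 - s1 < d2 \<Longrightarrow> Q s1 s2 t2 t3" unfolding P_def by blast
      have "Q s1 s2 t1 t3" if "s1 \<le> s" "s \<le> s2" "s2 - s1 < min d1 d2" for s1 s2
        by (rule glue[OF d(3)[of s1 s2] d(4)[of s1 s2], of s1 s2 t2 t2])
          (use that trans in \<open>auto simp: box_def\<close>)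
      then show ?case using d(1,2) unfolding P_def by (intro exI[of _ "min d1 d2"]) auto
    next
      case (local t)
      then obtain e where e: "e > 0" "\<And>A. A \<subseteq> ({a..b} \<times> {0..1}) \<inter> ball (s,t) e \<Longrightarrow> \<exists>\<Phi>. primitive_along f h A \<Phi>"
        using primitive_along_local[OF U cont hU, of "(s,t)"] s by auto
      have "Q s1 s2 t1 t2" if "s1 \<le> s \<and> s \<le> s2 \<and> s2 - s1 < e/2" "t1 \<le> t \<and> t \<le> t2 \<and> t2 - t1 < e/2" for s1 s2 t1 t2
        unfolding Q_def
      proof (rule e(2), rule subsetI)
        fix q assume q: "q \<in> box s1 s2 t1 t2"
        obtain x y where xy: "q = (x,y)" by (cases q)
        have "dist (s,t) q \<le> \<bar>s - x\<bar> + \<bar>t - y\<bar>"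
          unfolding xy dist_Pair_Pair dist_real_def by (metis power2_abs sqrt_sum_squares_le_sum_abs abs_abs)
        also have "\<dots> < e" using q that by (auto simp: box_def xy)
        finally show "q \<in> ({a..b} \<times> {0..1}) \<inter> ball (s,t) e" using q by (auto simp: box_def)
      qed
      then show ?case using e(1) unfolding P_def by (metis half_gt_zero)
    qed
    then show ?thesis unfolding P_def .
  qed
  have "Q a b 0 1" using ab
  proof (induction rule: Bolzano)
    case (trans s1 s2 s3)
    show ?case by (rule glue[OF trans(1,2), of s2 s2 0 1]) (use trans in \<open>auto simp: box_def\<close>)
  next
    case (local s)
    then show ?case using strip by blast
  qed
  moreover have "box a b 0 1 = {a..b} \<times> {0..1}" by (auto simp: box_def)
  ultimately show ?thesis unfolding Q_def by simp
qed

text \<open>Locally \<open>\<Phi> = F \<circ> \<gamma>\<close> with a smooth \<open>F\<close>, so \<open>\<Phi>\<close> is Lipschitz and has the derivative \<open>f(\<gamma>) \<gamma>'\<close> almost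
  everywhere.\<close>

lemma contour_integral_primitive_along:
  fixes \<gamma> :: "real \<Rightarrow> complex"
  assumes ab: "a \<le> b" and lip: "L-lipschitz_on {a..b} \<gamma>"
    and U: "open U" "continuous_on U f" "\<gamma> ` {a..b} \<subseteq> U"
    and \<Phi>: "primitive_along f \<gamma> {a..b} \<Phi>"
  shows "((\<lambda>t. f (\<gamma> t) * vector_derivative \<gamma> (at t)) has_integral (\<Phi> b - \<Phi> a)) {a..b}"
proof -
  define k where "k t = f (\<gamma> t) * vector_derivative \<gamma> (at t)" for t
  define N where "N = {x\<in>{a<..<b}. \<not> \<gamma> differentiable (at x)}"
  have N: "negligible N" unfolding N_def by (rule lipschitz_ae_differentiable_complex[OF lip])
  have "a \<le> a \<and> b \<le> b \<and> a \<le> b \<longrightarrow> (k has_integral (\<Phi> b - \<Phi> a)) {a..b}"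
    using ab
  proof (induction rule: Bolzano[where P = "\<lambda>c d. a \<le> c \<and> d \<le> b \<and> c \<le> d \<longrightarrow> (k has_integral (\<Phi> d - \<Phi> c)) {c..d}"])
    case (trans c d e)
    show ?case
    proof
      assume "a \<le> c \<and> e \<le> b \<and> c \<le> e"
      then have "(k has_integral ((\<Phi> d - \<Phi> c) + (\<Phi> e - \<Phi> d))) {c..e}"
        using trans by (intro has_integral_combine[of c d e]) auto
      then show "(k has_integral (\<Phi> e - \<Phi> c)) {c..e}" by (simp add: algebra_simps)
    qed
  next
    case (local x)
    then have x: "x \<in> {a..b}" by simp
    obtain F where F: "\<forall>\<^sub>F w in nhds (\<gamma> x). (F has_field_derivative f w) (at w)"
       "\<forall>\<^sub>F q in nhds x. q \<in> {a..b} \<longrightarrow> \<Phi> q = F (\<gamma> q)" and cont: "continuous_on {a..b} \<gamma>"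
      using \<Phi> x unfolding primitive_along_def by blast
    have "\<gamma> x \<in> U" using U(3) x by blast
    then have "\<forall>\<^sub>F w in nhds (\<gamma> x). w \<in> U \<and> (F has_field_derivative f w) (at w)"
      using F(1) U(1) by (intro eventually_conj eventually_nhds_in_open)
    then obtain r where r: "r > 0" "\<And>w. dist w (\<gamma> x) < r \<Longrightarrow> w \<in> U \<and> (F has_field_derivative f w) (at w)"
      by (auto simp: eventually_nhds_metric)
    have sub: "cball (\<gamma> x) (r/2) \<subseteq> U" using r by (auto simp: dist_commute)
    have "bounded (f ` cball (\<gamma> x) (r/2))"
      by (intro compact_imp_bounded compact_continuous_image continuous_on_subset[OF U(2) sub] compact_cball)
    then obtain M where M: "\<And>w. w \<in> cball (\<gamma> x) (r/2) \<Longrightarrow> cmod (f w) \<le> M"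
      unfolding bounded_iff by blast
    have M0: "M \<ge> 0" using M[of "\<gamma> x"] r(1) norm_ge_zero order_trans by (metis centre_in_cball less_eq_real_def half_gt_zero)
    have "\<forall>\<^sub>F w in nhds (\<gamma> x). w \<in> ball (\<gamma> x) (r/2)" using r(1) by (intro eventually_nhds_in_open) auto
    from eventually_continuous_on[OF cont x this] F(2)
    have "\<forall>\<^sub>F q in nhds x. q \<in> {a..b} \<longrightarrow> \<gamma> q \<in> ball (\<gamma> x) (r/2) \<and> \<Phi> q = F (\<gamma> q)"
      by eventually_elim auto
    then obtain e where e: "e > 0" "\<And>q. dist q x < e \<Longrightarrow> q \<in> {a..b} \<Longrightarrow> \<gamma> q \<in> ball (\<gamma> x) (r/2) \<and> \<Phi> q = F (\<gamma> q)"
      by (auto simp: eventually_nhds_metric)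
    have "(k has_integral (\<Phi> d - \<Phi> c)) {c..d}"
      if cd: "c \<le> x" "x \<le> d" "d - c < e" "a \<le> c" "d \<le> b" "c \<le> d" for c d
    proof (rule fundamental_theorem_of_calculus_lipschitz[OF cd(6) _ N])
      have q: "\<gamma> q \<in> cball (\<gamma> x) (r/2) \<and> \<Phi> q = F (\<gamma> q)" if q: "q \<in> {c..d}" for q
      proof -
        have "dist q x < e" using cd q by (simp add: dist_real_def abs_less_iff)
        then show ?thesis using e(2)[of q] cd q by simp
      qed
      have L0: "0 \<le> L" using lip by (rule lipschitz_on_nonneg)
      show "(M * L)-lipschitz_on {c..d} \<Phi>"
      proof (rule lipschitz_onI)
        fix p q assume pq: "p \<in> {c..d}" "q \<in> {c..d}"
        have "cmod (F (\<gamma> p) - F (\<gamma> q)) \<le> M * cmod (\<gamma> p - \<gamma> q)"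
        proof (rule field_differentiable_bound[OF convex_cball _ M])
          fix w assume "w \<in> cball (\<gamma> x) (r/2)"
          then have "(F has_field_derivative f w) (at w)" using r by (auto simp: dist_commute)
          then show "(F has_field_derivative f w) (at w within cball (\<gamma> x) (r/2))" by (rule has_field_derivative_at_within)
        qed (use pq q in auto)
        also have "\<dots> \<le> M * (L * dist p q)"
          using lipschitz_onD[OF lip, of p q] pq cd M0 by (intro mult_left_mono) (auto simp: dist_norm)
        finally show "dist (\<Phi> p) (\<Phi> q) \<le> M * L * dist p q" using q[OF pq(1)] q[OF pq(2)] by (simp add: dist_norm mult.assoc)
      qed (use M0 L0 in auto)
      fix t assume t: "t \<in> {c<..<d} - N"
      then have "\<gamma> differentiable (at t)" using cd by (auto simp: N_def)
      then have g: "(\<gamma> has_vector_derivative vector_derivative \<gamma> (at t)) (at t)" by (rule vector_derivative_works[THEN iffD1])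
      have "dist (\<gamma> t) (\<gamma> x) < r" using q[of t] t r(1) by (auto simp: dist_commute)
      then have "(F has_field_derivative f (\<gamma> t)) (at (\<gamma> t))" using r(2) by blast
      from field_vector_diff_chain_at[OF g this]
      have "((F \<circ> \<gamma>) has_vector_derivative k t) (at t)" by (simp add: k_def mult.commute)
      then show "(\<Phi> has_vector_derivative k t) (at t)"
        by (rule has_vector_derivative_transform_within_open[of _ _ _ "{c<..<d}"]) (use t q in auto)
    qed
    then show ?case using e(1) by blast
  qed
  then show ?thesis using ab unfolding k_def by simp
qed

section \<open>Crosscuts of a homotopy\<close>

text \<open>A zero of \<open>(u, v)\<close> is a fixed point of the map that moves \<open>p\<close> by \<open>- (u, v)\<close> and then retracts to the rectangle:
  the sign conditions exclude fixed points created by the retraction.\<close>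

lemma poincare_miranda:
  fixes u v :: "real \<times> real \<Rightarrow> real"
  assumes ab: "a \<le> b" and cont: "continuous_on ({a..b} \<times> {0..1}) u" "continuous_on ({a..b} \<times> {0..1}) v"
    and u: "\<And>t. t \<in> {0..1} \<Longrightarrow> u (a, t) < 0" "\<And>t. t \<in> {0..1} \<Longrightarrow> u (b, t) > 0"
    and v: "\<And>s. s \<in> {a..b} \<Longrightarrow> v (s, 0) < 0" "\<And>s. s \<in> {a..b} \<Longrightarrow> v (s, 1) > 0"
  shows "\<exists>p\<in>{a..b} \<times> {0..1}. u p = 0 \<and> v p = 0"
proof -
  let ?R = "{a..b} \<times> {0..1::real}"
  define T where "T p = (max a (min b (fst p - u p)), max 0 (min 1 (snd p - v p)))" for p
  have cT: "continuous_on ?R T" unfolding T_def by (intro continuous_intros cont)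
  have TR: "T \<in> ?R \<rightarrow> ?R" using ab by (auto simp: T_def)
  have R: "compact ?R" "convex ?R" by (auto intro!: compact_Times convex_Times)
  have "?R \<noteq> {}" using ab by simp
  then obtain p where p: "p \<in> ?R" "T p = p"
    using brouwer[OF R _ cT TR] by blast
  obtain x t where xt: "p = (x, t)" by (cases p)
  have x: "max a (min b (x - u (x,t))) = x" and t: "max 0 (min 1 (t - v (x,t))) = t"
    using p(2) by (auto simp: T_def xt)
  have m: "x \<in> {a..b}" "t \<in> {0..1}" using p(1) by (auto simp: xt)
  have "u (x,t) = 0"
  proof (rule ccontr)
    assume "u (x,t) \<noteq> 0"
    then have "(u (x,t) > 0 \<and> x = a) \<or> (u (x,t) < 0 \<and> x = b)" using x m(1) by (auto simp: max_def min_def split: if_splits)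
    then show False using u[OF m(2)] by auto
  qed
  moreover have "v (x,t) = 0"
  proof (rule ccontr)
    assume "v (x,t) \<noteq> 0"
    then have "(v (x,t) > 0 \<and> t = 0) \<or> (v (x,t) < 0 \<and> t = 1)" using t m(2) by (auto simp: max_def min_def split: if_splits)
    then show False using v[OF m(1)] by auto
  qed
  ultimately show ?thesis using p(1) xt by blast
qed

lemma closed_level_of_locally_constant:
  assumes "closed K" and loc: "\<And>p. p \<in> K \<Longrightarrow> \<forall>\<^sub>F q in nhds p. q \<in> K \<longrightarrow> \<Psi> q = \<Psi> p"
  shows "closed {p\<in>K. Q (\<Psi> p)}"
proof -
  have "x \<in> {p\<in>K. Q (\<Psi> p)}" if x: "x islimpt {p\<in>K. Q (\<Psi> p)}" for x
  proof -
    have "x islimpt K" using x by (rule islimpt_subset) auto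
    then have xK: "x \<in> K" using \<open>closed K\<close> unfolding closed_limpt by blast
    obtain S where S: "open S" "x \<in> S" "\<And>q. q \<in> S \<Longrightarrow> q \<in> K \<Longrightarrow> \<Psi> q = \<Psi> x"
      using loc[OF xK] by (auto simp: eventually_nhds)
    obtain q where "q \<in> {p\<in>K. Q (\<Psi> p)}" "q \<in> S" using x S unfolding islimpt_def by blast
    then show ?thesis using S(3)[of q] xK by auto
  qed
  then show ?thesis unfolding closed_limpt by blast
qed

text \<open>The level set \<open>u = 0\<close> separates the left side from the right one, so it contains a connected set which joins
  bottom and top, and a locally constant \<open>\<Psi>\<close> is constant on this set. To avoid components, let \<open>K1\<close> be the
  part of the level set where \<open>\<Psi>\<close> takes a value that it takes at the bottom, and \<open>K2\<close> the rest. If \<open>K1\<close> missed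
  the top, \<open>K1\<close> with the bottom and \<open>K2\<close> with the top would be disjoint closed sets, and \<open>u\<close> would have no
  common zero with the difference of the distances to them.\<close>

lemma level_set_crossing:
  fixes u :: "real \<times> real \<Rightarrow> real"
  assumes ab: "a \<le> b" and cont: "continuous_on ({a..b} \<times> {0..1}) u"
    and u: "\<And>t. t \<in> {0..1} \<Longrightarrow> u (a, t) < 0" "\<And>t. t \<in> {0..1} \<Longrightarrow> u (b, t) > 0"
    and loc: "\<And>p. p \<in> {a..b} \<times> {0..1} \<Longrightarrow> u p = 0 \<Longrightarrow>
       \<forall>\<^sub>F q in nhds p. q \<in> {a..b} \<times> {0..1} \<and> u q = 0 \<longrightarrow> \<Psi> q = \<Psi> p"
  shows "\<exists>s0\<in>{a..b}. \<exists>s1\<in>{a..b}. u (s0, 0) = 0 \<and> u (s1, 1) = 0 \<and> \<Psi> (s0, 0) = \<Psi> (s1, 1)"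
proof (rule ccontr)
  assume contr: "\<not> ?thesis"
  let ?R = "{a..b} \<times> {0..1::real}"
  define K where "K = {p\<in>?R. u p = 0}"
  have cR: "closed ?R" by (intro closed_Times) auto
  have clK: "closed K" unfolding K_def by (rule continuous_closed_preimage_constant[OF cont cR])
  have locK: "\<And>p. p \<in> K \<Longrightarrow> \<forall>\<^sub>F q in nhds p. q \<in> K \<longrightarrow> \<Psi> q = \<Psi> p"
    using loc unfolding K_def by simp
  define Q where "Q y \<longleftrightarrow> (\<exists>s. (s, 0) \<in> K \<and> \<Psi> (s, 0) = y)" for y
  define K1 where "K1 = {p\<in>K. Q (\<Psi> p)} \<union> {a..b} \<times> {0}"
  define K2 where "K2 = {p\<in>K. \<not> Q (\<Psi> p)} \<union> {a..b} \<times> {1}"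
  have cl: "closed K1" "closed K2" unfolding K1_def K2_def
    by (intro closed_Un closed_Times closed_level_of_locally_constant[OF clK locK] 
        closed_level_of_locally_constant[OF clK locK, where Q = "\<lambda>y. \<not> Q y"]; simp)+
  have ne: "K1 \<noteq> {}" "K2 \<noteq> {}" using ab unfolding K1_def K2_def by auto
  have disj: "K1 \<inter> K2 = {}"
  proof -
    have False if p: "p \<in> K1" "p \<in> K2" for p
    proof -
      obtain s t where st: "p = (s,t)" by (cases p)
      consider "p \<in> K" "Q (\<Psi> p)" "t = 1" | "t = 0" "p \<in> K" "\<not> Q (\<Psi> p)" 
        using p unfolding K1_def K2_def st by auto
      then show False
      proof cases
        case 1 
        then obtain s' where "(s',0) \<in> K" "\<Psi> (s',0) = \<Psi> (s,1)" unfolding Q_def st by auto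
        then show False using 1 contr unfolding st K_def by auto
      next
        case 2 then show False unfolding Q_def st by blast
      qed
    qed
    then show ?thesis by blast
  qed
  define v where "v p = infdist p K1 - infdist p K2" for p
  have v1: "v p < 0" if "p \<in> K1" for p
  proof -
    have "infdist p K1 = 0" using that by simp
    moreover have "infdist p K2 \<noteq> 0" using that disj in_closed_iff_infdist_zero[OF cl(2) ne(2), of p] by blast
    ultimately show ?thesis using infdist_nonneg[of p K2] unfolding v_def by linarith
  qed
  have v2: "v p > 0" if "p \<in> K2" for p
  proof -
    have "infdist p K2 = 0" using that by simp
    moreover have "infdist p K1 \<noteq> 0" using that disj in_closed_iff_infdist_zero[OF cl(1) ne(1), of p] by blast
    ultimately show ?thesis using infdist_nonneg[of p K1] unfolding v_def by linarith
  qed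
  have "\<exists>p\<in>?R. u p = 0 \<and> v p = 0"
  proof (rule poincare_miranda[OF ab cont _ u])
    show "continuous_on ?R v" unfolding v_def by (intro continuous_intros)
    show "v (s, 0) < 0" "v (s, 1) > 0" if "s \<in> {a..b}" for s
      using that by (auto intro!: v1 v2 simp: K1_def K2_def)
  qed
  then obtain p where "p \<in> K" "v p = 0" unfolding K_def by blast
  then have "p \<in> K1 \<or> p \<in> K2" unfolding K1_def K2_def by blast
  then show False using v1[of p] v2[of p] \<open>v p = 0\<close> by auto
qed

text \<open>\<open>G\<close> is the indefinite integral of \<open>k\<close>, extended by \<open>0\<close> outside \<open>O'\<close>. It is Lipschitz also
  across the gaps of \<open>O'\<close>. The interval \<open>[-2, 2]\<close> contains the angles \<open>[- \<pi>/2, \<pi>/2]\<close> of a half circle.\<close>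

lemma bounded_open_indicator_primitive:
  fixes k :: "real \<Rightarrow> complex"
  assumes O: "open O'" and k: "continuous_on O' k" and M: "\<And>x. x \<in> O' \<Longrightarrow> cmod (k x) \<le> M" "0 \<le> M"
  obtains G where "\<And>x. x \<in> O' \<Longrightarrow> x \<in> {-2<..<2} \<Longrightarrow> (G has_vector_derivative k x) (at x)"
    "\<And>x y. x \<in> {-2..2} \<Longrightarrow> y \<in> {-2..2} \<Longrightarrow> cmod (G x - G y) \<le> M * \<bar>x - y\<bar>"
proof -
  define g where "g x = indicator O' x *\<^sub>R k x" for x
  have gm: "g \<in> borel_measurable borel" unfolding g_def
    by (rule borel_measurable_continuous_on_indicator[OF borel_open[OF O] k])
  have gb: "cmod (g x) \<le> M" for x using M by (auto simp: g_def indicator_def)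
  have gi: "g integrable_on {c..d}" for c d
  proof (rule measurable_bounded_by_integrable_imp_integrable)
    show "g \<in> borel_measurable (lebesgue_on {c..d})"
    proof -
      have "g \<in> borel_measurable lborel" using gm by simp
      then show ?thesis by (intro measurable_restrict_space1 measurable_completion)
    qed
    show "(\<lambda>_. M) integrable_on {c..d}" by (rule integrable_const_ivl)
  qed (use gb in auto)
  define G where "G x = integral {-2..x} g" for x
  have diff: "cmod (G y - G x) \<le> M * (y - x)" if "x \<le> y" "-2 \<le> x" for x y
  proof -
    have "G y = G x + integral {x..y} g"
      unfolding G_def using that by (intro Henstock_Kurzweil_Integration.integral_combine[symmetric] gi) auto
    moreover have "cmod (integral {x..y} g) \<le> integral {x..y} (\<lambda>_. M)"
      by (rule integral_norm_bound_integral[OF gi]) (use gb in auto)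
    ultimately show ?thesis using that by (simp add: mult.commute)
  qed
  show thesis
  proof (rule that)
    show "cmod (G x - G y) \<le> M * \<bar>x - y\<bar>" if "x \<in> {-2..2}" "y \<in> {-2..2}" for x y
      using diff[of x y] diff[of y x] that by (cases "x \<le> y") (auto simp: norm_minus_commute)
    show "(G has_vector_derivative k x) (at x)" if x: "x \<in> O'" "x \<in> {-2<..<2}" for x
    proof -
      have "isCont g x"
      proof -
        have "isCont k x" using k O x(1) by (simp add: continuous_on_eq_continuous_at)
        moreover have "\<forall>\<^sub>F y in nhds x. g y = k y"
          using eventually_nhds_in_open[OF O x(1)] by eventually_elim (simp add: g_def)
        ultimately show ?thesis using isCont_cong by blast
      qed
      then have "continuous (at x within {-2..2} - {}) g" by (simp add: continuous_at_imp_continuous_at_within)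
      then have "((\<lambda>u. integral {-2..u} g) has_vector_derivative g x) (at x within {-2..2} - {})"
        using x by (intro integral_has_vector_derivative_continuous_at gi) auto
      then have "(G has_vector_derivative g x) (at x)"
        using x at_within_Icc_at[of "-2" x 2] unfolding G_def by simp
      then show ?thesis using x by (simp add: g_def)
    qed
  qed
qed

text \<open>On the half circle of radius \<open>r\<close> about \<open>c\<close>, the function \<open>f\<close> has a primitive \<open>G\<close> with respect to the angle, and
  \<open>\<Phi> - G\<close> is locally constant on the level set \<open>\<bar>h - c\<bar> = r\<close>. By \<open>level_set_crossing\<close> the level set
  contains a bottom and a top point with the same value of \<open>\<Phi> - G\<close>; between them \<open>\<Phi>\<close> changes by at most
  the length of the half circle times the bound for \<open>f\<close>. The half plane \<open>0 \<le> Re ((w - c) / \<omega>)\<close> makes the angle a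
  continuous function.\<close>

lemma crosscut_estimate:
  fixes h :: "real \<times> real \<Rightarrow> complex"
  assumes prim: "primitive_along f h ({a..b} \<times> {0..1}) \<Phi>" and ab: "a \<le> b"
    and hS: "h ` ({a..b} \<times> {0..1}) \<subseteq> S" and U: "open U" "S \<subseteq> U" "continuous_on U f"
    and r: "r > 0" and \<omega>: "cmod \<omega> = 1" "\<And>w. w \<in> S \<Longrightarrow> 0 \<le> Re ((w - c) / \<omega>)"
    and M: "\<And>w. w \<in> S \<Longrightarrow> cmod (w - c) = r \<Longrightarrow> cmod (f w) < M"
    and sides: "((\<forall>t\<in>{0..1}. cmod (h (a,t) - c) < r) \<and> (\<forall>t\<in>{0..1}. cmod (h (b,t) - c) > r)) \<or>
       ((\<forall>t\<in>{0..1}. cmod (h (a,t) - c) > r) \<and> (\<forall>t\<in>{0..1}. cmod (h (b,t) - c) < r))"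
  shows "\<exists>s0\<in>{a..b}. \<exists>s1\<in>{a..b}. cmod (h (s0, 0) - c) = r \<and> cmod (h (s1, 1) - c) = r \<and>
     cmod (\<Phi> (s1, 1) - \<Phi> (s0, 0)) \<le> 4 * r * \<bar>M\<bar>"
proof -
  let ?R = "{a..b} \<times> {0..1::real}"
  have ch: "continuous_on ?R h" using prim by (simp add: primitive_along_def)
  have \<omega>0: "\<omega> \<noteq> 0" using \<omega>(1) by auto
  define z where "z \<theta> = c + \<omega> * of_real r * exp (\<i> * of_real \<theta>)" for \<theta> :: real
  define th where "th w = Im (Ln ((w - c) / \<omega>))" for w
  have zr: "cmod (z \<theta> - c) = r" for \<theta> using r \<omega>(1) by (simp add: z_def norm_mult)
  have nonpos: "(w - c) / \<omega> \<notin> \<real>\<^sub>\<le>\<^sub>0" if "w \<in> S" "cmod (w - c) = r" for w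
  proof
    assume "(w - c) / \<omega> \<in> \<real>\<^sub>\<le>\<^sub>0"
    then have "Re ((w - c) / \<omega>) = 0" "Im ((w - c) / \<omega>) = 0" using \<omega>(2)[OF that(1)] by (auto simp: complex_nonpos_Reals_iff)
    then have "(w - c) / \<omega> = 0" by (simp add: complex_eq_iff)
    then show False using that r \<omega>0 by auto
  qed
  have z_th: "z (th w) = w" "\<bar>th w\<bar> \<le> pi/2" if w: "w \<in> S" "cmod (w - c) = r" for w
  proof -
    let ?v = "(w - c) / \<omega>"
    have v0: "?v \<noteq> 0" using nonpos[OF w] by auto
    have "cmod ?v = r" using w \<omega> by (simp add: norm_divide)
    then have "?v = exp (of_real (ln r) + \<i> * of_real (th w))"
      using exp_Ln[OF v0] Re_Ln[OF v0] unfolding th_def by (metis complex_eq)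
    also have "\<dots> = of_real r * exp (\<i> * of_real (th w))"
      using r by (simp add: exp_add exp_of_real)
    finally show "z (th w) = w" using \<omega>0 by (simp add: z_def field_simps)
    show "\<bar>th w\<bar> \<le> pi/2" unfolding th_def using Re_Ln_pos_le[OF v0] \<omega>(2)[OF w(1)] by simp
  qed
  define V where "V = {w\<in>U. cmod (f w) < M}"
  have V: "open V" unfolding V_def
    using continuous_open_preimage[OF continuous_on_norm[OF U(3)] U(1), of "{..<M}"] by (simp add: vimage_def Int_def)
  have contz: "continuous_on A z" for A unfolding z_def by (intro continuous_intros)
  define k where "k \<theta> = f (z \<theta>) * (\<omega> * of_real r * exp (\<i> * of_real \<theta>) * \<i>)" for \<theta>
  define O' where "O' = z -` V"
  have O': "open O'" unfolding O'_def by (rule open_vimage[OF V contz])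
  have ck: "continuous_on O' k" unfolding k_def
    by (intro continuous_intros continuous_on_compose2[OF U(3) contz]) (auto simp: O'_def V_def)
  have kM: "cmod (k \<theta>) \<le> r * \<bar>M\<bar>" if "\<theta> \<in> O'" for \<theta>
  proof -
    have "cmod (k \<theta>) = cmod (f (z \<theta>)) * r" using r \<omega>(1) by (simp add: k_def norm_mult)
    also have "\<dots> \<le> \<bar>M\<bar> * r" using that r by (intro mult_right_mono) (auto simp: O'_def V_def)
    finally show ?thesis by (simp add: mult.commute)
  qed
  have M0: "0 \<le> r * \<bar>M\<bar>" using r by simp
  obtain G where G: "\<And>x. x \<in> O' \<Longrightarrow> x \<in> {-2<..<2} \<Longrightarrow> (G has_vector_derivative k x) (at x)"
    "\<And>x y. x \<in> {-2..2} \<Longrightarrow> y \<in> {-2..2} \<Longrightarrow> cmod (G x - G y) \<le> r * \<bar>M\<bar> * \<bar>x - y\<bar>"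
    using bounded_open_indicator_primitive[OF O' ck kM M0] by blast
  have pi2: "pi / 2 < 2" using pi_less_4 by simp
  define \<Psi> where "\<Psi> p = \<Phi> p - G (th (h p))" for p
  define K where "K = {p\<in>?R. cmod (h p - c) = r}"
  have loc: "\<forall>\<^sub>F q in nhds p. q \<in> K \<longrightarrow> \<Psi> q = \<Psi> p" if p: "p \<in> K" for p
  proof -
    have hp: "h p \<in> S" "cmod (h p - c) = r" "p \<in> ?R" using p hS unfolding K_def by auto
    obtain F where F: "\<forall>\<^sub>F w in nhds (h p). (F has_field_derivative f w) (at w)"
      "\<forall>\<^sub>F q in nhds p. q \<in> ?R \<longrightarrow> \<Phi> q = F (h q)"
      using prim hp(3) unfolding primitive_along_def by blast
    let ?t0 = "th (h p)"
    have t0: "z ?t0 = h p" "\<bar>?t0\<bar> \<le> pi/2" using z_th[OF hp(1,2)] by auto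
    have "h p \<in> V" using hp(1) U(2) M[OF hp(1,2)] by (auto simp: V_def)
    then have t0O: "?t0 \<in> O'" by (simp add: O'_def t0)
    have "\<forall>\<^sub>F \<theta> in nhds ?t0. \<theta> \<in> UNIV \<longrightarrow> (F has_field_derivative f (z \<theta>)) (at (z \<theta>))"
      by (rule eventually_continuous_on[OF contz]) (use F(1) t0 in auto)
    moreover have "\<forall>\<^sub>F \<theta> in nhds ?t0. \<theta> \<in> O' \<inter> {-2<..<2}"
      using t0O t0(2) pi2 O' by (intro eventually_nhds_in_open) (auto simp: abs_le_iff)
    ultimately have "\<forall>\<^sub>F \<theta> in nhds ?t0. (F has_field_derivative f (z \<theta>)) (at (z \<theta>)) \<and> \<theta> \<in> O' \<inter> {-2<..<2}"
      by eventually_elim auto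
    then obtain d where d: "d > 0" "\<And>\<theta>. dist \<theta> ?t0 < d \<Longrightarrow> (F has_field_derivative f (z \<theta>)) (at (z \<theta>)) \<and> \<theta> \<in> O' \<inter> {-2<..<2}"
      unfolding eventually_nhds_metric by blast
    have "((\<lambda>\<theta>. F (z \<theta>) - G \<theta>) has_vector_derivative 0) (at \<theta> within ball ?t0 d)" if th: "\<theta> \<in> ball ?t0 d" for \<theta>
    proof -
      have d': "(F has_field_derivative f (z \<theta>)) (at (z \<theta>))" "\<theta> \<in> O'" "\<theta> \<in> {-2<..<2}"
        using d(2)[of \<theta>] th by (auto simp: dist_commute)
      have "(z has_vector_derivative (\<omega> * of_real r * exp (\<i> * of_real \<theta>) * \<i>)) (at \<theta>)"
      proof -
        have "((\<lambda>x. c + \<omega> * of_real r * exp (\<i> * x)) has_field_derivative (\<omega> * of_real r * exp (\<i> * of_real \<theta>) * \<i>)) (at (of_real \<theta>))"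
          by (auto intro!: derivative_eq_intros)
        from has_vector_derivative_real_field[OF this] show ?thesis unfolding z_def .
      qed
      from field_vector_diff_chain_at[OF this d'(1)]
      have "((\<lambda>\<theta>. F (z \<theta>)) has_vector_derivative k \<theta>) (at \<theta>)" by (simp add: o_def k_def mult.commute)
      then have "((\<lambda>\<theta>. F (z \<theta>) - G \<theta>) has_vector_derivative (k \<theta> - k \<theta>)) (at \<theta>)"
        by (rule has_vector_derivative_diff) (rule G(1)[OF d'(2,3)])
      then show ?thesis by (simp add: has_vector_derivative_at_within)
    qed
    then obtain C where C: "\<And>\<theta>. \<theta> \<in> ball ?t0 d \<Longrightarrow> F (z \<theta>) - G \<theta> = C"
      using has_vector_derivative_zero_constant[OF convex_ball, of ?t0 d "\<lambda>\<theta>. F (z \<theta>) - G \<theta>"] by blast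
    have cth: "continuous_on K (\<lambda>q. th (h q))" unfolding th_def
      by (intro continuous_on_Im continuous_on_Ln' continuous_on_divide continuous_on_diff continuous_on_const continuous_on_subset[OF ch])
        (use nonpos hS \<omega>0 in \<open>auto simp: K_def\<close>)
    have "\<forall>\<^sub>F \<theta> in nhds ?t0. \<theta> \<in> ball ?t0 d" using d(1) by (intro eventually_nhds_in_open) auto
    from eventually_continuous_on[OF cth p this]
    have "\<forall>\<^sub>F q in nhds p. q \<in> K \<longrightarrow> th (h q) \<in> ball ?t0 d" .
    with F(2) have "\<forall>\<^sub>F q in nhds p. q \<in> K \<longrightarrow> \<Psi> q = C"
    proof eventually_elim
      case (elim q)
      show ?case
      proof
        assume q: "q \<in> K"
        then have "z (th (h q)) = h q" using z_th(1)[of "h q"] hS unfolding K_def by auto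
        moreover have "\<Phi> q = F (h q)" "th (h q) \<in> ball ?t0 d" using elim q unfolding K_def by auto
        ultimately show "\<Psi> q = C" using C[of "th (h q)"] unfolding \<Psi>_def by simp
      qed
    qed
    moreover from eventually_nhds_x_imp_x[OF this] p have "\<Psi> p = C" by blast
    ultimately show ?thesis by simp
  qed
  have crossing: "\<exists>s0\<in>{a..b}. \<exists>s1\<in>{a..b}. u (s0, 0) = 0 \<and> u (s1, 1) = 0 \<and> \<Psi> (s0, 0) = \<Psi> (s1, 1)"
    if "continuous_on ?R u" "\<And>p. u p = 0 \<longleftrightarrow> cmod (h p - c) = r"
      "\<And>t. t \<in> {0..1} \<Longrightarrow> u (a, t) < 0" "\<And>t. t \<in> {0..1} \<Longrightarrow> u (b, t) > 0" for u :: "real \<times> real \<Rightarrow> real"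
  proof (rule level_set_crossing[OF ab that(1,3,4)])
    fix p assume "p \<in> ?R" "u p = 0"
    then show "\<forall>\<^sub>F q in nhds p. q \<in> ?R \<and> u q = 0 \<longrightarrow> \<Psi> q = \<Psi> p"
      using loc[of p] unfolding K_def that(2) by simp
  qed
  have "\<exists>s0\<in>{a..b}. \<exists>s1\<in>{a..b}. cmod (h (s0, 0) - c) = r \<and> cmod (h (s1, 1) - c) = r \<and> \<Psi> (s0, 0) = \<Psi> (s1, 1)"
  proof -
    have c1: "continuous_on ?R (\<lambda>p. cmod (h p - c) - r)" and c2: "continuous_on ?R (\<lambda>p. r - cmod (h p - c))"
      by (intro continuous_intros ch)+
    from sides show ?thesis
    proof
      assume s: "(\<forall>t\<in>{0..1}. cmod (h (a,t) - c) < r) \<and> (\<forall>t\<in>{0..1}. cmod (h (b,t) - c) > r)"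
      show ?thesis using crossing[OF c1] s by simp
    next
      assume s: "(\<forall>t\<in>{0..1}. cmod (h (a,t) - c) > r) \<and> (\<forall>t\<in>{0..1}. cmod (h (b,t) - c) < r)"
      have "r - x = 0 \<longleftrightarrow> x = r" for x by auto
      then show ?thesis using crossing[OF c2] s by simp
    qed
  qed
  then obtain s0 s1 where s: "s0 \<in> {a..b}" "s1 \<in> {a..b}" "cmod (h (s0, 0) - c) = r" "cmod (h (s1, 1) - c) = r" "\<Psi> (s0, 0) = \<Psi> (s1, 1)"
    by blast
  have b: "\<bar>th (h (s0,0))\<bar> \<le> pi/2" "\<bar>th (h (s1,1))\<bar> \<le> pi/2"
    using z_th(2)[OF _ s(3)] z_th(2)[OF _ s(4)] s(1,2) hS by (auto simp: image_subset_iff)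
  have "cmod (\<Phi> (s1, 1) - \<Phi> (s0, 0)) = cmod (G (th (h (s1,1))) - G (th (h (s0,0))))"
    using s(5) unfolding \<Psi>_def by (metis (no_types, lifting) add_diff_cancel_right diff_eq_eq diff_add_eq norm_minus_commute diff_diff_eq2 add.commute)
  also have "\<dots> \<le> r * \<bar>M\<bar> * \<bar>th (h (s1,1)) - th (h (s0,0))\<bar>"
    using b pi2 by (intro G(2)) (auto simp: abs_le_iff)
  also have "\<dots> \<le> r * \<bar>M\<bar> * 4" using b pi2 M0 by (intro mult_left_mono) (auto simp: abs_le_iff)
  finally show ?thesis using s by (intro bexI[of _ s0] bexI[of _ s1]) (auto simp: mult_ac)
qed

section \<open>Comparison of the two ends of a homotopy\<close>

text \<open>The integral of \<open>\<bar>F\<bar>\<close> over half circles about the end point \<open>m\<close> tends to \<open>0\<close>; at an infinite end point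
  these are large half circles about \<open>0\<close>.\<close>

definition end_small :: "(complex \<Rightarrow> complex) \<Rightarrow> complex set \<Rightarrow> ereal \<Rightarrow> bool" where
  "end_small F S m \<longleftrightarrow> (\<forall>\<eta>>0.
     if \<bar>m\<bar> = \<infinity> then \<exists>R. \<forall>r>R. \<exists>M. (\<forall>w\<in>S. cmod w = r \<longrightarrow> cmod (F w) < M) \<and> 4 * r * \<bar>M\<bar> \<le> \<eta>
     else \<exists>\<delta>>0. \<forall>r. 0 < r \<and> r < \<delta> \<longrightarrow>
       (\<exists>M. (\<forall>w\<in>S. cmod (w - of_real (real_of_ereal m)) = r \<longrightarrow> cmod (F w) < M) \<and> 4 * r * \<bar>M\<bar> \<le> \<eta>))"

lemma primitive_along_cong:
  assumes "\<And>p. p \<in> A \<Longrightarrow> h p = h' p"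
  shows "primitive_along f h A \<Phi> \<longleftrightarrow> primitive_along f h' A \<Phi>"
proof -
  have "continuous_on A h \<longleftrightarrow> continuous_on A h'" using assms by (rule continuous_on_cong[OF refl])
  then show ?thesis using assms unfolding primitive_along_def by (simp cong: imp_cong)
qed

lemma eventually_end:
  assumes "filterlim h F (G \<times>\<^sub>F principal T)" "eventually P F"
  shows "\<forall>\<^sub>F s in G. \<forall>t\<in>T. P (h (s, t))"
proof -
  have "\<forall>\<^sub>F x in G \<times>\<^sub>F principal T. P (h x)" using assms by (auto simp: filterlim_iff)
  then obtain Pf Pg where P: "eventually Pf G" "eventually Pg (principal T)" "\<And>x y. Pf x \<Longrightarrow> Pg y \<Longrightarrow> P (h (x, y))"
    unfolding eventually_prod_filter by blast
  show ?thesis using P(1) by eventually_elim (use P(2,3) in \<open>auto simp: eventually_principal\<close>)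
qed

lemma eventually_pick:
  assumes "F \<noteq> bot" "eventually A F" "(X \<and> eventually P F) \<or> (Y \<and> eventually Q F)"
  obtains s where "A s" "(P s \<and> X) \<or> (Q s \<and> Y)"
  using assms(3)
proof (elim disjE conjE)
  assume X: X and "eventually P F"
  with assms(2) have "eventually (\<lambda>s. A s \<and> P s) F" by (intro eventually_conj)
  then show thesis using eventually_happens'[OF assms(1)] that X by blast
next
  assume Y: Y and "eventually Q F"
  with assms(2) have "eventually (\<lambda>s. A s \<and> Q s) F" by (intro eventually_conj)
  then show thesis using eventually_happens'[OF assms(1)] that Y by blast
qed

text \<open>A circle on which \<open>F\<close> is small, and which separates the values of \<open>h\<close> on the line \<open>s = \<sigma>\<close> from those near
  the end.\<close>

lemma end_circle:
  fixes h :: "real \<times> real \<Rightarrow> complex"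
  assumes small: "end_small F S m" and cont: "continuous_on ({0<..<1} \<times> {0..1}) h"
    and hS: "h ` ({0<..<1} \<times> {0..1}) \<subseteq> S"
    and lim: "filterlim h (end_filter m) (G \<times>\<^sub>F principal {0..1})"
    and \<sigma>: "\<sigma> \<in> {0<..<1}" and m: "\<bar>m\<bar> \<noteq> \<infinity> \<Longrightarrow> of_real (real_of_ereal m) \<notin> S" and \<eta>: "\<eta> > 0"
  obtains c r M where "r > 0" "\<And>w. w \<in> S \<Longrightarrow> cmod (w - of_real c) = r \<Longrightarrow> cmod (F w) < M"
    "4 * r * \<bar>M\<bar> \<le> \<eta>"
    "((\<forall>t\<in>{0..1}. cmod (h (\<sigma>,t) - of_real c) > r) \<and> (\<forall>\<^sub>F s in G. \<forall>t\<in>{0..1}. cmod (h (s,t) - of_real c) < r)) \<or>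
     ((\<forall>t\<in>{0..1}. cmod (h (\<sigma>,t) - of_real c) < r) \<and> (\<forall>\<^sub>F s in G. \<forall>t\<in>{0..1}. cmod (h (s,t) - of_real c) > r))"
proof -
  have c\<sigma>: "continuous_on {0..1} (\<lambda>t. h (\<sigma>, t))"
    by (rule continuous_on_compose2[OF cont]) (use \<sigma> in \<open>auto intro!: continuous_intros\<close>)
  have h\<sigma>: "h (\<sigma>, t) \<in> S" if "t \<in> {0..1}" for t using that \<sigma> hS by auto
  show thesis
  proof (cases "\<bar>m\<bar> = \<infinity>")
    case True
    obtain R where R: "\<And>r. r > R \<Longrightarrow> \<exists>M. (\<forall>w\<in>S. cmod w = r \<longrightarrow> cmod (F w) < M) \<and> 4 * r * \<bar>M\<bar> \<le> \<eta>"
      using small[unfolded end_small_def, rule_format, OF \<eta>] unfolding if_P[OF True] by blast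
    have "bounded ((\<lambda>t. h (\<sigma>, t)) ` {0..1})"
      by (intro compact_imp_bounded compact_continuous_image c\<sigma>) auto
    then obtain R1 where R1: "\<And>t. t \<in> {0..1} \<Longrightarrow> cmod (h (\<sigma>, t)) \<le> R1" unfolding bounded_iff by blast
    define r where "r = max (max R R1) 0 + 1"
    have r: "r > R" "r > R1" "r > 0" unfolding r_def by auto
    obtain M where M: "\<And>w. w \<in> S \<Longrightarrow> cmod w = r \<Longrightarrow> cmod (F w) < M" "4 * r * \<bar>M\<bar> \<le> \<eta>" using R[OF r(1)] by blast
    have "eventually (\<lambda>w. cmod w > r) (end_filter m)"
      using True by (auto simp: end_filter_def eventually_at_infinity intro!: exI[of _ "r + 1"])
    from eventually_end[OF lim this] have "\<forall>\<^sub>F s in G. \<forall>t\<in>{0..1}. cmod (h (s,t) - of_real 0) > r" by simp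
    moreover have "\<forall>t\<in>{0..1}. cmod (h (\<sigma>,t) - of_real 0) < r" using le_less_trans[OF R1 r(2)] by simp
    ultimately show thesis using that[of r 0 M] r(3) M by simp
  next
    case False
    let ?m = "real_of_ereal m"
    obtain \<delta> where \<delta>: "\<delta> > 0" "\<And>r. 0 < r \<Longrightarrow> r < \<delta> \<Longrightarrow> \<exists>M. (\<forall>w\<in>S. cmod (w - of_real ?m) = r \<longrightarrow> cmod (F w) < M) \<and> 4 * r * \<bar>M\<bar> \<le> \<eta>"
      using small[unfolded end_small_def, rule_format, OF \<eta>] unfolding if_not_P[OF False] by blast
    have "continuous_on {0..1} (\<lambda>t. cmod (h (\<sigma>, t) - of_real ?m))" by (intro continuous_intros c\<sigma>)
    from continuous_attains_inf[OF compact_Icc _ this]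
    obtain t0 where t0: "t0 \<in> {0..1}" "\<And>t. t \<in> {0..1} \<Longrightarrow> cmod (h (\<sigma>, t0) - of_real ?m) \<le> cmod (h (\<sigma>, t) - of_real ?m)"
      by auto
    define r where "r = min \<delta> (cmod (h (\<sigma>, t0) - of_real ?m)) / 2"
    have "h (\<sigma>, t0) \<noteq> of_real ?m" using m[OF False] h\<sigma>[OF t0(1)] by auto
    then have p: "cmod (h (\<sigma>, t0) - of_real ?m) > 0" by simp
    have r: "r > 0" "r < \<delta>" "r < cmod (h (\<sigma>, t0) - of_real ?m)" unfolding r_def using p \<delta>(1) by (auto simp: min_def)
    obtain M where M: "\<And>w. w \<in> S \<Longrightarrow> cmod (w - of_real ?m) = r \<Longrightarrow> cmod (F w) < M" "4 * r * \<bar>M\<bar> \<le> \<eta>" using \<delta>(2)[OF r(1,2)] by blast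
    have "eventually (\<lambda>w. w \<in> ball (of_real ?m) r) (end_filter m)"
      unfolding end_filter_def if_not_P[OF False] using r(1) by (intro eventually_nhds_in_open) auto
    from eventually_end[OF lim this] have "\<forall>\<^sub>F s in G. \<forall>t\<in>{0..1}. cmod (h (s,t) - of_real ?m) < r"
      by (simp add: dist_norm norm_minus_commute)
    moreover have "\<forall>t\<in>{0..1}. cmod (h (\<sigma>,t) - of_real ?m) > r" by (intro ballI less_le_trans[OF r(3)] t0(2))
    ultimately show thesis using that[of r ?m M] r(1) M by simp
  qed
qed

text \<open>The primitive continued along \<open>h\<close> has the contour integral as its increment along the top of the rectangle
  and the integral over a part of the real interval as its increment along the bottom; the crosscuts near the two
  ends bound the difference.\<close>

lemma contour_integral_close_to_real_integral:
  fixes h :: "real \<times> real \<Rightarrow> complex" and \<phi> :: "real \<Rightarrow> real"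
  assumes U: "open U" "F holomorphic_on U" and SU: "S \<subseteq> U"
    and \<omega>: "cmod \<omega> = 1" "\<And>w c. w \<in> S \<Longrightarrow> 0 \<le> Re ((w - complex_of_real c) / \<omega>)"
    and cont: "continuous_on ({0<..<1} \<times> {0..1}) h" and hS: "h ` ({0<..<1} \<times> {0..1}) \<subseteq> S"
    and \<phi>: "strict_mono_on {0<..<1} \<phi>" 
    and h01: "\<And>s. s \<in> {0<..<1} \<Longrightarrow> h (s, 0) = of_real (\<phi> s) \<and> h (s, 1) = \<gamma> s"
    and lim: "filterlim h (end_filter m1) (at_right 0 \<times>\<^sub>F principal {0..1})"
      "filterlim h (end_filter m2) (at_left 1 \<times>\<^sub>F principal {0..1})"
    and small: "end_small F S m1" "end_small F S m2"
    and m: "\<And>m. m \<in> {m1, m2} \<Longrightarrow> \<bar>m\<bar> \<noteq> \<infinity> \<Longrightarrow> of_real (real_of_ereal m) \<notin> S"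
    and lip: "\<And>a b. 0 < a \<Longrightarrow> b < 1 \<Longrightarrow> \<exists>L. L-lipschitz_on {a..b} \<gamma>"
    and \<sigma>: "0 < \<sigma>" "\<sigma> < 1/2" and \<eta>: "0 < \<eta>"
  shows "\<exists>s0\<in>{0<..\<sigma>}. \<exists>s1\<in>{0<..\<sigma>}. \<exists>s0'\<in>{1-\<sigma>..<1}. \<exists>s1'\<in>{1-\<sigma>..<1}.
     (\<lambda>t. F (\<gamma> t) * vector_derivative \<gamma> (at t)) integrable_on {s1..s1'} \<and>
     cmod (integral {s1..s1'} (\<lambda>t. F (\<gamma> t) * vector_derivative \<gamma> (at t)) 
       - integral {\<phi> s0..\<phi> s0'} (\<lambda>x. F (of_real x))) \<le> 2 * \<eta>"
proof -
  have cF: "continuous_on U F" using U(2) by (rule holomorphic_on_imp_continuous_on)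
  have hU: "h (s, t) \<in> U" if "s \<in> {0<..<1}" "t \<in> {0..1}" for s t
    using that hS SU image_subset_iff[of h "{0<..<1} \<times> {0..1}" S] by blast
  have \<sigma>1: "\<sigma> \<in> {0<..<1}" "1 - \<sigma> \<in> {0<..<1}" using \<sigma> by auto
  obtain c1 r1 M1 where l: "r1 > 0" "\<And>w. w \<in> S \<Longrightarrow> cmod (w - of_real c1) = r1 \<Longrightarrow> cmod (F w) < M1"
    "4 * r1 * \<bar>M1\<bar> \<le> \<eta>"
    "((\<forall>t\<in>{0..1}. cmod (h (\<sigma>,t) - of_real c1) > r1) \<and> (\<forall>\<^sub>F s in at_right 0. \<forall>t\<in>{0..1}. cmod (h (s,t) - of_real c1) < r1)) \<or>
     ((\<forall>t\<in>{0..1}. cmod (h (\<sigma>,t) - of_real c1) < r1) \<and> (\<forall>\<^sub>F s in at_right 0. \<forall>t\<in>{0..1}. cmod (h (s,t) - of_real c1) > r1))"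
    by (rule end_circle[OF small(1) cont hS lim(1) \<sigma>1(1) m[of m1] \<eta>]) auto
  obtain c2 r2 M2 where r: "r2 > 0" "\<And>w. w \<in> S \<Longrightarrow> cmod (w - of_real c2) = r2 \<Longrightarrow> cmod (F w) < M2"
    "4 * r2 * \<bar>M2\<bar> \<le> \<eta>"
    "((\<forall>t\<in>{0..1}. cmod (h (1-\<sigma>,t) - of_real c2) > r2) \<and> (\<forall>\<^sub>F s in at_left 1. \<forall>t\<in>{0..1}. cmod (h (s,t) - of_real c2) < r2)) \<or>
     ((\<forall>t\<in>{0..1}. cmod (h (1-\<sigma>,t) - of_real c2) < r2) \<and> (\<forall>\<^sub>F s in at_left 1. \<forall>t\<in>{0..1}. cmod (h (s,t) - of_real c2) > r2))"
    by (rule end_circle[OF small(2) cont hS lim(2) \<sigma>1(2) m[of m2] \<eta>]) auto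
  have el: "\<forall>\<^sub>F s in at_right 0. s \<in> {0<..<\<sigma>}" using \<sigma> by (intro eventually_at_right_real) auto
  obtain a where a: "a \<in> {0<..<\<sigma>}"
     "((\<forall>t\<in>{0..1}. cmod (h (a,t) - of_real c1) < r1) \<and> (\<forall>t\<in>{0..1}. cmod (h (\<sigma>,t) - of_real c1) > r1)) \<or>
     ((\<forall>t\<in>{0..1}. cmod (h (a,t) - of_real c1) > r1) \<and> (\<forall>t\<in>{0..1}. cmod (h (\<sigma>,t) - of_real c1) < r1))"
    by (rule eventually_pick[OF trivial_limit_at_right_real el l(4)])
  have er: "\<forall>\<^sub>F s in at_left 1. s \<in> {1-\<sigma><..<1}" using \<sigma> by (intro eventually_at_left_real) auto
  obtain b where b: "b \<in> {1-\<sigma><..<1}"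
     "((\<forall>t\<in>{0..1}. cmod (h (b,t) - of_real c2) < r2) \<and> (\<forall>t\<in>{0..1}. cmod (h (1-\<sigma>,t) - of_real c2) > r2)) \<or>
     ((\<forall>t\<in>{0..1}. cmod (h (b,t) - of_real c2) > r2) \<and> (\<forall>t\<in>{0..1}. cmod (h (1-\<sigma>,t) - of_real c2) < r2))"
    by (rule eventually_pick[OF trivial_limit_at_left_real er r(4)])
  have b': "((\<forall>t\<in>{0..1}. cmod (h (1-\<sigma>,t) - of_real c2) < r2) \<and> (\<forall>t\<in>{0..1}. cmod (h (b,t) - of_real c2) > r2)) \<or>
     ((\<forall>t\<in>{0..1}. cmod (h (1-\<sigma>,t) - of_real c2) > r2) \<and> (\<forall>t\<in>{0..1}. cmod (h (b,t) - of_real c2) < r2))"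
    using b(2) by blast
  have ab: "a \<le> \<sigma>" "\<sigma> \<le> 1 - \<sigma>" "1 - \<sigma> \<le> b" "a \<le> b" "0 < a" "b < 1" using a(1) b(1) \<sigma> by auto
  have sub: "{a..b} \<times> {0..1::real} \<subseteq> {0<..<1} \<times> {0..1}" using ab by auto
  have "\<exists>\<Phi>. primitive_along F h ({a..b} \<times> {0..1}) \<Phi>"
    by (rule primitive_along_rectangle_exists[OF ab(4) U continuous_on_subset[OF cont sub]]) (use sub hS SU in blast)
  then obtain \<Phi> where \<Phi>: "primitive_along F h ({a..b} \<times> {0..1}) \<Phi>" by blast
  have "\<exists>s0\<in>{a..\<sigma>}. \<exists>s1\<in>{a..\<sigma>}. cmod (h (s0, 0) - of_real c1) = r1 \<and> cmod (h (s1, 1) - of_real c1) = r1 \<and>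
     cmod (\<Phi> (s1, 1) - \<Phi> (s0, 0)) \<le> 4 * r1 * \<bar>M1\<bar>"
    by (rule crosscut_estimate[OF primitive_along_subset[OF \<Phi>] ab(1) _ U(1) SU cF l(1) \<omega>(1) \<omega>(2) l(2) a(2)])
      (use ab hS in auto)
  then obtain s0 s1 where s: "s0 \<in> {a..\<sigma>}" "s1 \<in> {a..\<sigma>}" "cmod (\<Phi> (s1, 1) - \<Phi> (s0, 0)) \<le> \<eta>" using l(3) by fastforce
  have "\<exists>s0\<in>{1-\<sigma>..b}. \<exists>s1\<in>{1-\<sigma>..b}. cmod (h (s0, 0) - of_real c2) = r2 \<and> cmod (h (s1, 1) - of_real c2) = r2 \<and>
     cmod (\<Phi> (s1, 1) - \<Phi> (s0, 0)) \<le> 4 * r2 * \<bar>M2\<bar>"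
    by (rule crosscut_estimate[OF primitive_along_subset[OF \<Phi>] ab(3) _ U(1) SU cF r(1) \<omega>(1) \<omega>(2) r(2) b'])
      (use ab hS in auto)
  then obtain s0' s1' where s': "s0' \<in> {1-\<sigma>..b}" "s1' \<in> {1-\<sigma>..b}" "cmod (\<Phi> (s1', 1) - \<Phi> (s0', 0)) \<le> \<eta>" using r(3) by fastforce
  have int1: "((\<lambda>t. F (\<gamma> t) * vector_derivative \<gamma> (at t)) has_integral (\<Phi> (s1', 1) - \<Phi> (s1, 1))) {s1..s1'}"
  proof -
    obtain L where L: "L-lipschitz_on {s1..s1'} \<gamma>" using lip[of s1 s1'] s(2) s'(2) ab by auto
    have s01: "{s1..s1'} \<subseteq> {0<..<1}" using s s' ab by auto
    have "primitive_along F (\<lambda>t. h (t, 1)) {s1..s1'} (\<lambda>t. \<Phi> (t, 1))"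
      by (rule primitive_along_compose[OF \<Phi>]) (use s s' in \<open>auto intro!: continuous_intros\<close>)
    then have "primitive_along F \<gamma> {s1..s1'} (\<lambda>t. \<Phi> (t, 1))"
      by (rule primitive_along_cong[THEN iffD1, rotated]) (use h01 s01 in auto)
    moreover have "\<gamma> ` {s1..s1'} \<subseteq> U"
    proof
      fix w assume "w \<in> \<gamma> ` {s1..s1'}"
      then obtain t where t: "t \<in> {0<..<1}" "w = h (t, 1)" using s01 h01 by auto
      then show "w \<in> U" using hU[of t 1] by simp
    qed
    ultimately show ?thesis using s s' ab by (intro contour_integral_primitive_along[OF _ L U(1) cF]) auto
  qed
  have s0: "s0 \<le> s0'" "{s0..s0'} \<subseteq> {0<..<1}" "{s0..s0'} \<subseteq> {a..b}" using s s' ab by auto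
  have \<phi>m: "strict_mono_on {s0..s0'} \<phi>" 
  proof (rule strict_mono_onI)
    fix x y assume xy: "x \<in> {s0..s0'}" "y \<in> {s0..s0'}" "x < y"
    show "\<phi> x < \<phi> y" by (rule strict_mono_onD[OF \<phi> subsetD[OF s0(2) xy(1)] subsetD[OF s0(2) xy(2)] xy(3)])
  qed
  have \<phi>c: "continuous_on {s0..s0'} \<phi>"
  proof -
    have "continuous_on {s0..s0'} (\<lambda>s. Re (h (s, 0)))"
      by (intro continuous_intros continuous_on_compose2[OF cont]) (use s0(2) in auto)
    then show ?thesis by (rule continuous_on_eq) (use h01 s0(2) in auto)
  qed
  have inj: "inj_on \<phi> {s0..s0'}" using \<phi>m by (rule strict_mono_on_imp_inj_on)
  have img: "\<phi> ` {s0..s0'} = {\<phi> s0..\<phi> s0'}"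
  proof (rule equalityI; rule subsetI)
    fix x assume "x \<in> \<phi> ` {s0..s0'}"
    then obtain y where y: "y \<in> {s0..s0'}" "x = \<phi> y" by blast
    then show "x \<in> {\<phi> s0..\<phi> s0'}" using strict_mono_on_leD[OF \<phi>m, of s0 y] strict_mono_on_leD[OF \<phi>m, of y s0'] s0(1) by auto
  next
    fix x assume "x \<in> {\<phi> s0..\<phi> s0'}"
    then obtain y where "s0 \<le> y" "y \<le> s0'" "\<phi> y = x" using IVT'[of \<phi> s0 x s0'] s0(1) \<phi>c by auto
    then show "x \<in> \<phi> ` {s0..s0'}" by auto
  qed
  define g where "g = inv_into {s0..s0'} \<phi>"
  have gc: "continuous_on {\<phi> s0..\<phi> s0'} g" unfolding g_def img[symmetric]
    by (rule continuous_on_inv[OF \<phi>c compact_Icc]) (use inv_into_f_f[OF inj] in blast)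
  have g: "g x \<in> {s0..s0'}" "\<phi> (g x) = x" if "x \<in> {\<phi> s0..\<phi> s0'}" for x
    using that unfolding g_def img[symmetric] by (auto simp: inv_into_f_f[OF inj])
  have gab: "a \<le> g x" "g x \<le> b" if "x \<in> {\<phi> s0..\<phi> s0'}" for x
    using subsetD[OF s0(3) g(1)[OF that]] by auto
  have g_end: "g (\<phi> s0) = s0" "g (\<phi> s0') = s0'" unfolding g_def using inv_into_f_f[OF inj] s0(1) by auto
  have int0: "((\<lambda>x. F (of_real x) * vector_derivative complex_of_real (at x)) has_integral (\<Phi> (g (\<phi> s0'), 0) - \<Phi> (g (\<phi> s0), 0))) {\<phi> s0..\<phi> s0'}"
  proof (rule contour_integral_primitive_along[OF _ _ U(1) cF])
    show "\<phi> s0 \<le> \<phi> s0'" using strict_mono_on_leD[OF \<phi>m, of s0 s0'] s0(1) by auto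
    show "1-lipschitz_on {\<phi> s0..\<phi> s0'} complex_of_real" by (rule lipschitz_onI) (auto simp: dist_of_real)
    have hg: "h (g x, 0) = of_real x" if "x \<in> {\<phi> s0..\<phi> s0'}" for x using g[OF that] h01[of "g x"] s0(2) by auto
    show "complex_of_real ` {\<phi> s0..\<phi> s0'} \<subseteq> U"
    proof
      fix w assume "w \<in> complex_of_real ` {\<phi> s0..\<phi> s0'}"
      then obtain x where x: "x \<in> {\<phi> s0..\<phi> s0'}" "w = h (g x, 0)" using hg by auto
      then show "w \<in> U" using hU[of "g x" 0] g(1)[OF x(1)] s0(2) by auto
    qed
    have "primitive_along F (\<lambda>x. h (g x, 0)) {\<phi> s0..\<phi> s0'} (\<lambda>x. \<Phi> (g x, 0))"
      by (rule primitive_along_compose[OF \<Phi>]) (use gab gc in \<open>auto intro!: continuous_intros\<close>)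
    then show "primitive_along F complex_of_real {\<phi> s0..\<phi> s0'} (\<lambda>x. \<Phi> (g x, 0))"
      by (rule primitive_along_cong[THEN iffD1, rotated]) (use hg in auto)
  qed
  have "vector_derivative complex_of_real (at x) = 1" for x
    by (intro vector_derivative_at) (auto intro!: derivative_eq_intros)
  then have int0': "integral {\<phi> s0..\<phi> s0'} (\<lambda>x. F (of_real x)) = \<Phi> (s0', 0) - \<Phi> (s0, 0)"
    using int0 g_end by (simp add: integral_unique)
  have "integral {s1..s1'} (\<lambda>t. F (\<gamma> t) * vector_derivative \<gamma> (at t)) - integral {\<phi> s0..\<phi> s0'} (\<lambda>x. F (of_real x))
    = (\<Phi> (s1', 1) - \<Phi> (s0', 0)) - (\<Phi> (s1, 1) - \<Phi> (s0, 0))"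
    using int1 int0' by (simp add: integral_unique algebra_simps)
  also have "cmod \<dots> \<le> \<eta> + \<eta>" using s(3) s'(3) norm_triangle_ineq4 by (metis add_mono order_trans)
  finally have "cmod (integral {s1..s1'} (\<lambda>t. F (\<gamma> t) * vector_derivative \<gamma> (at t)) - integral {\<phi> s0..\<phi> s0'} (\<lambda>x. F (of_real x))) \<le> 2 * \<eta>" by simp
  moreover have "s0 \<in> {0<..\<sigma>}" "s1 \<in> {0<..\<sigma>}" "s0' \<in> {1-\<sigma>..<1}" "s1' \<in> {1-\<sigma>..<1}" using s s' ab by auto
  ultimately show ?thesis using int1 by blast
qed

section \<open>Damping at infinity\<close>

text \<open>Integration by parts. The function \<open>W\<close> majorizes the variation of \<open>e\<close>, and \<open>T\<close> is the integral of
  \<open>- \<Psi> e'\<close>; the mean value inequality for \<open>T\<close> replaces an integrability statement about \<open>e'\<close>.\<close>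

lemma abel_estimate:
  fixes f e :: "real \<Rightarrow> complex" and W :: "real \<Rightarrow> real"
  assumes pq: "p \<le> q" and f: "continuous_on {p..q} f"
    and e: "\<And>x. x \<in> {p..q} \<Longrightarrow> (e has_vector_derivative e' x) (at x)"
    and W: "\<And>x. x \<in> {p..q} \<Longrightarrow> (W has_real_derivative W' x) (at x)" "\<And>x. x \<in> {p..q} \<Longrightarrow> cmod (e' x) \<le> W' x"
    and eq: "cmod (e q) \<le> 1" and \<eta>: "\<And>x. x \<in> {p..q} \<Longrightarrow> cmod (integral {p..x} f) \<le> \<eta>"
  shows "cmod (integral {p..q} (\<lambda>x. f x * e x)) \<le> \<eta> * (1 + (W q - W p))"
proof (cases "p < q")
  case True
  have ec: "continuous_on {p..q} e"
    using e by (meson continuous_at_imp_continuous_on has_vector_derivative_continuous)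
  have Wc: "continuous_on {p..q} W"
    using W(1) by (meson continuous_at_imp_continuous_on DERIV_isCont)
  define \<Psi> where "\<Psi> x = integral {p..x} f" for x
  define T where "T x = integral {p..x} (\<lambda>x. f x * e x) - \<Psi> x * e x" for x
  have \<Psi>': "(\<Psi> has_vector_derivative f x) (at x within {p..q})" if "x \<in> {p..q}" for x
    unfolding \<Psi>_def using that f by (intro integral_has_vector_derivative) auto
  have T': "(T has_vector_derivative - (\<Psi> x * e' x)) (at x within {p..q})" if x: "x \<in> {p..q}" for x
  proof -
    have 1: "((\<lambda>x. integral {p..x} (\<lambda>x. f x * e x)) has_vector_derivative f x * e x) (at x within {p..q})"
      using x f ec by (intro integral_has_vector_derivative continuous_intros) auto
    have 2: "((\<lambda>x. \<Psi> x * e x) has_vector_derivative (\<Psi> x * e' x + f x * e x)) (at x within {p..q})"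
      by (rule has_vector_derivative_mult[OF \<Psi>'[OF x] has_vector_derivative_at_within[OF e[OF x]]])
    have "(T has_vector_derivative (f x * e x - (\<Psi> x * e' x + f x * e x))) (at x within {p..q})"
      unfolding T_def by (rule has_vector_derivative_diff[OF 1 2])
    then show ?thesis by simp
  qed
  have "norm (T q - T p) \<le> \<eta> * W q - \<eta> * W p"
  proof (rule differentiable_bound_general[OF True])
    show "continuous_on {p..q} T" using T' has_vector_derivative_continuous continuous_on_eq_continuous_within by blast
    show "continuous_on {p..q} (\<lambda>x. \<eta> * W x)" by (intro continuous_intros Wc)
    fix x assume x: "p < x" "x < q"
    show "(T has_vector_derivative - (\<Psi> x * e' x)) (at x)"
      using T'[of x] x at_within_Icc_at[of p x q] by simp
    show "((\<lambda>x. \<eta> * W x) has_vector_derivative \<eta> * W' x) (at x)"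
      using W(1)[of x] x DERIV_cmult[of W "W' x" x UNIV \<eta>] by (simp add: has_real_derivative_iff_has_vector_derivative)
    have "cmod (\<Psi> x) * cmod (e' x) \<le> \<eta> * W' x"
      using \<eta>[of x] W(2)[of x] x norm_ge_zero[of "\<Psi> x"] unfolding \<Psi>_def by (intro mult_mono) (auto intro: order_trans[OF norm_ge_zero])
    then show "norm (- (\<Psi> x * e' x)) \<le> \<eta> * W' x" by (simp add: norm_mult)
  qed
  moreover have "T p = 0" by (simp add: T_def \<Psi>_def)
  moreover have "cmod (\<Psi> q * e q) \<le> \<eta> * 1"
    unfolding norm_mult using \<eta>[of q] eq pq unfolding \<Psi>_def by (intro mult_mono) (auto intro: order_trans[OF norm_ge_zero])
  moreover have "integral {p..q} (\<lambda>x. f x * e x) = T q + \<Psi> q * e q" by (simp add: T_def)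
  ultimately have "cmod (integral {p..q} (\<lambda>x. f x * e x)) \<le> (\<eta> * W q - \<eta> * W p) + \<eta> * 1"
    using norm_triangle_mono by (metis diff_zero)
  then show ?thesis by (simp add: algebra_simps)
next
  case False
  then have "p = q" using pq by simp
  then show ?thesis using \<eta>[of p] by simp
qed

text \<open>With \<open>0 < \<beta> < 1\<close> this is at most \<open>exp (- \<epsilon> c \<bar>w\<bar>\<^sup>\<beta>)\<close>, \<open>c > 0\<close>, in the half plane \<open>0 \<le> Re (w / \<omega>)\<close>; the shift by \<open>1\<close>
  keeps the branch point of the power away from this half plane.\<close>

definition damp :: "real \<Rightarrow> complex \<Rightarrow> real \<Rightarrow> complex \<Rightarrow> complex" where
  "damp \<beta> \<omega> \<epsilon> w = exp (- (of_real \<epsilon> * exp (of_real \<beta> * Ln (1 + w / \<omega>))))"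

lemma damp_holomorphic: "\<omega> \<noteq> 0 \<Longrightarrow> damp \<beta> \<omega> \<epsilon> holomorphic_on {w. -1 < Re (w / \<omega>)}"
  unfolding damp_def by (intro holomorphic_intros) (auto simp: complex_nonpos_Reals_iff)

context
  fixes \<beta> :: real and \<omega> :: complex
  assumes \<beta>: "0 < \<beta>" "\<beta> < 1" and \<omega>: "cmod \<omega> = 1"
begin

definition "damp_rate = cos (\<beta> * (pi/2))"

lemma damp_rate_pos: "damp_rate > 0"
  unfolding damp_rate_def using \<beta> by (intro cos_gt_zero) auto

lemma damp_base:
  assumes "0 \<le> Re (w / \<omega>)"
  shows "1 \<le> cmod (1 + w / \<omega>)" "cmod w \<le> cmod (1 + w / \<omega>)" "1 + w / \<omega> \<noteq> 0" "cmod (1 + w / \<omega>) \<le> 1 + cmod w"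
proof -
  have "Re (1 + w / \<omega>) \<le> cmod (1 + w / \<omega>)" by (rule complex_Re_le_cmod)
  then show 1: "1 \<le> cmod (1 + w / \<omega>)" using assms by simp
  then show "1 + w / \<omega> \<noteq> 0" by auto
  have "(cmod (w / \<omega>))\<^sup>2 \<le> (cmod (1 + w / \<omega>))\<^sup>2"
    using assms by (simp add: cmod_power2 power2_sum)
  then have "cmod (w / \<omega>) \<le> cmod (1 + w / \<omega>)" by (simp add: power2_le_iff_abs_le)
  then show "cmod w \<le> cmod (1 + w / \<omega>)" using \<omega> by (simp add: norm_divide)
  show "cmod (1 + w / \<omega>) \<le> 1 + cmod w" using norm_triangle_ineq[of 1 "w / \<omega>"] \<omega> by (simp add: norm_divide)
qed

lemma damp_exponent:
  assumes w: "0 \<le> Re (w / \<omega>)"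
  shows "cmod (exp (of_real \<beta> * Ln (1 + w / \<omega>))) = cmod (1 + w / \<omega>) powr \<beta>"
    "damp_rate * cmod (1 + w / \<omega>) powr \<beta> \<le> Re (exp (of_real \<beta> * Ln (1 + w / \<omega>)))"
proof -
  let ?z = "1 + w / \<omega>"
  note b = damp_base[OF w]
  have z: "0 < Re ?z" using w by simp
  show n: "cmod (exp (of_real \<beta> * Ln ?z)) = cmod ?z powr \<beta>"
    using b(3) by (simp add: powr_def Re_Ln)
  have "\<bar>Im (Ln ?z)\<bar> < pi/2" using Re_Ln_pos_lt[OF b(3)] z by blast
  then have "\<bar>\<beta> * Im (Ln ?z)\<bar> \<le> \<beta> * (pi/2)" using \<beta> by (simp add: abs_mult)
  moreover have "\<beta> * (pi/2) \<le> pi" using mult_right_mono[of \<beta> 1 "pi/2"] \<beta> pi_gt_zero by linarith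
  ultimately have "cos (\<beta> * (pi/2)) \<le> cos \<bar>\<beta> * Im (Ln ?z)\<bar>" by (intro cos_monotone_0_pi_le) auto
  then have c: "damp_rate \<le> cos (\<beta> * Im (Ln ?z))" by (simp add: damp_rate_def abs_if split: if_splits)
  have "Re (exp (of_real \<beta> * Ln ?z)) = cmod ?z powr \<beta> * cos (\<beta> * Im (Ln ?z))"
    using b(3) by (simp add: Re_exp powr_def Re_Ln)
  then show "damp_rate * cmod ?z powr \<beta> \<le> Re (exp (of_real \<beta> * Ln ?z))"
    using mult_right_mono[OF c, of "cmod ?z powr \<beta>"] by (simp add: mult.commute)
qed

lemma damp_bound:
  assumes w: "0 \<le> Re (w / \<omega>)" and \<epsilon>: "0 \<le> \<epsilon>"
  shows "cmod (damp \<beta> \<omega> \<epsilon> w) \<le> exp (- (\<epsilon> * damp_rate * cmod (1 + w / \<omega>) powr \<beta>))"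
    "cmod (damp \<beta> \<omega> \<epsilon> w) \<le> exp (- (\<epsilon> * damp_rate * cmod w powr \<beta>))" "cmod (damp \<beta> \<omega> \<epsilon> w) \<le> 1"
proof -
  show 1: "cmod (damp \<beta> \<omega> \<epsilon> w) \<le> exp (- (\<epsilon> * damp_rate * cmod (1 + w / \<omega>) powr \<beta>))"
    using mult_left_mono[OF damp_exponent(2)[OF w] \<epsilon>] by (simp add: damp_def mult_ac)
  have "cmod w powr \<beta> \<le> cmod (1 + w / \<omega>) powr \<beta>" using damp_base[OF w] \<beta> by (intro powr_mono2) auto
  then have "\<epsilon> * damp_rate * cmod w powr \<beta> \<le> \<epsilon> * damp_rate * cmod (1 + w / \<omega>) powr \<beta>"
    using \<epsilon> damp_rate_pos by (intro mult_left_mono) auto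
  with 1 show 2: "cmod (damp \<beta> \<omega> \<epsilon> w) \<le> exp (- (\<epsilon> * damp_rate * cmod w powr \<beta>))"
    by (smt (verit) exp_le_cancel_iff)
  have "0 \<le> \<epsilon> * damp_rate * cmod w powr \<beta>" using \<epsilon> damp_rate_pos by simp
  with 2 show "cmod (damp \<beta> \<omega> \<epsilon> w) \<le> 1" by (smt (verit) one_le_exp_iff exp_le_one_iff)
qed

lemma damp_tendsto_1:
  assumes \<eta>: "\<eta> > 0"
  shows "\<exists>\<epsilon>0>0. \<epsilon>0 \<le> 1 \<and> (\<forall>\<epsilon>. 0 < \<epsilon> \<and> \<epsilon> \<le> \<epsilon>0 \<longrightarrow> (\<forall>w. 0 \<le> Re (w / \<omega>) \<and> cmod w \<le> R \<longrightarrow> cmod (damp \<beta> \<omega> \<epsilon> w - 1) \<le> \<eta>))"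
proof -
  have "isCont exp (0::complex)" by simp
  then obtain \<delta> where \<delta>: "\<delta> > 0" "\<And>v::complex. cmod v < \<delta> \<Longrightarrow> cmod (exp v - 1) < \<eta>"
    using \<eta> unfolding continuous_at_eps_delta dist_norm by (metis diff_zero exp_zero)
  define Q where "Q = (1 + \<bar>R\<bar>) powr \<beta>"
  have Q: "Q > 0" unfolding Q_def by simp
  have main: "cmod (damp \<beta> \<omega> \<epsilon> w - 1) \<le> \<eta>" if "0 < \<epsilon>" "\<epsilon> \<le> min 1 (\<delta> / (2 * Q))" "0 \<le> Re (w / \<omega>)" "cmod w \<le> R" for \<epsilon> w
  proof -
    have "cmod (1 + w / \<omega>) powr \<beta> \<le> Q" unfolding Q_def using damp_base[OF that(3)] that(4) \<beta> by (intro powr_mono2) auto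
    then have "cmod (- (of_real \<epsilon> * exp (of_real \<beta> * Ln (1 + w / \<omega>)))) \<le> \<epsilon> * Q"
      using that(1) damp_exponent(1)[OF that(3)] by (simp add: norm_mult)
    also have "\<dots> \<le> \<delta> / (2 * Q) * Q" using that Q by (intro mult_right_mono) auto
    also have "\<dots> < \<delta>" using Q \<delta>(1) by simp
    finally show ?thesis using \<delta>(2) unfolding damp_def by (intro less_imp_le) auto
  qed
  show ?thesis using \<delta>(1) Q main by (intro exI[of _ "min 1 (\<delta> / (2 * Q))"]) auto
qed

text \<open>The power bound at a finite end point is integrable over circles since the exponent exceeds \<open>-1\<close>; at an infinite
  one \<open>r exp (r\<^sup>\<alpha> - \<epsilon> c r\<^sup>\<beta>)\<close> tends to \<open>0\<close>.\<close>

lemma end_small_damp: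
  assumes S: "\<And>w. w \<in> S \<Longrightarrow> 0 \<le> Re (w / \<omega>)" and \<epsilon>: "\<epsilon> > 0"
    and fin: "\<bar>m\<bar> \<noteq> \<infinity> \<Longrightarrow> \<exists>C g. -1 < g \<and> (\<exists>\<delta>>0. \<forall>w\<in>S. dist w (of_real (real_of_ereal m)) < \<delta> \<longrightarrow>
       cmod (f w) \<le> C * dist w (of_real (real_of_ereal m)) powr g)"
    and inf: "\<bar>m\<bar> = \<infinity> \<Longrightarrow> \<exists>C \<alpha>. \<alpha> < \<beta> \<and> (\<exists>R. \<forall>w\<in>S. R < cmod w \<longrightarrow> cmod (f w) \<le> C * exp (cmod w powr \<alpha>))"
  shows "end_small (\<lambda>w. f w * damp \<beta> \<omega> \<epsilon> w) S m"
  unfolding end_small_def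
proof (intro allI impI)
  fix \<eta> :: real assume \<eta>: "\<eta> > 0"
  show "if \<bar>m\<bar> = \<infinity> then \<exists>R. \<forall>r>R. \<exists>M. (\<forall>w\<in>S. cmod w = r \<longrightarrow> cmod (f w * damp \<beta> \<omega> \<epsilon> w) < M) \<and> 4 * r * \<bar>M\<bar> \<le> \<eta>
     else \<exists>\<delta>>0. \<forall>r. 0 < r \<and> r < \<delta> \<longrightarrow>
       (\<exists>M. (\<forall>w\<in>S. cmod (w - of_real (real_of_ereal m)) = r \<longrightarrow> cmod (f w * damp \<beta> \<omega> \<epsilon> w) < M) \<and> 4 * r * \<bar>M\<bar> \<le> \<eta>)"
  proof (cases "\<bar>m\<bar> = \<infinity>")
    case True
    obtain C \<alpha> R where C: "\<alpha> < \<beta>" "\<And>w. w \<in> S \<Longrightarrow> R < cmod w \<Longrightarrow> cmod (f w) \<le> C * exp (cmod w powr \<alpha>)"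
      using inf[OF True] by blast
    define \<kappa> where "\<kappa> = \<epsilon> * damp_rate"
    have \<kappa>: "\<kappa> > 0" unfolding \<kappa>_def using \<epsilon> damp_rate_pos by simp
    define M where "M r = \<bar>C\<bar> * exp (r powr \<alpha> - \<kappa> * r powr \<beta>) + 1 / r\<^sup>2" for r :: real
    have "((\<lambda>r. 4 * r * M r) \<longlongrightarrow> 0) at_top" unfolding M_def using \<kappa> \<beta> C(1) by real_asymp
    then have "\<forall>\<^sub>F r in at_top. 4 * r * M r < \<eta>" using \<eta> by (rule order_tendstoD(2))
    then obtain R' where R': "\<And>r. r \<ge> R' \<Longrightarrow> 4 * r * M r < \<eta>" unfolding eventually_at_top_linorder by blast
    have "\<exists>M. (\<forall>w\<in>S. cmod w = r \<longrightarrow> cmod (f w * damp \<beta> \<omega> \<epsilon> w) < M) \<and> 4 * r * \<bar>M\<bar> \<le> \<eta>" if r: "r > max (max R R') 0" for r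
    proof (intro exI[of _ "M r"] conjI ballI impI)
      fix w assume w: "w \<in> S" "cmod w = r"
      have "cmod (f w) * cmod (damp \<beta> \<omega> \<epsilon> w) \<le> (\<bar>C\<bar> * exp (r powr \<alpha>)) * exp (- (\<kappa> * r powr \<beta>))"
      proof (rule mult_mono)
        show "cmod (f w) \<le> \<bar>C\<bar> * exp (r powr \<alpha>)"
          using C(2)[OF w(1)] w(2) r by (smt (verit) mult_right_mono exp_ge_zero abs_ge_self max.cobounded1)
        show "cmod (damp \<beta> \<omega> \<epsilon> w) \<le> exp (- (\<kappa> * r powr \<beta>))"
          using damp_bound(2)[OF S[OF w(1)], of \<epsilon>] \<epsilon> w(2) by (simp add: \<kappa>_def)
      qed auto
      also have "\<dots> < M r" using r by (simp add: M_def exp_diff exp_minus divide_inverse)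
      finally show "cmod (f w * damp \<beta> \<omega> \<epsilon> w) < M r" by (simp add: norm_mult)
    next
      have "M r \<ge> 0" by (simp add: M_def)
      then show "4 * r * \<bar>M r\<bar> \<le> \<eta>" using R'[of r] r by simp
    qed
    then show ?thesis unfolding if_P[OF True] by blast
  next
    case False
    let ?m = "complex_of_real (real_of_ereal m)"
    obtain C g \<delta> where C: "-1 < g" "\<delta> > 0" "\<And>w. w \<in> S \<Longrightarrow> dist w ?m < \<delta> \<Longrightarrow> cmod (f w) \<le> C * dist w ?m powr g"
      using fin[OF False] by blast
    define M where "M r = \<bar>C\<bar> * r powr g + 1" for r :: real
    have "((\<lambda>r. 4 * \<bar>C\<bar> * (r * r powr g) + 4 * r) \<longlongrightarrow> 4 * \<bar>C\<bar> * 0 + 4 * 0) (at_right 0)"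
      by (intro tendsto_intros) (use C(1) in real_asymp)
    then have "((\<lambda>r. 4 * r * M r) \<longlongrightarrow> 0) (at_right 0)" by (simp add: M_def algebra_simps)
    then have "\<forall>\<^sub>F r in at_right 0. 4 * r * M r < \<eta>" using \<eta> by (rule order_tendstoD(2))
    then obtain \<delta>' where \<delta>': "\<delta>' > 0" "\<And>r. 0 < r \<Longrightarrow> r < \<delta>' \<Longrightarrow> 4 * r * M r < \<eta>"
      unfolding eventually_at_right_field by auto
    have bnd: "\<exists>M. (\<forall>w\<in>S. cmod (w - ?m) = r \<longrightarrow> cmod (f w * damp \<beta> \<omega> \<epsilon> w) < M) \<and> 4 * r * \<bar>M\<bar> \<le> \<eta>"
      if r: "0 < r" "r < min \<delta> \<delta>'" for r
    proof (intro exI[of _ "M r"] conjI ballI impI)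
      fix w assume w: "w \<in> S" "cmod (w - ?m) = r"
      have "cmod (f w) * cmod (damp \<beta> \<omega> \<epsilon> w) \<le> (\<bar>C\<bar> * r powr g) * 1"
      proof (rule mult_mono)
        have "cmod (f w) \<le> C * r powr g" using C(3)[OF w(1)] w(2) r by (simp add: dist_norm)
        also have "\<dots> \<le> \<bar>C\<bar> * r powr g" by (intro mult_right_mono) auto
        finally show "cmod (f w) \<le> \<bar>C\<bar> * r powr g" .
        show "cmod (damp \<beta> \<omega> \<epsilon> w) \<le> 1" using damp_bound(3)[OF S[OF w(1)], of \<epsilon>] \<epsilon> by simp
      qed auto
      then show "cmod (f w * damp \<beta> \<omega> \<epsilon> w) < M r" by (simp add: M_def norm_mult)
    next
      have "M r \<ge> 0" by (simp add: M_def)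
      then show "4 * r * \<bar>M r\<bar> \<le> \<eta>" using \<delta>'(2)[of r] r by simp
    qed
    show ?thesis unfolding if_not_P[OF False]
    proof (rule exI[of _ "min \<delta> \<delta>'"], rule conjI)
      show "0 < min \<delta> \<delta>'" using C(2) \<delta>'(1) by simp
    qed (intro allI impI, erule conjE, rule bnd)
  qed
qed

end

context
  fixes \<beta> :: real and \<omega> :: complex
  assumes \<beta>: "0 < \<beta>" "\<beta> < 1" and \<omega>: "cmod \<omega> = 1" "Re (1 / \<omega>) = 0"
begin

lemma Re_real_over: "Re (of_real x / \<omega>) = 0"
proof -
  have "of_real x / \<omega> = of_real x * (1 / \<omega>)" by simp
  also have "Re (of_real x * (1 / \<omega>)) = x * Re (1 / \<omega>)"
    unfolding times_complex.simps(1) by (simp only: Re_complex_of_real Im_complex_of_real)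
  finally show ?thesis using \<omega>(2) by simp
qed

text \<open>The first bound serves near finite end points. The second one is the derivative of
  \<open>\<mp> exp (- \<epsilon> c \<bar>x\<bar>\<^sup>\<beta>) / c\<close>, so the variation at infinity is bounded uniformly in \<open>\<epsilon>\<close>.\<close>

lemma damp_real_derivative:
  assumes \<epsilon>: "0 < \<epsilon>" "\<epsilon> \<le> 1"
  shows "\<exists>e'. ((\<lambda>x. damp \<beta> \<omega> \<epsilon> (of_real x)) has_vector_derivative e') (at x) \<and> cmod e' \<le> 1 \<and>
     (x \<noteq> 0 \<longrightarrow> cmod e' \<le> \<epsilon> * \<beta> * \<bar>x\<bar> powr (\<beta> - 1) * exp (- (\<epsilon> * damp_rate \<beta> * \<bar>x\<bar> powr \<beta>)))"
proof -
  let ?w = "complex_of_real x" and ?z = "1 + complex_of_real x / \<omega>"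
  have w: "0 \<le> Re (?w / \<omega>)" using Re_real_over by simp
  note b = damp_base[OF \<beta> \<omega>(1) w]
  have \<omega>0: "\<omega> \<noteq> 0" using \<omega>(1) by auto
  have z: "?z \<notin> \<real>\<^sub>\<le>\<^sub>0" using Re_real_over[of x] by (simp add: complex_nonpos_Reals_iff)
  define e' where "e' = damp \<beta> \<omega> \<epsilon> ?w * (- (of_real \<epsilon> * (exp (of_real \<beta> * Ln ?z) * (of_real \<beta> * ((1 / \<omega>) / ?z)))))"
  have "(damp \<beta> \<omega> \<epsilon> has_field_derivative e') (at ?w)"
    unfolding damp_def e'_def by ((rule derivative_eq_intros refl z \<omega>0 | simp add: \<omega>0)+, simp add: divide_inverse mult_ac)
  from has_vector_derivative_real_field[OF this]
  have d: "((\<lambda>x. damp \<beta> \<omega> \<epsilon> (of_real x)) has_vector_derivative e') (at x)" .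
  have "cmod e' = cmod (damp \<beta> \<omega> \<epsilon> ?w) * (\<epsilon> * (cmod ?z powr \<beta> * (\<beta> / cmod ?z)))"
    unfolding e'_def using damp_exponent(1)[OF \<beta> \<omega>(1) w] \<omega>(1) \<beta> \<epsilon> by (simp add: norm_mult norm_divide)
  also have "cmod ?z powr \<beta> * (\<beta> / cmod ?z) = \<beta> * cmod ?z powr (\<beta> - 1)"
    using b(3) by (simp add: powr_diff)
  finally have n: "cmod e' = cmod (damp \<beta> \<omega> \<epsilon> ?w) * (\<epsilon> * \<beta> * cmod ?z powr (\<beta> - 1))" by simp
  have "cmod e' \<le> 1 * (1 * 1)" unfolding n
  proof (rule mult_mono)
    show "cmod (damp \<beta> \<omega> \<epsilon> ?w) \<le> 1" using damp_bound(3)[OF \<beta> \<omega>(1) w] \<epsilon> by simp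
    have "cmod ?z powr (\<beta> - 1) \<le> cmod ?z powr 0" using b(1) \<beta> by (intro powr_mono) auto
    then have "cmod ?z powr (\<beta> - 1) \<le> 1" using b(3) by simp
    moreover have "\<epsilon> * \<beta> \<le> 1 * 1" using \<epsilon> \<beta> by (intro mult_mono) auto
    ultimately show "\<epsilon> * \<beta> * cmod ?z powr (\<beta> - 1) \<le> 1 * 1" using \<epsilon> \<beta> by (intro mult_mono) auto
  qed (use \<epsilon> \<beta> in auto)
  moreover have "cmod e' \<le> \<epsilon> * \<beta> * \<bar>x\<bar> powr (\<beta> - 1) * exp (- (\<epsilon> * damp_rate \<beta> * \<bar>x\<bar> powr \<beta>))" if x: "x \<noteq> 0"
  proof -
    have "cmod ?z powr (\<beta> - 1) \<le> \<bar>x\<bar> powr (\<beta> - 1)"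
      using b(2) x \<beta> by (intro powr_mono2') auto
    then have "\<epsilon> * \<beta> * cmod ?z powr (\<beta> - 1) \<le> \<epsilon> * \<beta> * \<bar>x\<bar> powr (\<beta> - 1)" using \<epsilon> \<beta> by (intro mult_left_mono) auto
    moreover have "cmod (damp \<beta> \<omega> \<epsilon> ?w) \<le> exp (- (\<epsilon> * damp_rate \<beta> * \<bar>x\<bar> powr \<beta>))"
      using damp_bound(2)[OF \<beta> \<omega>(1) w, of \<epsilon>] \<epsilon> by simp
    ultimately show ?thesis unfolding n using \<epsilon> \<beta> by (subst mult.commute, intro mult_mono) auto
  qed
  ultimately show ?thesis using d by auto
qed

text \<open>Abel's estimate, with \<open>x\<close> itself as majorant of the variation on bounded intervals, and with a uniformly bounded
  majorant on intervals that avoid \<open>0\<close>.\<close>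

lemma damped_integral_bound:
  assumes pq: "p \<le> q" and f: "continuous_on {p..q} f" and \<epsilon>: "0 < \<epsilon>" "\<epsilon> \<le> 1"
    and \<eta>: "\<And>x. x \<in> {p..q} \<Longrightarrow> cmod (integral {p..x} f) \<le> \<eta>"
  shows "cmod (integral {p..q} (\<lambda>x. f x * damp \<beta> \<omega> \<epsilon> (of_real x))) \<le> \<eta> * (1 + (q - p))"
    "0 < p \<or> q < 0 \<Longrightarrow> cmod (integral {p..q} (\<lambda>x. f x * damp \<beta> \<omega> \<epsilon> (of_real x))) \<le> \<eta> * (1 + 1 / damp_rate \<beta>)"
proof -
  define \<kappa> where "\<kappa> = damp_rate \<beta>"
  have \<kappa>: "\<kappa> > 0" unfolding \<kappa>_def using damp_rate_pos[OF \<beta> \<omega>(1)] .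
  obtain e' where e': "\<And>x. ((\<lambda>x. damp \<beta> \<omega> \<epsilon> (of_real x)) has_vector_derivative e' x) (at x)" "\<And>x. cmod (e' x) \<le> 1"
     "\<And>x. x \<noteq> 0 \<Longrightarrow> cmod (e' x) \<le> \<epsilon> * \<beta> * \<bar>x\<bar> powr (\<beta> - 1) * exp (- (\<epsilon> * \<kappa> * \<bar>x\<bar> powr \<beta>))"
    using damp_real_derivative[OF \<epsilon>] unfolding \<kappa>_def by metis
  have eq: "cmod (damp \<beta> \<omega> \<epsilon> (of_real q)) \<le> 1"
    by (rule damp_bound(3)[OF \<beta> \<omega>(1)]) (use Re_real_over \<epsilon> in auto)
  have \<eta>0: "0 \<le> \<eta>" using \<eta>[of p] pq by simp
  show "cmod (integral {p..q} (\<lambda>x. f x * damp \<beta> \<omega> \<epsilon> (of_real x))) \<le> \<eta> * (1 + (q - p))"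
    by (rule abel_estimate[OF pq f e'(1) _ e'(2) eq \<eta>, where W = "\<lambda>x. x"]) (auto intro!: derivative_eq_intros)
  have W: "cmod (integral {p..q} (\<lambda>x. f x * damp \<beta> \<omega> \<epsilon> (of_real x))) \<le> \<eta> * (1 + 1 / \<kappa>)"
    if W1: "\<And>x. x \<in> {p..q} \<Longrightarrow> (W has_real_derivative \<epsilon> * \<beta> * \<bar>x\<bar> powr (\<beta> - 1) * exp (- (\<epsilon> * \<kappa> * \<bar>x\<bar> powr \<beta>))) (at x)"
      and W2: "W q - W p \<le> 1 / \<kappa>" and 0: "0 \<notin> {p..q}" for W
  proof -
    have "cmod (integral {p..q} (\<lambda>x. f x * damp \<beta> \<omega> \<epsilon> (of_real x))) \<le> \<eta> * (1 + (W q - W p))"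
      by (rule abel_estimate[OF pq f e'(1) W1 _ eq \<eta>]) (use 0 in \<open>auto intro!: e'(3)\<close>)
    also have "\<dots> \<le> \<eta> * (1 + 1 / \<kappa>)" using \<eta>0 W2 by (intro mult_left_mono) auto
    finally show ?thesis .
  qed
  assume pq0: "0 < p \<or> q < 0"
  have "cmod (integral {p..q} (\<lambda>x. f x * damp \<beta> \<omega> \<epsilon> (of_real x))) \<le> \<eta> * (1 + 1 / \<kappa>)"
  proof (cases "0 < p")
    case p: True
    show ?thesis
    proof (rule W[where W = "\<lambda>x. - exp (- (\<epsilon> * \<kappa> * x powr \<beta>)) / \<kappa>"])
      fix x assume "x \<in> {p..q}"
      then have x: "x > 0" using p by auto
      show "((\<lambda>x. - exp (- (\<epsilon> * \<kappa> * x powr \<beta>)) / \<kappa>) has_real_derivative \<epsilon> * \<beta> * \<bar>x\<bar> powr (\<beta> - 1) * exp (- (\<epsilon> * \<kappa> * \<bar>x\<bar> powr \<beta>))) (at x)"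
      proof -
        have d: "((\<lambda>x. x powr \<beta>) has_real_derivative \<beta> * x powr (\<beta> - 1)) (at x)"
          by (rule has_real_derivative_powr[OF x])
        have "((\<lambda>x. - exp (- (\<epsilon> * \<kappa> * x powr \<beta>)) / \<kappa>) has_real_derivative
          - (exp (- (\<epsilon> * \<kappa> * x powr \<beta>)) * - (\<epsilon> * \<kappa> * (\<beta> * x powr (\<beta> - 1)))) / \<kappa>) (at x)"
          by (intro DERIV_cdivide DERIV_fun_exp DERIV_minus DERIV_cmult d)
        then show ?thesis using x \<kappa> by (simp add: mult_ac)
      qed
    next
      have "exp (- (\<epsilon> * \<kappa> * p powr \<beta>)) \<le> 1" using \<epsilon> \<kappa> by simp
      moreover have "0 < exp (- (\<epsilon> * \<kappa> * q powr \<beta>))" by simp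
      ultimately have "exp (- (\<epsilon> * \<kappa> * p powr \<beta>)) - exp (- (\<epsilon> * \<kappa> * q powr \<beta>)) \<le> 1" by linarith
      then show "- exp (- (\<epsilon> * \<kappa> * q powr \<beta>)) / \<kappa> - - exp (- (\<epsilon> * \<kappa> * p powr \<beta>)) / \<kappa> \<le> 1 / \<kappa>"
        using \<kappa> by (simp add: divide_simps)
    qed (use p in auto)
  next
    case False
    then have q: "q < 0" using pq0 by simp
    show ?thesis
    proof (rule W[where W = "\<lambda>x. exp (- (\<epsilon> * \<kappa> * (- x) powr \<beta>)) / \<kappa>"])
      fix x assume "x \<in> {p..q}"
      then have x: "x < 0" using q by auto
      show "((\<lambda>x. exp (- (\<epsilon> * \<kappa> * (- x) powr \<beta>)) / \<kappa>) has_real_derivative \<epsilon> * \<beta> * \<bar>x\<bar> powr (\<beta> - 1) * exp (- (\<epsilon> * \<kappa> * \<bar>x\<bar> powr \<beta>))) (at x)"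
      proof -
        have d: "((\<lambda>x. (- x) powr \<beta>) has_real_derivative \<beta> * (- x) powr (\<beta> - 1) * (- 1)) (at x)"
          by (rule DERIV_chain2[OF has_real_derivative_powr]) (use x in \<open>auto intro!: derivative_eq_intros\<close>)
        have "((\<lambda>x. exp (- (\<epsilon> * \<kappa> * (- x) powr \<beta>)) / \<kappa>) has_real_derivative
          (exp (- (\<epsilon> * \<kappa> * (- x) powr \<beta>)) * - (\<epsilon> * \<kappa> * (\<beta> * (- x) powr (\<beta> - 1) * (- 1)))) / \<kappa>) (at x)"
          by (intro DERIV_cdivide DERIV_fun_exp DERIV_minus DERIV_cmult d)
        then show ?thesis using x \<kappa> by (simp add: mult_ac)
      qed
    next
      have "exp (- (\<epsilon> * \<kappa> * (- q) powr \<beta>)) \<le> 1" using \<epsilon> \<kappa> by simp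
      moreover have "0 < exp (- (\<epsilon> * \<kappa> * (- p) powr \<beta>))" by simp
      ultimately have "exp (- (\<epsilon> * \<kappa> * (- q) powr \<beta>)) - exp (- (\<epsilon> * \<kappa> * (- p) powr \<beta>)) \<le> 1" by linarith
      then show "exp (- (\<epsilon> * \<kappa> * (- q) powr \<beta>)) / \<kappa> - exp (- (\<epsilon> * \<kappa> * (- p) powr \<beta>)) / \<kappa> \<le> 1 / \<kappa>"
        using \<kappa> by (simp add: divide_simps)
    qed (use q in auto)
  qed
  then show "cmod (integral {p..q} (\<lambda>x. f x * damp \<beta> \<omega> \<epsilon> (of_real x))) \<le> \<eta> * (1 + 1 / damp_rate \<beta>)"
    by (simp add: \<kappa>_def)
qed

lemma damped_right_tail:
  assumes c: "c \<in> interval0 m1 m2"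
  shows "\<exists>b1\<in>interval0 m1 m2. \<exists>V\<ge>0. \<forall>p q f \<eta> \<epsilon>. b1 \<le> p \<and> p \<le> q \<and> q \<in> interval0 m1 m2 \<and> continuous_on {p..q} f \<and> 0 < \<epsilon> \<and> \<epsilon> \<le> 1 \<and>
     (\<forall>x\<in>{p..q}. cmod (integral {p..x} f) \<le> \<eta>) \<longrightarrow>
     cmod (integral {p..q} (\<lambda>x. f x * damp \<beta> \<omega> \<epsilon> (of_real x))) \<le> \<eta> * (1 + V)"
proof (cases "m2 = \<infinity>")
  case True
  have "m1 < ereal c" using c by (simp add: interval0_def)
  also have "ereal c \<le> ereal (max c 1)" by simp
  finally have "max c 1 \<in> interval0 m1 m2" using True by (simp add: interval0_def)
  moreover have "1 / damp_rate \<beta> \<ge> 0" using damp_rate_pos[OF \<beta> \<omega>(1)] by simp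
  ultimately show ?thesis
    by (intro bexI[of _ "max c 1"] exI[of _ "1 / damp_rate \<beta>"]) (auto intro!: damped_integral_bound(2))
next
  case False
  then obtain r where r: "m2 = ereal r" using c by (cases m2) (auto simp: interval0_def)
  have bd: "cmod (integral {p..q} (\<lambda>x. f x * damp \<beta> \<omega> \<epsilon> (of_real x))) \<le> \<eta> * (1 + (r - c))"
    if "c \<le> p" "p \<le> q" "q \<in> interval0 m1 m2" "continuous_on {p..q} f" "0 < \<epsilon>" "\<epsilon> \<le> 1"
     "\<And>x. x \<in> {p..q} \<Longrightarrow> cmod (integral {p..x} f) \<le> \<eta>" for p q f \<eta> \<epsilon>
  proof -
    have "0 \<le> \<eta>" using that(7)[of p] that(2) by simp
    then have "\<eta> * (1 + (q - p)) \<le> \<eta> * (1 + (r - c))" using that(1-3) r by (intro mult_left_mono) (auto simp: interval0_def)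
    then show ?thesis using damped_integral_bound(1)[OF that(2,4-7)] by linarith
  qed
  have "0 \<le> r - c" using c r by (auto simp: interval0_def)
  then show ?thesis using c bd by (intro bexI[OF _ c] exI[of _ "r - c"]) auto
qed

lemma damped_left_tail:
  assumes c: "c \<in> interval0 m1 m2"
  shows "\<exists>a1\<in>interval0 m1 m2. \<exists>V\<ge>0. \<forall>p q f \<eta> \<epsilon>. p \<in> interval0 m1 m2 \<and> p \<le> q \<and> q \<le> a1 \<and> continuous_on {p..q} f \<and> 0 < \<epsilon> \<and> \<epsilon> \<le> 1 \<and>
     (\<forall>x\<in>{p..q}. cmod (integral {p..x} f) \<le> \<eta>) \<longrightarrow>
     cmod (integral {p..q} (\<lambda>x. f x * damp \<beta> \<omega> \<epsilon> (of_real x))) \<le> \<eta> * (1 + V)"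
proof (cases "m1 = -\<infinity>")
  case True
  have "ereal (min c (-1)) \<le> ereal c" by simp
  also have "ereal c < m2" using c by (simp add: interval0_def)
  finally have "min c (-1) \<in> interval0 m1 m2" using True by (simp add: interval0_def)
  moreover have "1 / damp_rate \<beta> \<ge> 0" using damp_rate_pos[OF \<beta> \<omega>(1)] by simp
  ultimately show ?thesis
    by (intro bexI[of _ "min c (-1)"] exI[of _ "1 / damp_rate \<beta>"]) (auto intro!: damped_integral_bound(2))
next
  case False
  then obtain r where r: "m1 = ereal r" using c by (cases m1) (auto simp: interval0_def)
  have bd: "cmod (integral {p..q} (\<lambda>x. f x * damp \<beta> \<omega> \<epsilon> (of_real x))) \<le> \<eta> * (1 + (c - r))"
    if "p \<in> interval0 m1 m2" "p \<le> q" "q \<le> c" "continuous_on {p..q} f" "0 < \<epsilon>" "\<epsilon> \<le> 1"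
     "\<And>x. x \<in> {p..q} \<Longrightarrow> cmod (integral {p..x} f) \<le> \<eta>" for p q f \<eta> \<epsilon>
  proof -
    have "0 \<le> \<eta>" using that(7)[of p] that(2) by simp
    then have "\<eta> * (1 + (q - p)) \<le> \<eta> * (1 + (c - r))" using that(1-3) r by (intro mult_left_mono) (auto simp: interval0_def)
    then show ?thesis using damped_integral_bound(1)[OF that(2,4-7)] by linarith
  qed
  have "0 \<le> c - r" using c r by (auto simp: interval0_def)
  then show ?thesis using c bd by (intro bexI[OF _ c] exI[of _ "c - r"]) auto
qed

end

section \<open>Deformation of the contour\<close>

lemma integral_small_at_ends:
  fixes k :: "real \<Rightarrow> real"
  assumes k: "k integrable_on {0..1}" and pos: "\<And>t. t \<in> {0..1} \<Longrightarrow> 0 \<le> k t" and \<eta>: "\<eta> > 0" and \<tau>: "\<tau> > 0"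
  shows "\<exists>\<sigma>>0. \<sigma> < 1/2 \<and> \<sigma> \<le> \<tau> \<and> integral {0..\<sigma>} k \<le> \<eta> \<and> integral {1-\<sigma>..1} k \<le> \<eta>"
proof -
  define N where "N x = integral {0..x} k" for x
  have cont: "continuous_on {0..1} N" unfolding N_def by (rule indefinite_integral_continuous_1[OF k])
  have N0: "N 0 = 0" by (simp add: N_def)
  obtain d1 where d1: "d1 > 0" "\<And>x. x \<in> {0..1} \<Longrightarrow> dist x 0 < d1 \<Longrightarrow> dist (N x) (N 0) < \<eta>"
    using cont \<eta> unfolding continuous_on_iff by (metis atLeastAtMost_iff order_refl zero_le_one)
  obtain d2 where d2: "d2 > 0" "\<And>x. x \<in> {0..1} \<Longrightarrow> dist x 1 < d2 \<Longrightarrow> dist (N x) (N 1) < \<eta>"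
    using cont \<eta> unfolding continuous_on_iff by (metis atLeastAtMost_iff order_refl zero_le_one)
  define \<sigma> where "\<sigma> = min (min d1 d2) (min \<tau> 1) / 3"
  have \<sigma>: "0 < \<sigma>" "\<sigma> < 1/2" "\<sigma> \<le> \<tau>" "\<sigma> < d1" "\<sigma> < d2" unfolding \<sigma>_def using d1(1) d2(1) \<tau> by (auto simp: min_def)
  have "N \<sigma> \<le> \<eta>" using d1(2)[of \<sigma>] \<sigma> N0 by (simp add: dist_real_def)
  moreover have "integral {1-\<sigma>..1} k \<le> \<eta>"
  proof -
    have "N (1 - \<sigma>) + integral {1-\<sigma>..1} k = N 1"
      unfolding N_def using \<sigma> by (intro Henstock_Kurzweil_Integration.integral_combine k) auto
    then show ?thesis using d2(2)[of "1 - \<sigma>"] \<sigma> by (simp add: dist_real_def abs_less_iff)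
  qed
  ultimately show ?thesis using \<sigma> unfolding N_def by blast
qed

text \<open>Cauchy's theorem for a contour and an interval which are joined by a homotopy that fixes the possibly infinite
  end points. On the interval \<open>L\<close> is an improper integral, whose convergence may be conditional.\<close>

theorem contour_integral_eq_real_integral:
  fixes h :: "real \<times> real \<Rightarrow> complex" and \<phi> :: "real \<Rightarrow> real" and \<gamma> :: "real \<Rightarrow> complex"
  assumes U: "open U" "f holomorphic_on U" and SU: "S \<subseteq> U"
    and \<omega>: "cmod \<omega> = 1" "Re (1 / \<omega>) = 0" "\<And>w c. w \<in> S \<Longrightarrow> 0 \<le> Re ((w - complex_of_real c) / \<omega>)"
    and m12: "m1 < m2"
    and cont: "continuous_on ({0<..<1} \<times> {0..1}) h" and hS: "h ` ({0<..<1} \<times> {0..1}) \<subseteq> S"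
    and \<phi>: "strict_mono_on {0<..<1} \<phi>" "\<phi> ` {0<..<1} = interval0 m1 m2"
    and h01: "\<And>s. s \<in> {0<..<1} \<Longrightarrow> h (s, 0) = of_real (\<phi> s) \<and> h (s, 1) = \<gamma> s"
    and lim: "filterlim h (end_filter m1) (at_right 0 \<times>\<^sub>F principal {0..1})"
      "filterlim h (end_filter m2) (at_left 1 \<times>\<^sub>F principal {0..1})"
    and m: "\<And>m. m \<in> {m1, m2} \<Longrightarrow> \<bar>m\<bar> \<noteq> \<infinity> \<Longrightarrow> of_real (real_of_ereal m) \<notin> S"
    and fin: "\<And>m. m \<in> {m1, m2} \<Longrightarrow> \<bar>m\<bar> \<noteq> \<infinity> \<Longrightarrow> \<exists>C g. -1 < g \<and> (\<exists>\<delta>>0. \<forall>w\<in>S. dist w (of_real (real_of_ereal m)) < \<delta> \<longrightarrow>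
       cmod (f w) \<le> C * dist w (of_real (real_of_ereal m)) powr g)"
    and inf: "\<And>m. m \<in> {m1, m2} \<Longrightarrow> \<bar>m\<bar> = \<infinity> \<Longrightarrow> \<exists>C \<alpha>. \<alpha> < 1 \<and> (\<exists>R. \<forall>w\<in>S. R < cmod w \<longrightarrow> cmod (f w) \<le> C * exp (cmod w powr \<alpha>))"
    and lip: "\<And>a b. 0 < a \<Longrightarrow> b < 1 \<Longrightarrow> \<exists>L. L-lipschitz_on {a..b} \<gamma>"
    and I: "((\<lambda>t. f (\<gamma> t) * vector_derivative \<gamma> (at t)) has_integral I) {0<..<1}"
      "(\<lambda>t. cmod (f (\<gamma> t) * vector_derivative \<gamma> (at t))) integrable_on {0<..<1}"
    and L: "\<And>\<eta>. \<eta> > 0 \<Longrightarrow> \<exists>a0 b0. a0 \<in> interval0 m1 m2 \<and> b0 \<in> interval0 m1 m2 \<and> a0 < b0 \<and>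
      (\<forall>a b. a \<in> interval0 m1 m2 \<and> b \<in> interval0 m1 m2 \<and> a \<le> a0 \<and> b0 \<le> b \<longrightarrow>
         cmod (integral {a..b} (\<lambda>x. f (of_real x)) - L) < \<eta>)"
  shows "I = L"
proof -
  let ?D = "interval0 m1 m2"
  have D_between: "x \<in> ?D" if "a \<in> ?D" "b \<in> ?D" "a \<le> x" "x \<le> b" for a b x
    using that less_le_trans[of m1 "ereal a" "ereal x"] le_less_trans[of "ereal x" "ereal b" m2] by (simp add: interval0_def)
  have realS: "of_real x \<in> S" if x: "x \<in> ?D" for x
  proof -
    obtain s where "s \<in> {0<..<1}" "\<phi> s = x" using x unfolding \<phi>(2)[symmetric] by blast
    then show ?thesis using h01[of s] imageI[of "(s, 0)" "{0<..<1} \<times> {0..1}" h] hS by auto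
  qed
  have contf: "continuous_on {a..b} (\<lambda>x. f (of_real x))" if "a \<in> ?D" "b \<in> ?D" for a b
  proof (rule continuous_on_compose2[OF holomorphic_on_imp_continuous_on[OF U(2)]])
    show "complex_of_real ` {a..b} \<subseteq> U" using D_between[OF that] realS SU by auto
  qed (intro continuous_intros)
  have intf: "(\<lambda>x. f (of_real x)) integrable_on {a..b}" if "a \<in> ?D" "b \<in> ?D" for a b
    by (rule integrable_continuous_interval[OF contf[OF that]])
  have S0: "0 \<le> Re (w / \<omega>)" if "w \<in> S" for w using \<omega>(3)[OF that, of 0] by simp
  have \<omega>0: "\<omega> \<noteq> 0" using \<omega>(1) by auto
  have "\<exists>\<alpha><1. \<bar>m\<bar> = \<infinity> \<longrightarrow> (\<exists>C R. \<forall>w\<in>S. R < cmod w \<longrightarrow> cmod (f w) \<le> C * exp (cmod w powr \<alpha>))" if "m \<in> {m1, m2}" for m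
  proof (cases "\<bar>m\<bar> = \<infinity>")
    case True
    from inf[OF that True] show ?thesis by blast
  next
    case False
    then show ?thesis by (intro exI[of _ 0]) simp
  qed
  then obtain \<alpha> where \<alpha>: "\<And>m. m \<in> {m1,m2} \<Longrightarrow> \<alpha> m < 1" "\<And>m. m \<in> {m1,m2} \<Longrightarrow> \<bar>m\<bar> = \<infinity> \<Longrightarrow> 
     \<exists>C R. \<forall>w\<in>S. R < cmod w \<longrightarrow> cmod (f w) \<le> C * exp (cmod w powr \<alpha> m)" by metis
  \<comment> \<open>One damping exponent for both ends, above the two growth exponents.\<close>
  define \<beta> where "\<beta> = (max 0 (max (\<alpha> m1) (\<alpha> m2)) + 1) / 2"
  have \<beta>: "0 < \<beta>" "\<beta> < 1" "\<And>m. m \<in> {m1,m2} \<Longrightarrow> \<alpha> m < \<beta>"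
    unfolding \<beta>_def using \<alpha>(1)[of m1] \<alpha>(1)[of m2] by (auto simp: max_def)
  have small: "end_small (\<lambda>w. f w * damp \<beta> \<omega> \<epsilon> w) S m" if "m \<in> {m1,m2}" "\<epsilon> > 0" for m \<epsilon>
  proof (rule end_small_damp[OF \<beta>(1,2) \<omega>(1) S0 that(2) fin[OF that(1)]])
    assume "\<bar>m\<bar> = \<infinity>"
    from \<alpha>(2)[OF that(1) this] \<beta>(3)[OF that(1)]
    show "\<exists>C \<alpha>. \<alpha> < \<beta> \<and> (\<exists>R. \<forall>w\<in>S. R < cmod w \<longrightarrow> cmod (f w) \<le> C * exp (cmod w powr \<alpha>))" by blast
  qed
  define U' where "U' = U \<inter> {w. -1 < Re (w / \<omega>)}"
  have U'o: "open U'" unfolding U'_def by (intro open_Int U open_Collect_less continuous_intros) (use \<omega>0 in auto)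
  have SU': "S \<subseteq> U'" unfolding U'_def using SU S0 by force
  have holF: "(\<lambda>w. f w * damp \<beta> \<omega> \<epsilon> w) holomorphic_on U'" for \<epsilon>
    by (intro holomorphic_on_mult holomorphic_on_subset[OF U(2)] holomorphic_on_subset[OF damp_holomorphic[OF \<omega>0]])
      (auto simp: U'_def)
  obtain c where c: "c \<in> ?D" using L[of 1] by auto
  obtain b1 V2 where b1: "b1 \<in> ?D" "V2 \<ge> 0" "\<And>p q f \<eta> \<epsilon>. b1 \<le> p \<Longrightarrow> p \<le> q \<Longrightarrow> q \<in> ?D \<Longrightarrow> continuous_on {p..q} f \<Longrightarrow> 0 < \<epsilon> \<Longrightarrow> \<epsilon> \<le> 1 \<Longrightarrow>
     (\<forall>x\<in>{p..q}. cmod (integral {p..x} f) \<le> \<eta>) \<Longrightarrow>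
     cmod (integral {p..q} (\<lambda>x. f x * damp \<beta> \<omega> \<epsilon> (of_real x))) \<le> \<eta> * (1 + V2)"
    using damped_right_tail[OF \<beta>(1,2) \<omega>(1,2) c] by blast
  obtain a1 V1 where a1: "a1 \<in> ?D" "V1 \<ge> 0" "\<And>p q f \<eta> \<epsilon>. p \<in> ?D \<Longrightarrow> p \<le> q \<Longrightarrow> q \<le> a1 \<Longrightarrow> continuous_on {p..q} f \<Longrightarrow> 0 < \<epsilon> \<Longrightarrow> \<epsilon> \<le> 1 \<Longrightarrow>
     (\<forall>x\<in>{p..q}. cmod (integral {p..x} f) \<le> \<eta>) \<Longrightarrow>
     cmod (integral {p..q} (\<lambda>x. f x * damp \<beta> \<omega> \<epsilon> (of_real x))) \<le> \<eta> * (1 + V1)"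
    using damped_left_tail[OF \<beta>(1,2) \<omega>(1,2) c] by blast
  define k where "k t = f (\<gamma> t) * vector_derivative \<gamma> (at t)" for t
  have kI: "(k has_integral I) {0..1}" using I(1) unfolding k_def has_integral_Icc_iff_Ioo .
  have kn: "(\<lambda>t. cmod (k t)) integrable_on {0..1}" using I(2) unfolding k_def integrable_on_Icc_iff_Ioo .
  have ki: "k integrable_on {p..q}" "(\<lambda>t. cmod (k t)) integrable_on {p..q}" if "0 \<le> p" "q \<le> 1" for p q
    using that kI kn by (auto intro: integrable_subinterval_real dest: has_integral_integrable)
  have \<gamma>S: "\<gamma> t \<in> S" if "t \<in> {0<..<1}" for t
    using that h01[of t] imageI[of "(t, 1)" "{0<..<1} \<times> {0..1}" h] hS by auto
  define N where "N = integral {0..1} (\<lambda>t. cmod (k t))"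
  have N0: "0 \<le> N" unfolding N_def by (rule integral_nonneg[OF kn]) auto
  have main: "cmod (I - L) \<le> \<eta> * (9 + 2 * (1 + V1) + 2 * (1 + V2))" if \<eta>: "\<eta> > 0" for \<eta>
  proof -
    obtain a00 b00 where ab00: "a00 \<in> ?D" "b00 \<in> ?D" "a00 < b00"
      "\<And>a b. a \<in> ?D \<Longrightarrow> b \<in> ?D \<Longrightarrow> a \<le> a00 \<Longrightarrow> b00 \<le> b \<Longrightarrow> cmod (integral {a..b} (\<lambda>x. f (of_real x)) - L) < \<eta>"
      using L[OF \<eta>] by blast
    define a0 where "a0 = min a00 a1"
    define b0 where "b0 = max b00 b1"
    have a0: "a0 \<in> ?D" "a0 \<le> a1" "a0 \<le> a00" using ab00(1) a1(1) unfolding a0_def by (auto simp: min_def)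
    have b0: "b0 \<in> ?D" "b1 \<le> b0" "b00 \<le> b0" using ab00(2) b1(1) unfolding b0_def by (auto simp: max_def)
    have ab0: "a0 < b0" using ab00(3) a0(3) b0(3) by linarith
    have close: "cmod (integral {a..b} (\<lambda>x. f (of_real x)) - L) < \<eta>" if "a \<in> ?D" "b \<in> ?D" "a \<le> a0" "b0 \<le> b" for a b
      using ab00(4)[OF that(1,2)] that a0 b0 by linarith
    obtain sa where sa: "sa \<in> {0<..<1}" "\<phi> sa = a0" using a0(1) unfolding \<phi>(2)[symmetric] by blast
    obtain sb where sb: "sb \<in> {0<..<1}" "\<phi> sb = b0" using b0(1) unfolding \<phi>(2)[symmetric] by blast
    obtain \<sigma> where \<sigma>: "0 < \<sigma>" "\<sigma> < 1/2" "\<sigma> \<le> min sa (1 - sb)" "integral {0..\<sigma>} (\<lambda>t. cmod (k t)) \<le> \<eta>" "integral {1-\<sigma>..1} (\<lambda>t. cmod (k t)) \<le> \<eta>"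
      using integral_small_at_ends[OF kn _ \<eta>, of "min sa (1 - sb)"] sa(1) sb(1) by auto
    have "bounded ((\<lambda>x. f (of_real x)) ` {a0..b0})"
      by (intro compact_imp_bounded compact_continuous_image contf a0 b0 compact_Icc)
    then obtain Mf where Mf: "\<And>x. x \<in> {a0..b0} \<Longrightarrow> cmod (f (of_real x)) \<le> Mf" unfolding bounded_iff by blast
    have Mf0: "0 \<le> Mf" using order_trans[OF norm_ge_zero Mf[of a0]] ab0 by simp
    obtain Lc where "Lc-lipschitz_on {\<sigma>..1-\<sigma>} \<gamma>" using lip[of \<sigma> "1 - \<sigma>"] \<sigma> by auto
    then have "bounded (\<gamma> ` {\<sigma>..1-\<sigma>})"
      by (intro compact_imp_bounded compact_continuous_image lipschitz_on_continuous_on compact_Icc)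
    then obtain R1 where R1: "\<And>t. t \<in> {\<sigma>..1-\<sigma>} \<Longrightarrow> cmod (\<gamma> t) \<le> R1" unfolding bounded_iff by blast
    define R where "R = max R1 (max \<bar>a0\<bar> \<bar>b0\<bar>)"
    \<comment> \<open>This tolerance makes both middle parts, which are bounded by \<open>\<tau> N\<close> and \<open>\<tau> Mf (b0 - a0)\<close>, at most \<open>\<eta>\<close>.\<close>
    define \<tau> where "\<tau> = \<eta> / (1 + N + Mf * (b0 - a0))"
    have den: "1 + N + Mf * (b0 - a0) > 0" using N0 Mf0 ab0 by (simp add: add_pos_nonneg)
    have \<tau>: "\<tau> > 0" unfolding \<tau>_def using \<eta> den by simp
    have \<tau>1: "\<tau> * (1 + N + Mf * (b0 - a0)) = \<eta>" unfolding \<tau>_def using den by simp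
    have \<tau>N: "\<tau> * N \<le> \<eta>" "\<tau> * (Mf * (b0 - a0)) \<le> \<eta>"
      using mult_left_mono[of N "1 + N + Mf * (b0 - a0)" \<tau>] mult_left_mono[of "Mf * (b0 - a0)" "1 + N + Mf * (b0 - a0)" \<tau>] \<tau> \<tau>1 N0 Mf0 ab0
      by auto
    obtain \<epsilon> where \<epsilon>: "0 < \<epsilon>" "\<epsilon> \<le> 1" "\<And>w. 0 \<le> Re (w / \<omega>) \<Longrightarrow> cmod w \<le> R \<Longrightarrow> cmod (damp \<beta> \<omega> \<epsilon> w - 1) \<le> \<tau>"
      using damp_tendsto_1[OF \<beta>(1,2) \<omega>(1) \<tau>, of R] by blast
    define e where "e w = damp \<beta> \<omega> \<epsilon> w" for w
    have e1: "cmod (e w) \<le> 1" if "w \<in> S" for w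
      unfolding e_def by (rule damp_bound(3)[OF \<beta>(1,2) \<omega>(1) S0[OF that]]) (use \<epsilon> in auto)
    have "\<exists>s0\<in>{0<..\<sigma>}. \<exists>s1\<in>{0<..\<sigma>}. \<exists>s0'\<in>{1-\<sigma>..<1}. \<exists>s1'\<in>{1-\<sigma>..<1}.
       (\<lambda>t. f (\<gamma> t) * damp \<beta> \<omega> \<epsilon> (\<gamma> t) * vector_derivative \<gamma> (at t)) integrable_on {s1..s1'} \<and>
       cmod (integral {s1..s1'} (\<lambda>t. f (\<gamma> t) * damp \<beta> \<omega> \<epsilon> (\<gamma> t) * vector_derivative \<gamma> (at t)) 
         - integral {\<phi> s0..\<phi> s0'} (\<lambda>x. f (of_real x) * damp \<beta> \<omega> \<epsilon> (of_real x))) \<le> 2 * \<eta>"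
      by (rule contour_integral_close_to_real_integral[OF U'o holF SU' \<omega>(1,3) cont hS \<phi>(1) h01 lim small small m lip \<sigma>(1,2) \<eta>])
        (use \<epsilon> in auto)
    then obtain s0 s1 s0' s1' where s: "s0 \<in> {0<..\<sigma>}" "s1 \<in> {0<..\<sigma>}" "s0' \<in> {1-\<sigma>..<1}" "s1' \<in> {1-\<sigma>..<1}"
      and ke0: "(\<lambda>t. f (\<gamma> t) * damp \<beta> \<omega> \<epsilon> (\<gamma> t) * vector_derivative \<gamma> (at t)) integrable_on {s1..s1'}"
      and cl: "cmod (integral {s1..s1'} (\<lambda>t. f (\<gamma> t) * damp \<beta> \<omega> \<epsilon> (\<gamma> t) * vector_derivative \<gamma> (at t)) 
         - integral {\<phi> s0..\<phi> s0'} (\<lambda>x. f (of_real x) * damp \<beta> \<omega> \<epsilon> (of_real x))) \<le> 2 * \<eta>"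
      by blast
    define ke where "ke t = k t * e (\<gamma> t)" for t
    have ke_eq: "(\<lambda>t. f (\<gamma> t) * damp \<beta> \<omega> \<epsilon> (\<gamma> t) * vector_derivative \<gamma> (at t)) = ke"
      by (simp add: ke_def k_def e_def fun_eq_iff)
    have kei: "ke integrable_on {p..q}" if "s1 \<le> p" "q \<le> s1'" for p q
      by (rule integrable_subinterval_real[OF ke0[unfolded ke_eq]]) (use that in auto)
    have ke_le: "cmod (ke t) \<le> cmod (k t)" if "t \<in> {0<..<1}" for t
      using mult_left_mono[OF e1[OF \<gamma>S[OF that]], of "cmod (k t)"] by (simp add: ke_def norm_mult)
    have s1p: "0 < s1" "s1 \<le> \<sigma>" "\<sigma> \<le> 1 - \<sigma>" "1 - \<sigma> \<le> s1'" "s1' < 1" using s \<sigma> by auto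
    \<comment> \<open>Outside \<open>[\<sigma>, 1 - \<sigma>]\<close> both integrals are small since \<open>k\<close> is absolutely integrable; inside, the damping
      factor is within \<open>\<tau>\<close> of \<open>1\<close>.\<close>
    have C: "cmod (integral {s1..s1'} ke - I) \<le> 5 * \<eta>"
    proof -
      have split_ke: "integral {s1..s1'} ke = integral {s1..\<sigma>} ke + integral {\<sigma>..1-\<sigma>} ke + integral {1-\<sigma>..s1'} ke"
        using Henstock_Kurzweil_Integration.integral_combine[of s1 \<sigma> s1' ke] Henstock_Kurzweil_Integration.integral_combine[of \<sigma> "1-\<sigma>" s1' ke] kei[of s1 s1'] kei[of \<sigma> s1'] s1p
        by (simp add: add.assoc)
      have split_k: "I = integral {0..\<sigma>} k + integral {\<sigma>..1-\<sigma>} k + integral {1-\<sigma>..1} k"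
        using Henstock_Kurzweil_Integration.integral_combine[of 0 \<sigma> 1 k] Henstock_Kurzweil_Integration.integral_combine[of \<sigma> "1-\<sigma>" 1 k] ki(1)[of 0 1] ki(1)[of \<sigma> 1] s1p \<sigma> integral_unique[OF kI]
        by (simp add: add.assoc)
      have 1: "cmod (integral {s1..\<sigma>} ke) \<le> \<eta>"
      proof -
        have "cmod (integral {s1..\<sigma>} ke) \<le> integral {s1..\<sigma>} (\<lambda>t. cmod (k t))"
          by (rule integral_norm_bound_integral[OF kei ki(2)]) (use s1p ke_le in auto)
        also have "\<dots> \<le> integral {0..\<sigma>} (\<lambda>t. cmod (k t))"
          by (rule integral_subset_le) (use s1p ki(2) in auto)
        finally show ?thesis using \<sigma>(4) by linarith
      qed
      have 2: "cmod (integral {1-\<sigma>..s1'} ke) \<le> \<eta>"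
      proof -
        have "cmod (integral {1-\<sigma>..s1'} ke) \<le> integral {1-\<sigma>..s1'} (\<lambda>t. cmod (k t))"
          by (rule integral_norm_bound_integral[OF kei ki(2)]) (use s1p ke_le in auto)
        also have "\<dots> \<le> integral {1-\<sigma>..1} (\<lambda>t. cmod (k t))"
          by (rule integral_subset_le) (use s1p ki(2) in auto)
        finally show ?thesis using \<sigma>(5) by linarith
      qed
      have 3: "cmod (integral {0..\<sigma>} k) \<le> \<eta>"
        using integral_norm_bound_integral[OF ki(1) ki(2), of 0 \<sigma>] \<sigma> by force
      have 4: "cmod (integral {1-\<sigma>..1} k) \<le> \<eta>"
        using integral_norm_bound_integral[OF ki(1) ki(2), of "1-\<sigma>" 1] \<sigma> by force
      have 5: "cmod (integral {\<sigma>..1-\<sigma>} ke - integral {\<sigma>..1-\<sigma>} k) \<le> \<eta>"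
      proof -
        have "integral {\<sigma>..1-\<sigma>} ke - integral {\<sigma>..1-\<sigma>} k = integral {\<sigma>..1-\<sigma>} (\<lambda>t. ke t - k t)"
          using s1p by (intro Henstock_Kurzweil_Integration.integral_diff[symmetric] kei ki) auto
        also have "cmod \<dots> \<le> integral {\<sigma>..1-\<sigma>} (\<lambda>t. \<tau> * cmod (k t))"
        proof (rule integral_norm_bound_integral)
          show "(\<lambda>t. ke t - k t) integrable_on {\<sigma>..1-\<sigma>}" using s1p by (intro integrable_diff kei ki) auto
          show "(\<lambda>t. \<tau> * cmod (k t)) integrable_on {\<sigma>..1-\<sigma>}" using ki(2)[of \<sigma> "1-\<sigma>"] s1p integrable_on_mult_right by fastforce
          fix t assume t: "t \<in> {\<sigma>..1-\<sigma>}"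
          then have "t \<in> {0<..<1}" using s1p \<sigma> by auto
          from S0[OF \<gamma>S[OF this]] have "cmod (e (\<gamma> t) - 1) \<le> \<tau>" unfolding e_def using R1[OF t] by (intro \<epsilon>(3)) (auto simp: R_def)
          then have "cmod (k t) * cmod (e (\<gamma> t) - 1) \<le> cmod (k t) * \<tau>" by (rule mult_left_mono) simp
          moreover have "ke t - k t = k t * (e (\<gamma> t) - 1)" by (simp add: ke_def algebra_simps)
          ultimately show "cmod (ke t - k t) \<le> \<tau> * cmod (k t)" by (simp add: norm_mult mult.commute)
        qed
        also have "\<dots> = \<tau> * integral {\<sigma>..1-\<sigma>} (\<lambda>t. cmod (k t))" by simp
        also have "\<dots> \<le> \<tau> * N" unfolding N_def
          using s1p \<sigma> \<tau> by (intro mult_left_mono integral_subset_le ki) auto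
        finally show ?thesis using \<tau>N(1) by linarith
      qed
      have "integral {s1..s1'} ke - I = integral {s1..\<sigma>} ke + integral {1-\<sigma>..s1'} ke + (integral {\<sigma>..1-\<sigma>} ke - integral {\<sigma>..1-\<sigma>} k)
         - integral {0..\<sigma>} k - integral {1-\<sigma>..1} k" unfolding split_ke split_k by simp
      also have "cmod \<dots> \<le> \<eta> + \<eta> + \<eta> + \<eta> + \<eta>"
        by (intro norm_triangle_le_diff norm_triangle_le add_mono order_trans[OF norm_triangle_ineq4] order_trans[OF norm_triangle_ineq] 1 2 3 4 5)
      finally show ?thesis by simp
    qed
    \<comment> \<open>Beyond \<open>a0\<close> and \<open>b0\<close> the partial integrals of \<open>f\<close> are at most \<open>2 \<eta>\<close>, and the damped ones are controlled by
      the variation of the damping factor.\<close>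
    define a where "a = \<phi> s0"
    define b where "b = \<phi> s0'"
    have s01: "s0 \<in> {0<..<1}" "s0' \<in> {0<..<1}" "s0 \<le> sa" "sb \<le> s0'" using s \<sigma> by auto
    have a: "a \<in> ?D" "a \<le> a0" unfolding a_def sa(2)[symmetric] \<phi>(2)[symmetric]
      using s01 sa(1) strict_mono_on_leD[OF \<phi>(1)] by auto
    have b: "b \<in> ?D" "b0 \<le> b" unfolding b_def sb(2)[symmetric] \<phi>(2)[symmetric]
      using s01 sb(1) strict_mono_on_leD[OF \<phi>(1)] by auto
    let ?f = "\<lambda>x. f (complex_of_real x)"
    let ?fe = "\<lambda>x. f (complex_of_real x) * damp \<beta> \<omega> \<epsilon> (complex_of_real x)"
    have fei: "?fe integrable_on {p..q}" if "p \<in> ?D" "q \<in> ?D" for p q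
    proof (rule integrable_continuous_interval, rule continuous_on_compose2[OF holomorphic_on_imp_continuous_on[OF holF[of \<epsilon>]]])
      show "complex_of_real ` {p..q} \<subseteq> U'" using D_between[OF that] realS SU' by auto
    qed (intro continuous_intros)
    have split: "integral {p..r} g = integral {p..q} g + integral {q..r} g"
      if "\<And>x y. x \<in> ?D \<Longrightarrow> y \<in> ?D \<Longrightarrow> g integrable_on {x..y}" "p \<in> ?D" "r \<in> ?D" "p \<le> q" "q \<le> r" for p q r and g :: "real \<Rightarrow> complex"
      by (rule Henstock_Kurzweil_Integration.integral_combine[OF that(4,5) that(1)[OF that(2,3)], symmetric])
    have two: "cmod (x - y) \<le> 2 * \<eta>" if "cmod (x - L) < \<eta>" "cmod (y - L) < \<eta>" for x y
      using norm_triangle_ineq4[of "x - L" "y - L"] that by simp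
    have l: "cmod (integral {a..a0} ?fe) \<le> 2 * \<eta> * (1 + V1)"
    proof (rule a1(3)[OF a(1,2) a0(2) contf[OF a(1) a0(1)] \<epsilon>(1,2)], rule ballI)
      fix x assume x: "x \<in> {a..a0}"
      have xD: "x \<in> ?D" using D_between[OF a(1) a0(1)] x by auto
      have "integral {a..b0} ?f = integral {a..x} ?f + integral {x..b0} ?f" by (rule split[OF intf a(1) b0(1)]) (use x ab0 in auto)
      then have "integral {a..x} ?f = integral {a..b0} ?f - integral {x..b0} ?f" by simp
      then show "cmod (integral {a..x} ?f) \<le> 2 * \<eta>" using two[OF close[OF a(1) b0(1)] close[OF xD b0(1)]] a(2) x by auto
    qed
    have r: "cmod (integral {b0..b} ?fe) \<le> 2 * \<eta> * (1 + V2)"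
    proof (rule b1(3)[OF b0(2) b(2,1) contf[OF b0(1) b(1)] \<epsilon>(1,2)], rule ballI)
      fix x assume x: "x \<in> {b0..b}"
      have xD: "x \<in> ?D" using D_between[OF b0(1) b(1)] x by auto
      have "integral {a0..x} ?f = integral {a0..b0} ?f + integral {b0..x} ?f" by (rule split[OF intf a0(1) xD]) (use x ab0 in auto)
      then have "integral {b0..x} ?f = integral {a0..x} ?f - integral {a0..b0} ?f" by simp
      then show "cmod (integral {b0..x} ?f) \<le> 2 * \<eta>" using two[OF close[OF a0(1) xD] close[OF a0(1) b0(1)]] x by auto
    qed
    have mid: "cmod (integral {a0..b0} ?fe - integral {a0..b0} ?f) \<le> \<eta>"
    proof -
      have "integral {a0..b0} ?fe - integral {a0..b0} ?f = integral {a0..b0} (\<lambda>x. ?fe x - ?f x)"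
        by (intro Henstock_Kurzweil_Integration.integral_diff[symmetric] fei intf a0 b0)
      also have "cmod \<dots> \<le> integral {a0..b0} (\<lambda>x. Mf * \<tau>)"
      proof (rule integral_norm_bound_integral)
        show "(\<lambda>x. ?fe x - ?f x) integrable_on {a0..b0}" by (intro integrable_diff fei intf a0 b0)
        fix x assume x: "x \<in> {a0..b0}"
        have "cmod (damp \<beta> \<omega> \<epsilon> (of_real x) - 1) \<le> \<tau>"
          using x by (intro \<epsilon>(3)) (auto simp: R_def Re_real_over[OF \<beta>(1,2) \<omega>(1,2)] abs_le_iff max_def)
        then have "cmod (?f x) * cmod (damp \<beta> \<omega> \<epsilon> (of_real x) - 1) \<le> Mf * \<tau>" using Mf[OF x] Mf0 by (intro mult_mono) auto
        moreover have "?fe x - ?f x = ?f x * (damp \<beta> \<omega> \<epsilon> (of_real x) - 1)" by (simp add: algebra_simps)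
        ultimately show "cmod (?fe x - ?f x) \<le> Mf * \<tau>" by (simp add: norm_mult)
      qed (rule integrable_const_ivl)
      also have "\<dots> \<le> \<eta>" using \<tau>N(2) ab0 by (simp add: mult_ac)
      finally show ?thesis .
    qed
    have "integral {a..b} ?fe = integral {a..a0} ?fe + (integral {a0..b0} ?fe + integral {b0..b} ?fe)"
      using split[OF fei a(1) b(1), of a0] split[OF fei a0(1) b(1), of b0] a b ab0 by simp
    then have "integral {a..b} ?fe - L = integral {a..a0} ?fe + integral {b0..b} ?fe + (integral {a0..b0} ?fe - integral {a0..b0} ?f) + (integral {a0..b0} ?f - L)"
      by simp
    also have "cmod \<dots> \<le> 2 * \<eta> * (1 + V1) + 2 * \<eta> * (1 + V2) + \<eta> + \<eta>"
      by (intro order_trans[OF norm_triangle_ineq] add_mono l r mid less_imp_le[OF close[OF a0(1) b0(1)]]) auto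
    finally have Rl: "cmod (integral {a..b} ?fe - L) \<le> 2 * \<eta> * (1 + V1) + 2 * \<eta> * (1 + V2) + \<eta> + \<eta>" .
    have cl': "cmod (integral {s1..s1'} ke - integral {a..b} ?fe) \<le> 2 * \<eta>"
      using cl unfolding ke_eq a_def b_def .
    have tri: "cmod (x + y - z) \<le> cmod x + cmod y + cmod z" for x y z :: complex
      using norm_triangle_ineq4[of "x + y" z] norm_triangle_ineq[of x y] by linarith
    have eq: "I - L = (integral {s1..s1'} ke - integral {a..b} ?fe) + (integral {a..b} ?fe - L) - (integral {s1..s1'} ke - I)" by simp
    have "cmod (I - L) \<le> cmod (integral {s1..s1'} ke - integral {a..b} ?fe) + cmod (integral {a..b} ?fe - L) + cmod (integral {s1..s1'} ke - I)"
      unfolding eq by (rule tri)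
    then have "cmod (I - L) \<le> 2 * \<eta> + (2 * \<eta> * (1 + V1) + 2 * \<eta> * (1 + V2) + \<eta> + \<eta>) + 5 * \<eta>"
      using cl' Rl C by linarith
    then show ?thesis by (simp add: algebra_simps)
  qed
  define Q where "Q = 9 + 2 * (1 + V1) + 2 * (1 + V2)"
  have Q: "Q > 0" unfolding Q_def using a1(2) b1(2) by argo
  have "cmod (I - L) \<le> 0"
  proof (rule field_le_epsilon)
    fix \<eta> :: real assume "\<eta> > 0"
    then have "cmod (I - L) \<le> \<eta> / Q * Q" using main[of "\<eta> / Q"] Q unfolding Q_def[symmetric] by simp
    then show "cmod (I - L) \<le> 0 + \<eta>" using Q by simp
  qed
  then show ?thesis by simp
qed

section \<open>Complex Hilbert spaces\<close>

lemma cinner_add_right: "cinner (x::'a::complex_hilbert) (y + z) = cinner x y + cinner x z"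
  by (subst (1 2 3) cinner_commute) (simp add: cinner_add_left)

lemma cinner_scaleC_right: "cinner (x::'a::complex_hilbert) (c *\<^sub>C y) = cnj c * cinner x y"
  by (subst (1 2) cinner_commute) (simp add: cinner_scaleC_left)

lemma cinner_self: "cinner (x::'a::complex_hilbert) x = of_real ((norm x)\<^sup>2)"
proof -
  have "Im (cinner x x) = - Im (cinner x x)" by (subst (1) cinner_commute) simp
  then have "Im (cinner x x) = 0" by simp
  moreover have "(norm x)\<^sup>2 = Re (cinner x x)"
  proof -
    have n: "norm x = sqrt (Re (cinner x x))" by (rule norm_eq_sqrt_cinner)
    then have "Re (cinner x x) \<ge> 0" by (metis norm_ge_zero real_sqrt_ge_0_iff)
    then show ?thesis using n by simp
  qed
  ultimately show ?thesis by (simp add: complex_eq_iff)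
qed

lemma scaleC_minus1: "(-1) *\<^sub>C (x::'a::complex_hilbert) = - x"
  using scaleR_scaleC[of "-1" x] by simp

lemma scaleC_one [simp]: "1 *\<^sub>C (x::'a::complex_hilbert) = x"
  using scaleR_scaleC[of 1 x] by simp

lemma cinner_minus_left: "cinner (- x) (y::'a::complex_hilbert) = - cinner x y"
  using cinner_scaleC_left[of "-1" x y] by (simp add: scaleC_minus1)

lemma cinner_diff_left: "cinner (x - z) (y::'a::complex_hilbert) = cinner x y - cinner z y"
  using cinner_add_left[of x "- z" y] by (simp add: cinner_minus_left)

lemma cinner_diff_right: "cinner (y::'a::complex_hilbert) (x - z) = cinner y x - cinner y z"
  by (subst (1 2 3) cinner_commute) (simp add: cinner_diff_left)

lemma norm_diff_cinner: "(norm (x - y::'a::complex_hilbert))\<^sup>2 = (norm x)\<^sup>2 - 2 * Re (cinner x y) + (norm y)\<^sup>2"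
proof -
  have "cinner (x - y) (x - y) = cinner x x - cinner x y - cinner y x + cinner y y"
    by (simp add: cinner_diff_left cinner_diff_right)
  then have "Re (cinner (x - y) (x - y)) = Re (cinner x x) - Re (cinner x y) - Re (cnj (cinner x y)) + Re (cinner y y)"
    using cinner_commute[of y x] by simp
  then show ?thesis by (simp add: cinner_self)
qed

lemma cinner_Cauchy_Schwarz: "cmod (cinner x y) \<le> norm x * norm (y::'a::complex_hilbert)"
proof (cases "y = 0")
  case True
  have "cinner x 0 = 0" using cinner_scaleC_right[of x 0 0] scaleR_scaleC[of 0 "0::'a"] by simp
  then show ?thesis using True by simp
next
  case False
  define c where "c = cinner x y / of_real ((norm y)\<^sup>2)"
  have "cinner x (c *\<^sub>C y) = of_real ((cmod (cinner x y))\<^sup>2 / (norm y)\<^sup>2)"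
    unfolding cinner_scaleC_right c_def using complex_norm_square[of "cinner x y"] by (simp add: mult.commute)
  moreover have "(norm (c *\<^sub>C y))\<^sup>2 = (cmod (cinner x y))\<^sup>2 / (norm y)\<^sup>2"
  proof -
    have "cmod c = cmod (cinner x y) / (norm y)\<^sup>2" unfolding c_def norm_divide norm_of_real by simp
    then have "norm (c *\<^sub>C y) = cmod (cinner x y) / norm y" using False by (simp add: norm_scaleC power2_eq_square)
    then show ?thesis by (simp add: power_divide)
  qed
  ultimately have "(norm (x - c *\<^sub>C y))\<^sup>2 = (norm x)\<^sup>2 - (cmod (cinner x y))\<^sup>2 / (norm y)\<^sup>2"
    by (simp add: norm_diff_cinner)
  then have "(cmod (cinner x y))\<^sup>2 / (norm y)\<^sup>2 \<le> (norm x)\<^sup>2" by (metis diff_ge_0_iff_ge zero_le_power2)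
  then have "(cmod (cinner x y))\<^sup>2 \<le> (norm x * norm y)\<^sup>2" using False by (simp add: divide_le_eq power_mult_distrib)
  then show ?thesis by (rule power2_le_imp_le) simp
qed

lemma bounded_bilinear_cinner: "bounded_bilinear (cinner :: 'a::complex_hilbert \<Rightarrow> 'a \<Rightarrow> complex)"
proof
  show "\<exists>K. \<forall>a b. cmod (cinner (a::'a) b) \<le> norm a * norm b * K"
    using cinner_Cauchy_Schwarz by (intro exI[of _ 1]) auto
qed (simp_all add: cinner_add_left cinner_add_right scaleR_scaleC[where 'a = 'a] cinner_scaleC_left cinner_scaleC_right scaleR_conv_of_real)

text \<open>The representing vector minimizes \<open>\<parallel>x\<parallel>\<^sup>2 - 2 Re \<phi>(x)\<close>; minimizing sequences are Cauchy by the parallelogram law.\<close>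

lemma Riesz_representation:
  fixes \<phi> :: "'a::complex_hilbert \<Rightarrow> complex"
  assumes bl: "bounded_linear \<phi>" and cl: "\<And>c x. \<phi> (c *\<^sub>C x) = c * \<phi> x"
  shows "\<exists>z. \<forall>x. \<phi> x = cinner x z"
proof -
  interpret bounded_linear \<phi> by (rule bl)
  define J where "J x = (norm x)\<^sup>2 - 2 * Re (\<phi> x)" for x
  obtain K where K: "\<And>x. cmod (\<phi> x) \<le> norm x * K" using bounded by blast
  have Jlb: "- K\<^sup>2 \<le> J x" for x
  proof -
    have "Re (\<phi> x) \<le> norm x * K" using K[of x] complex_Re_le_cmod order_trans by blast
    moreover have "0 \<le> (norm x - K)\<^sup>2" by simp
    ultimately show ?thesis unfolding J_def by (simp add: power2_diff)
  qed
  define m where "m = Inf (range J)"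
  have bdd: "bdd_below (range J)" using Jlb by (auto intro!: bdd_belowI)
  have mJ: "m \<le> J x" for x unfolding m_def by (rule cInf_lower[OF _ bdd]) simp
  have "\<exists>x. J x < m + e" if "e > 0" for e
    using cInf_lessD[of "range J" "m + e"] that unfolding m_def by auto
  then have "\<forall>n. \<exists>x. J x < m + inverse (real (Suc n))" by simp
  then obtain X where X: "\<And>n. J (X n) < m + inverse (real (Suc n))" by metis
  have par: "(norm (x - y))\<^sup>2 \<le> 2 * (J x - m) + 2 * (J y - m)" for x y
  proof -
    have "(norm (x - y))\<^sup>2 + (norm (x + y))\<^sup>2 = 2 * (norm x)\<^sup>2 + 2 * (norm y)\<^sup>2"
      using norm_diff_cinner[of x y] norm_diff_cinner[of x "- y"] cinner_minus_left[of y x] cinner_commute[of x y] cinner_commute[of x "-y"] by simp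
    moreover have "4 * J ((1/2) *\<^sub>R (x + y)) = (norm (x + y))\<^sup>2 - 4 * Re (\<phi> x) - 4 * Re (\<phi> y)"
      unfolding J_def scale add by (simp add: power_mult_distrib power2_eq_square) (simp add: field_simps)
    ultimately show ?thesis using mJ[of "(1/2) *\<^sub>R (x + y)"] unfolding J_def by simp
  qed
  have "Cauchy X"
  proof (rule metric_CauchyI)
    fix e :: real assume e: "e > 0"
    define E where "E = e\<^sup>2 / 4"
    have E: "0 < E" "e\<^sup>2 = 4 * E" unfolding E_def using e by auto
    obtain N where N: "inverse (real (Suc N)) < E" using reals_Archimedean[OF E(1)] by auto
    have "dist (X i) (X j) < e" if "i \<ge> N" "j \<ge> N" for i j
    proof -
      have "inverse (real (Suc k)) \<le> inverse (real (Suc N))" if "k \<ge> N" for k using that by (simp add: le_imp_inverse_le)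
      then have iN: "inverse (real (Suc i)) \<le> inverse (real (Suc N))" "inverse (real (Suc j)) \<le> inverse (real (Suc N))" using that by blast+
      have "J (X i) < m + E" "J (X j) < m + E" using X[of i] X[of j] N iN by linarith+
      then have "(norm (X i - X j))\<^sup>2 < e\<^sup>2" using par[of "X i" "X j"] unfolding E(2) by argo
      then show ?thesis using e power2_less_imp_less[of "norm (X i - X j)" e] by (simp add: dist_norm)
    qed
    then show "\<exists>N. \<forall>i\<ge>N. \<forall>j\<ge>N. dist (X i) (X j) < e" by blast
  qed
  then obtain z where z: "X \<longlonglongrightarrow> z" using Cauchy_convergent convergent_def by blast
  have "(\<lambda>n. J (X n)) \<longlonglongrightarrow> J z" unfolding J_def by (intro tendsto_intros z tendsto)
  moreover have "(\<lambda>n. m + inverse (real (Suc n))) \<longlonglongrightarrow> m + 0" by (intro tendsto_intros LIMSEQ_inverse_real_of_nat)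
  ultimately have "J z \<le> m + 0" by (rule LIMSEQ_le) (use X less_imp_le in blast)
  then have zmin: "J z \<le> J x" for x using mJ[of x] by simp
  have Re_eq: "Re (\<phi> x) = Re (cinner x z)" for x
  proof -
    define b where "b = Re (cinner x z) - Re (\<phi> x)"
    have q: "0 \<le> t\<^sup>2 * (norm x)\<^sup>2 + 2 * t * b" for t
    proof -
      have "(norm (z + t *\<^sub>R x))\<^sup>2 = (norm z)\<^sup>2 + 2 * t * Re (cinner x z) + t\<^sup>2 * (norm x)\<^sup>2"
      proof -
        have r: "cinner z ((-t) *\<^sub>R x) = (-t) *\<^sub>R cinner z x" by (rule bounded_bilinear.scaleR_right[OF bounded_bilinear_cinner])
        have c: "Re (cinner z x) = Re (cinner x z)" by (subst cinner_commute) simp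
        have "(norm (z - (-t) *\<^sub>R x))\<^sup>2 = (norm z)\<^sup>2 - 2 * Re (cinner z ((-t) *\<^sub>R x)) + (norm ((-t) *\<^sub>R x))\<^sup>2"
          by (rule norm_diff_cinner)
        then show ?thesis unfolding r by (simp add: c power_mult_distrib)
      qed
      then have "J (z + t *\<^sub>R x) = J z + 2 * t * b + t\<^sup>2 * (norm x)\<^sup>2" unfolding J_def add scale b_def by (simp add: algebra_simps)
      then show ?thesis using zmin[of "z + t *\<^sub>R x"] by simp
    qed
    have "b = 0"
    proof (rule ccontr)
      assume b: "b \<noteq> 0"
      define s where "s = (norm x)\<^sup>2 + 1"
      have s: "s > 0" "(norm x)\<^sup>2 < s" unfolding s_def by (auto simp: add_nonneg_pos)
      have "0 \<le> (- b / s)\<^sup>2 * (norm x)\<^sup>2 + 2 * (- b / s) * b" by (rule q)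
      also have "\<dots> \<le> (- b / s)\<^sup>2 * s + 2 * (- b / s) * b" using s by (intro add_right_mono mult_left_mono) auto
      also have "\<dots> = - (b\<^sup>2 / s)" using s by (simp add: power2_eq_square field_simps)
      also have "\<dots> < 0" using b s by simp
      finally show False by simp
    qed
    then show ?thesis by (simp add: b_def)
  qed
  have "\<phi> x = cinner x z" for x
  proof (rule complex_eqI)
    show "Re (\<phi> x) = Re (cinner x z)" by (rule Re_eq)
    show "Im (\<phi> x) = Im (cinner x z)" using Re_eq[of "(- \<i>) *\<^sub>C x"] by (simp add: cl cinner_scaleC_left)
  qed
  then show ?thesis by blast
qed

lemma cinner_eqI: "(\<And>x. cinner x y = cinner x (z::'a::complex_hilbert)) \<Longrightarrow> y = z"
  using cinner_self[of "y - z"] cinner_diff_right[of "y - z" y z] by simp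

lemma adj_works:
  fixes T :: "'a::complex_hilbert \<Rightarrow>\<^sub>L 'b::complex_hilbert"
  assumes T: "clin T"
  shows "cinner (T x) y = cinner x (adj T y)"
proof -
  have "\<exists>z. \<forall>x. cinner (T x) y = cinner x z" for y
  proof (rule Riesz_representation)
    show "bounded_linear (\<lambda>x. cinner (T x) y)"
      by (rule bounded_linear_compose[OF bounded_bilinear.bounded_linear_left[OF bounded_bilinear_cinner] blinfun.bounded_linear_right])
  qed (use T in \<open>simp add: clin_def cinner_scaleC_left\<close>)
  then obtain s where s: "\<And>x y. cinner (T x) y = cinner x (s y)" by metis
  have "bounded_linear s"
  proof (rule bounded_linear_intro[where K = "norm T"])
    show "s (y + z) = s y + s z" for y z by (rule cinner_eqI) (simp add: cinner_add_right s[symmetric])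
    show "s (r *\<^sub>R y) = r *\<^sub>R s y" for r y by (rule cinner_eqI) (simp add: cinner_scaleC_right scaleR_scaleC s[symmetric])
    show "norm (s y) \<le> norm y * norm T" for y
    proof (cases "s y = 0")
      case False
      have "(norm (s y))\<^sup>2 = cmod (cinner (T (s y)) y)" unfolding s cinner_self by (simp add: norm_power)
      also have "\<dots> \<le> norm (T (s y)) * norm y" by (rule cinner_Cauchy_Schwarz)
      also have "\<dots> \<le> norm T * norm (s y) * norm y" by (intro mult_right_mono norm_blinfun) simp
      finally have "norm (s y) * norm (s y) \<le> norm (s y) * (norm y * norm T)" by (simp add: power2_eq_square mult_ac)
      then show ?thesis using False by simp
    qed simp
  qed
  then have S: "\<forall>x y. cinner (T x) y = cinner x (Blinfun s y)" using s by (simp add: bounded_linear_Blinfun_apply)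
  have "\<forall>x y. cinner (T x) y = cinner x (adj T y)" unfolding adj_def
  proof (rule theI[where P = "\<lambda>S :: 'b \<Rightarrow>\<^sub>L 'a. \<forall>x y. cinner (T x) y = cinner x (S y)", OF S])
    fix S' :: "'b \<Rightarrow>\<^sub>L 'a" assume "\<forall>x y. cinner (T x) y = cinner x (S' y)"
    then have "cinner x (S' y) = cinner x (Blinfun s y)" for x y using S by metis
    then show "S' = Blinfun s" by (rule blinfun_eqI[OF cinner_eqI])
  qed
  then show ?thesis by blast
qed

lemma norm_adj:
  fixes T :: "'a::complex_hilbert \<Rightarrow>\<^sub>L 'b::complex_hilbert"
  assumes T: "clin T"
  shows "norm (adj T) = norm T"
proof (rule antisym)
  show "norm (adj T) \<le> norm T"
  proof (rule norm_blinfun_bound)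
    fix y
    show "norm (adj T y) \<le> norm T * norm y"
    proof (cases "adj T y = 0")
      case False
      have "(norm (adj T y))\<^sup>2 = cmod (cinner (T (adj T y)) y)" unfolding adj_works[OF T] cinner_self by (simp add: norm_power)
      also have "\<dots> \<le> norm (T (adj T y)) * norm y" by (rule cinner_Cauchy_Schwarz)
      also have "\<dots> \<le> norm T * norm (adj T y) * norm y" by (intro mult_right_mono norm_blinfun) simp
      finally have "norm (adj T y) * norm (adj T y) \<le> norm (adj T y) * (norm T * norm y)" by (simp add: power2_eq_square mult_ac)
      then show ?thesis using False by simp
    qed simp
  qed simp
  show "norm T \<le> norm (adj T)"
  proof (rule norm_blinfun_bound)
    fix x
    show "norm (T x) \<le> norm (adj T) * norm x"
    proof (cases "T x = 0")
      case False
      have "(norm (T x))\<^sup>2 = cmod (cinner x (adj T (T x)))" unfolding adj_works[OF T, symmetric] cinner_self by (simp add: norm_power)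
      also have "\<dots> \<le> norm x * norm (adj T (T x))" by (rule cinner_Cauchy_Schwarz)
      also have "\<dots> \<le> norm x * (norm (adj T) * norm (T x))" by (intro mult_left_mono norm_blinfun) simp
      finally have "norm (T x) * norm (T x) \<le> norm (T x) * (norm (adj T) * norm x)" by (simp add: power2_eq_square mult_ac)
      then show ?thesis using False by simp
    qed simp
  qed simp
qed

definition inverse_ops :: "('a::complex_hilbert \<Rightarrow>\<^sub>L 'a) \<Rightarrow> ('a \<Rightarrow>\<^sub>L 'a) \<Rightarrow> bool" where
  "inverse_ops T R \<longleftrightarrow> clin R \<and> (\<forall>x. T (R x) = x) \<and> (\<forall>x. R (T x) = x)"

text \<open>The theorem of Lax and Milgram: \<open>x \<mapsto> x - t (T x - y)\<close> is a contraction for small \<open>t > 0\<close>, and its fixed point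
  solves \<open>T x = y\<close>.\<close>

lemma inverse_ops_if_coercive:
  fixes T :: "'a::complex_hilbert \<Rightarrow>\<^sub>L 'a"
  assumes T: "clin T" and c: "c > 0" "\<And>x. c * (norm x)\<^sup>2 \<le> Re (cinner (T x) x)"
  shows "\<exists>R. inverse_ops T R"
proof -
  have low: "c * norm x \<le> norm (T x)" for x
  proof (cases "x = 0")
    case False
    have "c * (norm x)\<^sup>2 \<le> norm (T x) * norm x"
      using c(2)[of x] complex_Re_le_cmod[of "cinner (T x) x"] cinner_Cauchy_Schwarz[of "T x" x] by linarith
    then have "norm x * (c * norm x) \<le> norm x * norm (T x)" by (simp add: power2_eq_square mult_ac)
    then show ?thesis using False by simp
  qed simp
  define N where "N = norm T + c"
  have N: "N > 0" "norm T \<le> N" "c \<le> N" unfolding N_def using c(1) by (auto simp: add_nonneg_pos)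
  \<comment> \<open>This \<open>t\<close> minimizes the bound \<open>1 - 2 t c + t\<^sup>2 N\<^sup>2\<close> for the squared contraction factor.\<close>
  define t where "t = c / N\<^sup>2"
  have t: "t > 0" unfolding t_def using c N by simp
  define q where "q = sqrt (1 - c\<^sup>2 / N\<^sup>2)"
  have cN: "0 < c\<^sup>2 / N\<^sup>2" "c\<^sup>2 / N\<^sup>2 \<le> 1" using c N by (auto simp: divide_le_eq power_mono)
  have q: "0 \<le> q" "q < 1" unfolding q_def using cN by auto
  have contr: "norm (x - t *\<^sub>R T x) \<le> q * norm x" for x
  proof -
    have "cinner x (t *\<^sub>R T x) = of_real t * cinner x (T x)" by (simp add: scaleR_scaleC cinner_scaleC_right)
    then have re: "Re (cinner x (t *\<^sub>R T x)) = t * Re (cinner (T x) x)" using cinner_commute[of x "T x"] by simp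
    have "(norm (x - t *\<^sub>R T x))\<^sup>2 = (norm x)\<^sup>2 - 2 * t * Re (cinner (T x) x) + t\<^sup>2 * (norm (T x))\<^sup>2"
      unfolding norm_diff_cinner re by (simp add: power_mult_distrib)
    also have "\<dots> \<le> (norm x)\<^sup>2 - 2 * t * (c * (norm x)\<^sup>2) + t\<^sup>2 * (N * norm x)\<^sup>2"
    proof -
      have "norm (T x) \<le> N * norm x" using norm_blinfun[of T x] N(2) by (meson mult_right_mono norm_ge_zero order_trans)
      then have "t\<^sup>2 * (norm (T x))\<^sup>2 \<le> t\<^sup>2 * (N * norm x)\<^sup>2" by (intro mult_left_mono power_mono) auto
      moreover have "2 * t * (c * (norm x)\<^sup>2) \<le> 2 * t * Re (cinner (T x) x)" using c(2)[of x] t by (intro mult_left_mono) auto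
      ultimately show ?thesis by linarith
    qed
    also have "\<dots> = (1 - c\<^sup>2 / N\<^sup>2) * (norm x)\<^sup>2"
      unfolding t_def using N(1) by (simp add: field_simps power2_eq_square)
    also have "\<dots> = (q * norm x)\<^sup>2" unfolding q_def using cN by (simp add: power_mult_distrib)
    finally show ?thesis by (rule power2_le_imp_le) (use q in simp)
  qed
  have surj: "\<exists>x. T x = y" for y
  proof -
    have "\<exists>!x. x - t *\<^sub>R (T x - y) = x"
    proof (rule banach_fix_type[OF q], intro allI)
      fix x x'
      have eq: "(x - t *\<^sub>R (T x - y)) - (x' - t *\<^sub>R (T x' - y)) = (x - x') - t *\<^sub>R T (x - x')"
        by (simp add: blinfun.diff_right algebra_simps)
      show "dist (x - t *\<^sub>R (T x - y)) (x' - t *\<^sub>R (T x' - y)) \<le> q * dist x x'"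
        unfolding dist_norm eq by (rule contr)
    qed
    then show ?thesis using t by auto
  qed
  have inj: "x = y" if "T x = T y" for x y using low[of "x - y"] that c by (simp add: blinfun.diff_right mult_le_0_iff)
  obtain r where r: "\<And>y. T (r y) = y" using surj by metis
  have "bounded_linear r"
  proof (rule bounded_linear_intro[where K = "1 / c"])
    show "r (x + y) = r x + r y" for x y by (rule inj) (simp add: r blinfun.add_right)
    show "r (a *\<^sub>R y) = a *\<^sub>R r y" for a y by (rule inj) (simp add: r blinfun.scaleR_right)
    show "norm (r y) \<le> norm y * (1 / c)" for y using low[of "r y"] c(1) by (simp add: r field_simps)
  qed
  note R = bounded_linear_Blinfun_apply[OF this]
  have "inverse_ops T (Blinfun r)" unfolding inverse_ops_def clin_def R
  proof (intro conjI allI)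
    show "r (a *\<^sub>C y) = a *\<^sub>C r y" for a y by (rule inj) (use T in \<open>simp add: r clin_def\<close>)
    show "r (T x) = x" for x by (rule inj) (simp add: r)
  qed (rule r)
  then show ?thesis by blast
qed

lemma clin_simps:
  "clin T \<Longrightarrow> clin S \<Longrightarrow> clin (T + S)" "clin T \<Longrightarrow> clin S \<Longrightarrow> clin (T - S)" "clin (cmul c)"
  "clin T' \<Longrightarrow> clin S \<Longrightarrow> clin (T' o\<^sub>L S)" "clin id_blinfun"
proof -
  have d: "a *\<^sub>C (x - y) = a *\<^sub>C x - a *\<^sub>C y" for a and x y :: "'x::complex_hilbert"
    using scaleC_add_right[of a "x - y" y] by (simp add: eq_diff_eq)
  show "clin T \<Longrightarrow> clin S \<Longrightarrow> clin (T + S)" "clin T \<Longrightarrow> clin S \<Longrightarrow> clin (T - S)"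
    by (auto simp: clin_def blinfun.add_left blinfun.diff_left scaleC_add_right d)
  show "clin (cmul c)" "clin T' \<Longrightarrow> clin S \<Longrightarrow> clin (T' o\<^sub>L S)" "clin id_blinfun"
    by (auto simp: clin_def scaleC_scaleC mult.commute)
qed

lemma inv_op_eq:
  assumes "inverse_ops T R"
  shows "inv_op T = R"
  unfolding inv_op_def
proof (rule the_equality)
  show "R o\<^sub>L T = id_blinfun \<and> T o\<^sub>L R = id_blinfun"
    using assms by (auto simp: inverse_ops_def intro!: blinfun_eqI)
  fix S assume S: "S o\<^sub>L T = id_blinfun \<and> T o\<^sub>L S = id_blinfun"
  have "S x = R x" for x
  proof -
    have "S (T (R x)) = R x" using S by (metis blinfun_apply_blinfun_compose id_blinfun.rep_eq id_apply)
    then show ?thesis using assms by (simp add: inverse_ops_def)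
  qed
  then show "S = R" by (rule blinfun_eqI)
qed

lemma notin_spec_iff:
  "z \<notin> spec T \<longleftrightarrow> (\<exists>R. inverse_ops (T - cmul z) R)"
  by (simp add: spectrum_def inverse_ops_def blinfun.diff_left blinfun.diff_right)

definition resolvent :: "('a::complex_hilbert \<Rightarrow>\<^sub>L 'a) \<Rightarrow> complex \<Rightarrow> 'a \<Rightarrow>\<^sub>L 'a" where
  "resolvent T z = inv_op (T - cmul z)"

lemma resolvent_inverse: "z \<notin> spec T \<Longrightarrow> inverse_ops (T - cmul z) (resolvent T z)"
  unfolding notin_spec_iff resolvent_def using inv_op_eq by metis

lemma resolvent_simps:
  assumes "z \<notin> spec T"
  shows "T (resolvent T z x) = x + z *\<^sub>C resolvent T z x" "resolvent T z (T x) = x + resolvent T z (z *\<^sub>C x)"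
    "resolvent T z (c *\<^sub>C x) = c *\<^sub>C resolvent T z x"
  using resolvent_inverse[OF assms]
  by (auto simp: inverse_ops_def clin_def blinfun.diff_left blinfun.diff_right diff_eq_eq)

lemma resolvent_identity:
  assumes z: "z \<notin> spec T" and w: "w \<notin> spec T"
  shows "resolvent T z x - resolvent T w x = (z - w) *\<^sub>C resolvent T z (resolvent T w x)"
proof -
  let ?P = "resolvent T z (resolvent T w x)"
  have "resolvent T z (T (resolvent T w x)) = resolvent T z x + w *\<^sub>C ?P"
    unfolding resolvent_simps(1)[OF w] blinfun.add_right resolvent_simps(3)[OF z] ..
  moreover have "resolvent T z (T (resolvent T w x)) = resolvent T w x + z *\<^sub>C ?P"
    unfolding resolvent_simps(2)[OF z] resolvent_simps(3)[OF z] ..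
  moreover have "z *\<^sub>C ?P = (z - w) *\<^sub>C ?P + w *\<^sub>C ?P" by (simp add: scaleC_add_left[symmetric])
  ultimately have "resolvent T z x + w *\<^sub>C ?P = (resolvent T w x + (z - w) *\<^sub>C ?P) + w *\<^sub>C ?P"
    by (simp only: add.assoc)
  then show ?thesis by simp
qed

lemma inverse_ops_id_minus:
  fixes K :: "'a::complex_hilbert \<Rightarrow>\<^sub>L 'a"
  assumes "clin K" "norm K < 1"
  shows "\<exists>R. inverse_ops (id_blinfun - K) R"
proof (rule inverse_ops_if_coercive[where c = "1 - norm K"])
  show "clin (id_blinfun - K)" using assms by (intro clin_simps)
  fix x
  have "cmod (cinner (K x) x) \<le> norm K * norm x * norm x"
    using cinner_Cauchy_Schwarz[of "K x" x] norm_blinfun[of K x] by (meson mult_right_mono norm_ge_zero order_trans)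
  then have "Re (cinner (K x) x) \<le> norm K * (norm x)\<^sup>2"
    using complex_Re_le_cmod[of "cinner (K x) x"] by (simp add: power2_eq_square mult_ac)
  then show "(1 - norm K) * (norm x)\<^sup>2 \<le> Re (cinner ((id_blinfun - K) x) x)"
    by (simp add: blinfun.diff_left cinner_diff_left cinner_self algebra_simps)
qed (use assms in simp)

lemma inverse_ops_compose:
  "inverse_ops S R \<Longrightarrow> inverse_ops T Q \<Longrightarrow> inverse_ops (S o\<^sub>L T) (Q o\<^sub>L R)"
  by (auto simp: inverse_ops_def intro: clin_simps)

lemma norm_cmul_le: "norm (cmul c) \<le> cmod c"
  by (rule norm_blinfun_bound) (auto simp: norm_scaleC)

text \<open>\<open>T - z = (1 - (z - z\<^sub>0) (T - z\<^sub>0)\<^sup>-\<^sup>1) (T - z\<^sub>0)\<close>, and the first factor is coercive.\<close>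

lemma notin_spec_near:
  assumes T: "clin T" and z0: "z0 \<notin> spec T" and z: "cmod (z - z0) * norm (resolvent T z0) < 1"
  shows "z \<notin> spec T"
proof -
  let ?K = "cmul (z - z0) o\<^sub>L resolvent T z0"
  note R0 = resolvent_inverse[OF z0]
  have cR: "clin (resolvent T z0)" using R0 by (simp add: inverse_ops_def)
  have "norm ?K \<le> cmod (z - z0) * norm (resolvent T z0)"
    using norm_blinfun_compose[of "cmul (z - z0)" "resolvent T z0"] norm_cmul_le[of "z - z0"]
    by (meson mult_right_mono norm_ge_zero order_trans)
  then have "norm ?K < 1" using z by simp
  then obtain Q where Q: "inverse_ops (id_blinfun - ?K) Q"
    using inverse_ops_id_minus[of ?K] clin_simps cR by blast
  have "inverse_ops ((id_blinfun - ?K) o\<^sub>L (T - cmul z0)) (resolvent T z0 o\<^sub>L Q)"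
    by (rule inverse_ops_compose[OF Q R0])
  moreover have "(id_blinfun - ?K) o\<^sub>L (T - cmul z0) = T - cmul z"
  proof (rule blinfun_eqI)
    fix x
    have "resolvent T z0 ((T - cmul z0) x) = x" using R0 by (simp add: inverse_ops_def)
    moreover have "z *\<^sub>C x = z0 *\<^sub>C x + (z - z0) *\<^sub>C x" by (simp add: scaleC_add_left[symmetric])
    ultimately show "((id_blinfun - ?K) o\<^sub>L (T - cmul z0)) x = (T - cmul z) x"
      by (simp add: blinfun.diff_left)
  qed
  ultimately show ?thesis unfolding notin_spec_iff by metis
qed

lemma open_resolvent_set: "clin T \<Longrightarrow> open (- spec T)"
proof (rule openI)
  fix z0 assume T: "clin T" and "z0 \<in> - spec T"
  then have z0: "z0 \<notin> spec T" by simp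
  let ?r = "1 / (norm (resolvent T z0) + 1)"
  have p: "norm (resolvent T z0) + 1 > 0" by (simp add: add_nonneg_pos)
  have "z \<in> - spec T" if "z \<in> ball z0 ?r" for z
  proof -
    have "cmod (z - z0) * (norm (resolvent T z0) + 1) < 1" using that p by (simp add: dist_norm norm_minus_commute pos_less_divide_eq)
    then have "cmod (z - z0) * norm (resolvent T z0) < 1" unfolding distrib_left using norm_ge_zero[of "z - z0"] by linarith
    then show ?thesis using notin_spec_near[OF T z0] by simp
  qed
  then show "\<exists>r>0. ball z0 r \<subseteq> - spec T" using p by (intro exI[of _ ?r]) auto
qed

lemma norm_resolvent_diff:
  assumes z: "z \<notin> spec T" and w: "w \<notin> spec T"
  shows "norm (resolvent T z - resolvent T w) \<le> cmod (z - w) * norm (resolvent T z) * norm (resolvent T w)"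
proof (rule norm_blinfun_bound)
  fix x
  have "norm ((resolvent T z - resolvent T w) x) = cmod (z - w) * norm (resolvent T z (resolvent T w x))"
    by (simp add: blinfun.diff_left resolvent_identity[OF z w] norm_scaleC)
  also have "\<dots> \<le> cmod (z - w) * (norm (resolvent T z) * (norm (resolvent T w) * norm x))"
    by (intro mult_left_mono order_trans[OF norm_blinfun] norm_blinfun) auto
  finally show "norm ((resolvent T z - resolvent T w) x) \<le> cmod (z - w) * norm (resolvent T z) * norm (resolvent T w) * norm x"
    by (simp add: mult_ac)
qed simp

lemma resolvent_locally_lipschitz:
  assumes T: "clin T" and z0: "z0 \<notin> spec T"
  shows "\<exists>e>0. \<exists>C. \<forall>z. cmod (z - z0) < e \<longrightarrow> z \<notin> spec T \<and> norm (resolvent T z - resolvent T z0) \<le> C * cmod (z - z0)"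
proof -
  define N where "N = norm (resolvent T z0) + 1"
  have N: "N > 0" "norm (resolvent T z0) \<le> N" unfolding N_def by (auto simp: add_nonneg_pos)
  have "z \<notin> spec T \<and> norm (resolvent T z - resolvent T z0) \<le> (2 * N * N) * cmod (z - z0)" if z: "cmod (z - z0) < 1 / (2 * N)" for z
  proof -
    have s: "cmod (z - z0) * N < 1/2" using z N by (simp add: field_simps)
    have s': "cmod (z - z0) * norm (resolvent T z0) \<le> cmod (z - z0) * N" by (intro mult_left_mono N) simp
    have zs: "z \<notin> spec T" using notin_spec_near[OF T z0, of z] s s' by simp
    note d = norm_resolvent_diff[OF zs z0]
    have "norm (resolvent T z) \<le> norm (resolvent T z0) + norm (resolvent T z - resolvent T z0)"
      using norm_triangle_ineq[of "resolvent T z0" "resolvent T z - resolvent T z0"] by simp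
    also have "\<dots> \<le> N + (cmod (z - z0) * norm (resolvent T z0)) * norm (resolvent T z)"
      using d N by (intro add_mono) (auto simp: mult_ac)
    also have "\<dots> \<le> N + 1/2 * norm (resolvent T z)"
      using s s' by (intro add_left_mono mult_right_mono) auto
    finally have "norm (resolvent T z) \<le> 2 * N" by simp
    then have "cmod (z - z0) * norm (resolvent T z) * norm (resolvent T z0) \<le> cmod (z - z0) * (2 * N) * N"
      using N by (intro mult_mono mult_nonneg_nonneg) auto
    then show ?thesis using d zs by (simp add: mult_ac)
  qed
  then show ?thesis using N(1) by (intro exI[of _ "1 / (2 * N)"]) auto
qed

lemma continuous_on_resolvent:
  assumes T: "clin T" and S: "S \<inter> spec T = {}"
  shows "continuous_on S (resolvent T)"
proof -
  have "isCont (resolvent T) z0" if z0: "z0 \<in> S" for z0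
  proof -
    obtain e C where e: "e > 0" "\<And>z. cmod (z - z0) < e \<Longrightarrow> norm (resolvent T z - resolvent T z0) \<le> C * cmod (z - z0)"
      using resolvent_locally_lipschitz[OF T, of z0] S z0 by blast
    have "((\<lambda>z. resolvent T z - resolvent T z0) \<longlongrightarrow> 0) (at z0)"
    proof (rule Lim_null_comparison)
      show "\<forall>\<^sub>F z in at z0. norm (resolvent T z - resolvent T z0) \<le> C * cmod (z - z0)"
        unfolding eventually_at using e by (auto simp: dist_norm intro!: exI[of _ e])
      have "((\<lambda>z. C * cmod (z - z0)) \<longlongrightarrow> C * cmod (z0 - z0)) (at z0)" by (intro tendsto_intros)
      then show "((\<lambda>z. C * cmod (z - z0)) \<longlongrightarrow> 0) (at z0)" by simp
    qed
    then show ?thesis unfolding isCont_def by (rule LIM_zero_cancel)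
  qed
  then show ?thesis by (simp add: continuous_at_imp_continuous_on)
qed

lemma resolvent_has_derivative:
  assumes T: "clin T" and z0: "z0 \<notin> spec T"
  shows "((\<lambda>z. resolvent T z x) has_derivative (\<lambda>h. h *\<^sub>C resolvent T z0 (resolvent T z0 x))) (at z0)"
proof -
  obtain e C where e: "e > 0" "\<And>z. cmod (z - z0) < e \<Longrightarrow> z \<notin> spec T" "\<And>z. cmod (z - z0) < e \<Longrightarrow> norm (resolvent T z - resolvent T z0) \<le> C * cmod (z - z0)"
    using resolvent_locally_lipschitz[OF T z0] by blast
  let ?y = "resolvent T z0 x"
  let ?D = "\<lambda>h. h *\<^sub>C resolvent T z0 ?y"
  show ?thesis
  proof (rule has_derivativeI_sandwich[OF e(1), where H = "\<lambda>z. C * norm ?y * cmod (z - z0)"])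
    show "bounded_linear ?D"
      by (rule bounded_linear_intro[where K = "norm (resolvent T z0 ?y)"])
        (auto simp: scaleC_add_left scaleR_scaleC[where 'a = 'a] scaleC_scaleC norm_scaleC scaleR_conv_of_real)
    have "((\<lambda>z. C * norm ?y * cmod (z - z0)) \<longlongrightarrow> C * norm ?y * cmod (z0 - z0)) (at z0)" by (intro tendsto_intros)
    then show "((\<lambda>z. C * norm ?y * cmod (z - z0)) \<longlongrightarrow> 0) (at z0)" by simp
    fix z assume z: "z \<noteq> z0" "dist z z0 < e"
    then have zs: "z \<notin> spec T" using e(2) by (simp add: dist_norm)
    have dd: "a *\<^sub>C u - a *\<^sub>C v = a *\<^sub>C (u - v)" for a and u v :: 'a
      using scaleC_add_right[of a "u - v" v] by (simp add: eq_diff_eq)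
    have "resolvent T z x - ?y - ?D (z - z0) = (z - z0) *\<^sub>C (resolvent T z ?y - resolvent T z0 ?y)"
      unfolding resolvent_identity[OF zs z0] dd ..
    also have "norm \<dots> = cmod (z - z0) * norm ((resolvent T z - resolvent T z0) ?y)" by (simp add: norm_scaleC blinfun.diff_left)
    also have "\<dots> \<le> cmod (z - z0) * (C * cmod (z - z0) * norm ?y)"
      using e(3)[of z] z(2) by (intro mult_left_mono order_trans[OF norm_blinfun] mult_right_mono) (auto simp: dist_norm)
    finally show "norm (resolvent T z x - ?y - ?D (z - z0)) / norm (z - z0) \<le> C * norm ?y * cmod (z - z0)"
      using z(1) by (simp add: divide_le_eq mult_ac)
  qed
qed

lemma resolvent_large:
  assumes T: "clin T" and z: "norm T + 1 \<le> cmod z"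
  shows "z \<notin> spec T" "norm (resolvent T z) \<le> 1"
proof -
  have z0: "cmod z > 0" using z norm_ge_zero[of T] by linarith
  let ?K = "cmul (1 / z) o\<^sub>L T"
  have "norm ?K \<le> cmod (1 / z) * norm T"
    using norm_blinfun_compose[of "cmul (1/z)" T] norm_cmul_le[of "1/z"] by (meson mult_right_mono norm_ge_zero order_trans)
  also have "\<dots> < 1" using z z0 by (simp add: norm_divide divide_less_eq)
  finally obtain Q where Q: "inverse_ops (id_blinfun - ?K) Q"
    using inverse_ops_id_minus[of ?K] clin_simps T by blast
  have zne: "z \<noteq> 0" using z0 by auto
  have "inverse_ops (cmul (- z)) (cmul (- 1 / z))"
    using zne by (auto simp: inverse_ops_def clin_simps scaleC_scaleC)
  from inverse_ops_compose[OF this Q]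
  have "inverse_ops (cmul (- z) o\<^sub>L (id_blinfun - ?K)) (Q o\<^sub>L cmul (- 1 / z))" .
  moreover have "cmul (- z) o\<^sub>L (id_blinfun - ?K) = T - cmul z"
  proof (rule blinfun_eqI)
    fix x
    have dd: "a *\<^sub>C (u - v) = a *\<^sub>C u - a *\<^sub>C v" for a and u v :: 'a
      using scaleC_add_right[of a "u - v" v] by (simp add: eq_diff_eq)
    have mm: "(- a) *\<^sub>C u = - (a *\<^sub>C u)" for a and u :: 'a
      using scaleC_scaleC[of "-1" a u] by (simp add: scaleC_minus1)
    show "(cmul (- z) o\<^sub>L (id_blinfun - ?K)) x = (T - cmul z) x"
      using zne by (simp add: blinfun.diff_left dd scaleC_scaleC scaleC_minus1 mm)
  qed
  ultimately show zs: "z \<notin> spec T" unfolding notin_spec_iff by metis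
  show "norm (resolvent T z) \<le> 1"
  proof (rule norm_blinfun_bound)
    fix x
    let ?y = "resolvent T z x"
    have "z *\<^sub>C ?y = T ?y - x" using resolvent_simps(1)[OF zs, of x] by simp
    then have "cmod z * norm ?y \<le> norm T * norm ?y + norm x"
      using norm_triangle_ineq4[of "T ?y" x] norm_blinfun[of T ?y] norm_scaleC[of z ?y] by simp
    moreover have "(norm T + 1) * norm ?y \<le> cmod z * norm ?y" by (intro mult_right_mono z) simp
    ultimately show "norm ?y \<le> 1 * norm x" by (simp add: distrib_right)
  qed simp
qed

text \<open>The set need not be compact, but the resolvent is bounded by \<open>1\<close> outside a disk.\<close>

lemma resolvent_bounded_on_closed:
  assumes T: "clin T" and C: "closed C" "C \<inter> spec T = {}"
  shows "\<exists>M. \<forall>z\<in>C. norm (resolvent T z) \<le> M"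
proof -
  let ?K = "C \<inter> cball 0 (norm T + 1)"
  have "bounded (resolvent T ` ?K)"
    by (intro compact_imp_bounded compact_continuous_image continuous_on_resolvent[OF T] closed_Int_compact C(1) compact_cball)
      (use C(2) in auto)
  then obtain M where M: "\<And>z. z \<in> ?K \<Longrightarrow> norm (resolvent T z) \<le> M" unfolding bounded_iff by blast
  have "norm (resolvent T z) \<le> max M 1" if "z \<in> C" for z
    using M[of z] resolvent_large(2)[OF T, of z] that by (cases "z \<in> ?K") (auto simp: max_def)
  then show ?thesis by blast
qed

lemma clin_adj:
  assumes "clin T" shows "clin (adj T)"
  unfolding clin_def
proof (intro allI)
  fix c y
  show "adj T (c *\<^sub>C y) = c *\<^sub>C adj T y"
    by (rule cinner_eqI) (simp add: adj_works[OF assms, symmetric] cinner_scaleC_right)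
qed

lemma notin_spec_if_coercive:
  fixes T :: "'a::complex_hilbert \<Rightarrow>\<^sub>L 'a"
  assumes T: "clin T" and \<omega>: "\<omega> \<noteq> 0" and c: "c > 0" "\<And>x. c * (norm x)\<^sup>2 \<le> Re (\<omega> * cinner ((T - cmul z) x) x)"
  shows "z \<notin> spec T"
proof -
  have cl: "clin (cmul \<omega> o\<^sub>L (T - cmul z))" using T by (intro clin_simps)
  have "\<exists>R. inverse_ops (cmul \<omega> o\<^sub>L (T - cmul z)) R"
    by (rule inverse_ops_if_coercive[OF cl c(1)]) (use c(2) in \<open>simp add: cinner_scaleC_left\<close>)
  then obtain R where R: "inverse_ops (cmul \<omega> o\<^sub>L (T - cmul z)) R" by blast
  have "inverse_ops (cmul (1 / \<omega>)) (cmul \<omega>)"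
    using \<omega> by (auto simp: inverse_ops_def clin_simps scaleC_scaleC)
  from inverse_ops_compose[OF this R]
  have "inverse_ops (cmul (1 / \<omega>) o\<^sub>L (cmul \<omega> o\<^sub>L (T - cmul z))) (R o\<^sub>L cmul \<omega>)" .
  moreover have "cmul (1 / \<omega>) o\<^sub>L (cmul \<omega> o\<^sub>L (T - cmul z)) = T - cmul z"
    using \<omega> by (intro blinfun_eqI) (simp add: scaleC_scaleC)
  ultimately show ?thesis unfolding notin_spec_iff by metis
qed

text \<open>The Cauchy--Schwarz inequality for the form of \<open>T\<close>, obtained from its nonnegativity at \<open>x - T x / (\<parallel>T\<parallel> + 1)\<close>.\<close>

lemma norm_sq_le_form:
  fixes T :: "'a::complex_hilbert \<Rightarrow>\<^sub>L 'a"
  assumes sym: "\<And>x y. cinner (T x) y = cinner x (T y)" and pos: "\<And>x. 0 \<le> Re (cinner (T x) x)"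
  shows "(norm (T x))\<^sup>2 \<le> (norm T + 1) * Re (cinner (T x) x)"
proof -
  define N where "N = norm T + 1"
  have N: "N > 0" "norm T \<le> N" unfolding N_def by (auto simp: add_nonneg_pos)
  define y where "y = (1 / N) *\<^sub>R T x"
  have sc: "cinner (r *\<^sub>R u) v = r *\<^sub>R cinner u v" "cinner v (r *\<^sub>R u) = r *\<^sub>R cinner v u" for r and u v :: 'a
    by (rule bounded_bilinear.scaleR_left[OF bounded_bilinear_cinner] bounded_bilinear.scaleR_right[OF bounded_bilinear_cinner])+
  have "cinner (T (x - y)) (x - y) = cinner (T x) x - cinner (T x) y - cinner (T y) x + cinner (T y) y"
    by (simp add: blinfun.diff_right cinner_diff_left cinner_diff_right)
  moreover have "cinner (T x) y = of_real ((norm (T x))\<^sup>2 / N)" unfolding y_def sc cinner_self by (simp add: scaleR_conv_of_real)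
  moreover have "cinner (T y) x = of_real ((norm (T x))\<^sup>2 / N)" unfolding sym[of y x] unfolding y_def sc cinner_self by (simp add: scaleR_conv_of_real)
  ultimately have "0 \<le> Re (cinner (T x) x) - 2 * ((norm (T x))\<^sup>2 / N) + Re (cinner (T y) y)" using pos[of "x - y"] by simp
  moreover have "Re (cinner (T y) y) \<le> (norm (T x))\<^sup>2 / N"
  proof -
    have "Re (cinner (T y) y) \<le> norm (T y) * norm y" using complex_Re_le_cmod cinner_Cauchy_Schwarz order_trans by blast
    also have "\<dots> \<le> N * norm y * norm y"
      using norm_blinfun[of T y] N(2) by (meson mult_right_mono norm_ge_zero order_trans)
    also have "\<dots> = (norm (T x))\<^sup>2 / N" using N(1) by (simp add: y_def power2_eq_square)
    finally show ?thesis .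
  qed
  ultimately have "(norm (T x))\<^sup>2 / N \<le> Re (cinner (T x) x)" by linarith
  then show ?thesis using N(1) unfolding N_def[symmetric] by (simp add: divide_le_eq mult.commute)
qed

text \<open>At the infimum \<open>s = 1\<close> or the supremum \<open>s = -1\<close> of the form of \<open>A\<close>, the operator \<open>s (A - \<mu>)\<close> is nonnegative and
  its form takes arbitrarily small values on unit vectors. Then it also maps unit vectors to arbitrarily small ones,
  which excludes a bounded inverse.\<close>

lemma extreme_of_numerical_range_in_spec:
  fixes A :: "'a::complex_hilbert \<Rightarrow>\<^sub>L 'a"
  assumes A: "clin A" and sym: "\<And>x y. cinner (A x) y = cinner x (A y)" and ne: "\<exists>x::'a. x \<noteq> 0" and s: "s \<in> {1, -1::real}"
  shows "\<exists>\<mu>. complex_of_real \<mu> \<in> spec A \<and> (\<forall>x. s * \<mu> * (norm x)\<^sup>2 \<le> s * Re (cinner (A x) x))"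
proof -
  define q where "q x = s * Re (cinner (A x) x)" for x
  define U where "U = {x::'a. norm x = 1}"
  have ss: "s * s = 1" "\<bar>s\<bar> = 1" using s by auto
  obtain x0 :: 'a where x0: "x0 \<noteq> 0" using ne by blast
  have "norm ((1 / norm x0) *\<^sub>R x0) = 1" using x0 by simp
  then have U: "U \<noteq> {}" unfolding U_def by blast
  have qb: "- norm A \<le> q x" if "x \<in> U" for x
  proof -
    have "\<bar>q x\<bar> \<le> cmod (cinner (A x) x)" unfolding q_def abs_mult ss(2) using abs_Re_le_cmod by simp
    also have "\<dots> \<le> norm (A x) * norm x" by (rule cinner_Cauchy_Schwarz)
    also have "\<dots> \<le> norm A" using norm_blinfun[of A x] that by (simp add: U_def)
    finally show ?thesis by linarith
  qed
  define m where "m = Inf (q ` U)"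
  have mle: "m \<le> q x" if "x \<in> U" for x unfolding m_def using that qb by (auto intro!: cInf_lower bdd_belowI)
  have scR: "cinner (r *\<^sub>R u) v = r *\<^sub>R cinner u v" "cinner v (r *\<^sub>R u) = r *\<^sub>R cinner v u" for r and u v :: 'a
    by (rule bounded_bilinear.scaleR_left[OF bounded_bilinear_cinner] bounded_bilinear.scaleR_right[OF bounded_bilinear_cinner])+
  have mle': "m * (norm x)\<^sup>2 \<le> q x" for x
  proof (cases "x = 0")
    case False
    define e where "e = (1 / norm x) *\<^sub>R x"
    have e: "e \<in> U" "x = norm x *\<^sub>R e" using False unfolding e_def U_def by auto
    have "q x = (norm x)\<^sup>2 * q e" unfolding q_def by (subst (1 2) e(2)) (simp add: blinfun.scaleR_right scR power2_eq_square)
    then show ?thesis using mult_left_mono[OF mle[OF e(1)], of "(norm x)\<^sup>2"] by (simp add: mult.commute)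
  next
    case True
    have "cinner (A 0) 0 = (0::complex)" using cinner_Cauchy_Schwarz[of "A 0" 0] by simp
    then show ?thesis using True by (simp add: q_def)
  qed
  define \<mu> where "\<mu> = s * m"
  define T where "T = s *\<^sub>R (A - cmul (of_real \<mu>))"
  have Tx: "T x = s *\<^sub>R (A x - \<mu> *\<^sub>R x)" for x unfolding T_def by (simp add: blinfun.scaleR_left blinfun.diff_left scaleR_scaleC[of \<mu>])
  have form: "Re (cinner (T x) x) = q x - m * (norm x)\<^sup>2" for x
    unfolding Tx scR cinner_diff_left cinner_self q_def \<mu>_def using ss(1) by (simp add: algebra_simps)
  have symT: "cinner (T x) y = cinner x (T y)" for x y unfolding Tx scR cinner_diff_left cinner_diff_right sym ..
  have "complex_of_real \<mu> \<in> spec A"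
  proof (rule ccontr)
    assume "complex_of_real \<mu> \<notin> spec A"
    then obtain R where R: "inverse_ops (A - cmul (of_real \<mu>)) R" unfolding notin_spec_iff by blast
    have RT: "norm x \<le> norm R * norm (T x)" for x
    proof -
      have "R (A x - \<mu> *\<^sub>R x) = x" using R by (simp add: inverse_ops_def blinfun.diff_left scaleR_scaleC[of \<mu>])
      then have "norm x \<le> norm R * norm (A x - \<mu> *\<^sub>R x)" by (metis norm_blinfun)
      then show ?thesis unfolding Tx using ss(2) by simp
    qed
    define N where "N = (norm R)\<^sup>2 * (norm T + 1)"
    have N: "0 \<le> N" unfolding N_def by (simp add: add_nonneg_nonneg)
    have "m < m + 1 / (N + 1)" using N by (simp add: add_nonneg_pos)
    then obtain x where x: "x \<in> U" "q x < m + 1 / (N + 1)"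
      using cInf_lessD[of "q ` U" "m + 1 / (N + 1)"] U unfolding m_def by auto
    have nx: "norm x = 1" using x(1) by (simp add: U_def)
    have pos: "0 \<le> Re (cinner (T x) x)" for x unfolding form using mle'[of x] by simp
    have "1 \<le> (norm R * norm (T x))\<^sup>2" using RT[of x] nx by simp
    also have "\<dots> \<le> (norm R)\<^sup>2 * ((norm T + 1) * Re (cinner (T x) x))"
      unfolding power_mult_distrib using norm_sq_le_form[OF symT pos] by (intro mult_left_mono) auto
    also have "\<dots> = N * (q x - m)" unfolding form N_def nx by simp
    also have "\<dots> \<le> N * (1 / (N + 1))" using x(2) N by (intro mult_left_mono) auto
    also have "\<dots> < 1" using N by (simp add: divide_less_eq)
    finally show False by simp
  qed
  moreover have "s * \<mu> * (norm x)\<^sup>2 \<le> s * Re (cinner (A x) x)" for x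
    using mle'[of x] ss(1) unfolding \<mu>_def q_def by (simp add: mult.assoc[symmetric])
  ultimately show ?thesis by blast
qed

section \<open>Integrals with respect to a spectral measure\<close>

lemma pvm_empty:
  assumes "projection_valued_measure E" shows "E {} x = 0"
proof -
  have "(\<lambda>n::nat. E {} x) sums E (\<Union>n::nat. {}) x"
    using assms[unfolded projection_valued_measure_def, THEN conjunct2, THEN conjunct2, rule_format, of "\<lambda>_. {}" x]
    by (auto simp: disjoint_family_on_def)
  then have "(\<lambda>n::nat. E {} x) \<longlonglongrightarrow> 0" using sums_summable summable_LIMSEQ_zero by blast
  then show ?thesis by (simp add: LIMSEQ_const_iff)
qed

lemma pvm_Un:
  assumes E: "projection_valued_measure E" and MN: "M \<in> sets borel" "N \<in> sets borel" "M \<inter> N = {}"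
  shows "E (M \<union> N) x = E M x + E N x"
proof -
  define F where "F n = (if n = 0 then M else if n = 1 then N else {})" for n :: nat
  have "range F \<subseteq> sets borel" "disjoint_family F" using MN by (auto simp: F_def disjoint_family_on_def)
  then have "(\<lambda>n. E (F n) x) sums E (\<Union>n. F n) x"
    using E[unfolded projection_valued_measure_def, THEN conjunct2, THEN conjunct2] by blast
  moreover have "(\<Union>n. F n) = M \<union> N"
  proof
    show "M \<union> N \<subseteq> (\<Union>n. F n)" using UN_upper[of 0 UNIV F] UN_upper[of 1 UNIV F] by (simp add: F_def)
  qed (auto simp: F_def split: if_splits)
  moreover have "(\<lambda>n. E (F n) x) sums (\<Sum>n\<in>{0,1}. E (F n) x)"
    by (rule sums_finite) (auto simp: F_def pvm_empty[OF E])
  ultimately have "E (M \<union> N) x = (\<Sum>n\<in>{0,1}. E (F n) x)" by (metis sums_unique2)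
  then show ?thesis by (simp add: F_def)
qed

lemma pvm_lessThan_split:
  assumes E: "projection_valued_measure E" and "c \<le> d"
  shows "E {..<d} x = E {..<c} x + E {c..<d} x"
proof -
  have "{..<d} = {..<c} \<union> {c..<d}" using assms(2) by auto
  moreover have "E ({..<c} \<union> {c..<d}) x = E {..<c} x + E {c..<d} x" by (rule pvm_Un[OF E]) auto
  ultimately show ?thesis by (simp only:)
qed

text \<open>On the range of \<open>E N\<close> the projection \<open>E (M \<union> N)\<close> gives \<open>\<parallel>E (M \<union> N) y\<parallel>\<^sup>2 = \<parallel>E M y\<parallel>\<^sup>2 + \<parallel>y\<parallel>\<^sup>2\<close>, and it does not
  increase norms.\<close>

lemma pvm_orthogonal:
  assumes E: "projection_valued_measure E" and MN: "M \<in> sets borel" "N \<in> sets borel" "M \<inter> N = {}"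
  shows "cinner (E M x) (E N y) = 0"
proof -
  have idem: "E S (E S x) = E S x" if "S \<in> sets borel" for S x
    using E that unfolding projection_valued_measure_def by (metis blinfun_apply_blinfun_compose)
  have sa: "cinner (E S x) y = cinner x (E S y)" if "S \<in> sets borel" for S x y
    using E that unfolding projection_valued_measure_def by blast
  have U: "M \<union> N \<in> sets borel" using MN by blast
  have z: "E M (E N y) = 0" for y
  proof -
    let ?y = "E N y"
    have "(norm (E (M \<union> N) ?y))\<^sup>2 = Re (cinner (E (M \<union> N) ?y) ?y)"
      using cinner_self[of "E (M \<union> N) ?y"] sa[OF U, of "E (M \<union> N) ?y" ?y] idem[OF U, of ?y] by simp
    also have "\<dots> = Re (cinner (E M ?y) ?y) + Re (cinner (E N ?y) ?y)"
      unfolding pvm_Un[OF E MN] cinner_add_left by simp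
    also have "cinner (E M ?y) ?y = cinner (E M ?y) (E M ?y)" using sa[OF MN(1), of "E M ?y" ?y] idem[OF MN(1), of ?y] by simp
    also have "E N ?y = ?y" by (rule idem[OF MN(2)])
    finally have 1: "(norm (E (M \<union> N) ?y))\<^sup>2 = (norm (E M ?y))\<^sup>2 + (norm ?y)\<^sup>2" by (simp add: cinner_self)
    have "(norm (E (M \<union> N) ?y))\<^sup>2 = Re (cinner (E (M \<union> N) ?y) ?y)"
      using cinner_self[of "E (M \<union> N) ?y"] sa[OF U, of "E (M \<union> N) ?y" ?y] idem[OF U, of ?y] by simp
    also have "\<dots> \<le> norm (E (M \<union> N) ?y) * norm ?y" using complex_Re_le_cmod cinner_Cauchy_Schwarz order_trans by blast
    finally have "norm (E (M \<union> N) ?y) \<le> norm ?y"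
      by (cases "norm (E (M \<union> N) ?y) = 0") (auto simp: power2_eq_square)
    then have "(norm (E (M \<union> N) ?y))\<^sup>2 \<le> (norm ?y)\<^sup>2" by (intro power_mono) auto
    then have "(norm (E M ?y))\<^sup>2 \<le> 0" using 1 by linarith
    then show ?thesis by simp
  qed
  have "cinner (E M x) (E N y) = cinner x (E M (E N y))" by (rule sa[OF MN(1)])
  also have "\<dots> = 0" unfolding z using cinner_Cauchy_Schwarz[of x 0] by simp
  finally show ?thesis .
qed

text \<open>The points of the partition into \<open>Suc n\<close> equal cells; \<open>Suc\<close> excludes the empty partition.\<close>

definition grid :: "real \<Rightarrow> real \<Rightarrow> nat \<Rightarrow> nat \<Rightarrow> real" where
  "grid a b n i = a + (b - a) * real i / real (Suc n)"

lemma grid_simps: "grid a b n 0 = a" "grid a b n (Suc n) = b"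
  by (simp_all add: grid_def)

lemma grid_step: "grid a b n (Suc i) - grid a b n i = (b - a) / real (Suc n)"
  by (simp add: grid_def add_divide_distrib ring_distribs)

lemma grid_mono: "a \<le> b \<Longrightarrow> i \<le> j \<Longrightarrow> grid a b n i \<le> grid a b n j"
  unfolding grid_def by (intro add_left_mono divide_right_mono mult_left_mono) auto

lemma grid_less: "a < b \<Longrightarrow> grid a b n i < grid a b n (Suc i)"
  using grid_step[of a b n i] by (metis diff_gt_0_iff_gt divide_pos_pos of_nat_0_less_iff zero_less_Suc)

lemma grid_bounds: "a \<le> b \<Longrightarrow> i \<le> Suc n \<Longrightarrow> grid a b n i \<in> {a..b}"
  using grid_mono[of a b 0 i n] grid_mono[of a b i "Suc n" n] by (simp add: grid_simps)

lemma grid_mesh: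
  assumes "\<delta> > 0" shows "\<forall>\<^sub>F n in sequentially. (b - a) / real (Suc n) < \<delta>"
proof -
  have "(\<lambda>n. (b - a) * inverse (real (Suc n))) \<longlonglongrightarrow> (b - a) * 0" by (intro tendsto_intros LIMSEQ_inverse_real_of_nat)
  then have "(\<lambda>n. (b - a) / real (Suc n)) \<longlonglongrightarrow> 0" by (simp add: divide_inverse)
  then show ?thesis using assms by (rule order_tendstoD(2))
qed

lemma strong_integral_riemann_sums:
  assumes "has_strong_integral_compact E F a b J" and ab: "a < b"
  shows "(\<lambda>n. \<Sum>i<Suc n. E {grid a b n i..<grid a b n (Suc i)} (F (grid a b n i) u)) \<longlonglongrightarrow> J u"
proof (rule LIMSEQ_I)
  fix e :: real assume "e > 0"
  from assms(1)[unfolded has_strong_integral_compact_def, THEN spec, THEN spec, THEN mp, OF this, of u]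
  obtain \<delta> where \<delta>: "\<delta> > 0" "\<forall>(n::nat) (t :: nat \<Rightarrow> real) (\<xi> :: nat \<Rightarrow> real).
       t 0 = a \<and> t n = b \<and> (\<forall>i<n. t i \<le> \<xi> i \<and> \<xi> i < t (Suc i) \<and> t (Suc i) - t i < \<delta>) \<longrightarrow>
       norm ((\<Sum>i<n. E {t i..<t (Suc i)} (F (\<xi> i) u)) - J u) < e"
    by blast
  obtain N where N: "\<And>n. n \<ge> N \<Longrightarrow> (b - a) / real (Suc n) < \<delta>"
    using grid_mesh[OF \<delta>(1), of b a] unfolding eventually_sequentially by blast
  have "norm ((\<Sum>i<Suc n. E {grid a b n i..<grid a b n (Suc i)} (F (grid a b n i) u)) - J u) < e" if "n \<ge> N" for n
    by (rule \<delta>(2)[THEN spec, THEN spec, THEN spec, THEN mp]) (use N[OF that] grid_step[of a b n] grid_less[OF ab, of n] in \<open>simp add: grid_simps\<close>)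
  then show "\<exists>N. \<forall>n\<ge>N. norm ((\<Sum>i<Suc n. E {grid a b n i..<grid a b n (Suc i)} (F (grid a b n i) u)) - J u) < e" by blast
qed

lemma cinner_sum_left: "cinner (\<Sum>i\<in>A. f i) y = (\<Sum>i\<in>A. cinner (f i) (y::'a::complex_hilbert))"
  by (rule bounded_bilinear.sum_left[OF bounded_bilinear_cinner])

lemma cinner_sum_right: "cinner y (\<Sum>i\<in>A. f i) = (\<Sum>i\<in>A. cinner (y::'a::complex_hilbert) (f i))"
  by (rule bounded_bilinear.sum_right[OF bounded_bilinear_cinner])

text \<open>For a Riemann sum \<open>P\<close> with points \<open>t\<^sub>i\<close> and terms \<open>v\<^sub>i\<close>, orthogonality gives
  \<open>\<langle>P Z u, P u\<rangle> = \<langle>B u, P u\<rangle> + \<Sum> t\<^sub>i \<parallel>v\<^sub>i\<parallel>\<^sup>2\<close>. In the limit this is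
  the imaginary part of the Riccati equation for \<open>J\<close>, tested against \<open>J u\<close>.\<close>

lemma strong_integral_form_real:
  fixes B :: "'b::complex_hilbert \<Rightarrow>\<^sub>L 'a::complex_hilbert"
  assumes E: "projection_valued_measure E" and B: "clin B" and ab: "a < b"
    and res: "\<And>t. t \<in> {a..b} \<Longrightarrow> complex_of_real t \<notin> spec Z"
    and J: "has_strong_integral_compact E (\<lambda>\<mu>. B o\<^sub>L resolvent Z (complex_of_real \<mu>)) a b J"
  shows "Im (cinner (J (Z u)) (J u)) = Im (cinner (B u) (J u))"
proof -
  define t where "t = grid a b"
  define M where "M n i = {t n i..<t n (Suc i)}" for n i
  define R where "R n i = resolvent Z (complex_of_real (t n i))" for n i
  define v where "v n i = E (M n i) (B (R n i u))" for n i
  define P where "P n w = (\<Sum>i<Suc n. E (M n i) (B (R n i w)))" for n w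
  have P: "(\<lambda>n. P n w) \<longlonglongrightarrow> J w" for w
    using strong_integral_riemann_sums[OF J ab, of w] unfolding P_def M_def R_def t_def by simp
  have Pu: "P n u = (\<Sum>i<Suc n. v n i)" for n by (simp add: P_def v_def)
  have Mb: "M n i \<in> sets borel" for n i by (simp add: M_def)
  have Md: "M n i \<inter> M n j = {}" if "i \<noteq> j" for n i j
  proof -
    have "M n i \<inter> M n j = {}" if "i < j" for i j
      using grid_mono[of a b "Suc i" j n] ab that by (auto simp: M_def t_def)
    then show ?thesis using that by (metis Int_commute linorder_neqE_nat)
  qed
  have idem: "E S (E S x) = E S x" and sa: "cinner (E S x) y = cinner x (E S y)" and cE: "clin (E S)"
    if "S \<in> sets borel" for S x y
    using E that unfolding projection_valued_measure_def by (metis blinfun_apply_blinfun_compose)+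
  have PZ: "P n (Z u) = (\<Sum>i<Suc n. E (M n i) (B u) + of_real (t n i) *\<^sub>C v n i)" for n
    unfolding P_def
  proof (rule sum.cong[OF refl])
    fix i assume "i \<in> {..<Suc n}"
    then have "t n i \<in> {a..b}" unfolding t_def using ab by (intro grid_bounds) auto
    note r = res[OF this]
    have "R n i (Z u) = u + of_real (t n i) *\<^sub>C R n i u"
      unfolding R_def using resolvent_simps(2,3)[OF r] by simp
    then show "E (M n i) (B (R n i (Z u))) = E (M n i) (B u) + of_real (t n i) *\<^sub>C v n i"
      using B cE[OF Mb] unfolding v_def clin_def by (simp add: blinfun.add_right)
  qed
  have orth: "cinner (E (M n i) x) (P n u) = cinner (E (M n i) x) (v n i)" if "i < Suc n" for n i x
  proof -
    have "cinner (E (M n i) x) (P n u) = (\<Sum>j<Suc n. cinner (E (M n i) x) (v n j))" unfolding Pu by (rule cinner_sum_right)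
    also have "\<dots> = (\<Sum>j<Suc n. if j = i then cinner (E (M n i) x) (v n i) else 0)"
      by (rule sum.cong[OF refl]) (use pvm_orthogonal[OF E Mb Mb Md] in \<open>auto simp: v_def\<close>)
    also have "\<dots> = cinner (E (M n i) x) (v n i)" using that by simp
    finally show ?thesis .
  qed
  have "Im (cinner (P n (Z u)) (P n u)) = Im (cinner (B u) (P n u))" for n
  proof -
    have "cinner (P n (Z u)) (P n u) = (\<Sum>i<Suc n. cinner (B u) (v n i) + of_real (t n i * (norm (v n i))\<^sup>2))"
      unfolding PZ cinner_sum_left
    proof (rule sum.cong[OF refl])
      fix i assume "i \<in> {..<Suc n}"
      then have i: "i < Suc n" by simp
      have "cinner (E (M n i) (B u)) (P n u) = cinner (B u) (v n i)"
        unfolding orth[OF i] unfolding sa[OF Mb] v_def idem[OF Mb] ..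
      moreover have "cinner (v n i) (P n u) = of_real ((norm (v n i))\<^sup>2)"
        unfolding v_def[of n i] orth[OF i] unfolding v_def[of n i] by (rule cinner_self)
      ultimately show "cinner (E (M n i) (B u) + of_real (t n i) *\<^sub>C v n i) (P n u) = cinner (B u) (v n i) + of_real (t n i * (norm (v n i))\<^sup>2)"
        by (simp add: cinner_add_left cinner_scaleC_left)
    qed
    also have "\<dots> = cinner (B u) (P n u) + of_real (\<Sum>i<Suc n. t n i * (norm (v n i))\<^sup>2)"
      unfolding sum.distrib Pu cinner_sum_right of_real_sum ..
    finally show ?thesis by simp
  qed
  moreover have "(\<lambda>n. Im (cinner (P n (Z u)) (P n u))) \<longlonglongrightarrow> Im (cinner (J (Z u)) (J u))"
    by (intro tendsto_Im bounded_bilinear.tendsto[OF bounded_bilinear_cinner] P)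
  moreover have "(\<lambda>n. Im (cinner (B u) (P n u))) \<longlonglongrightarrow> Im (cinner (B u) (J u))"
    by (intro tendsto_Im bounded_bilinear.tendsto[OF bounded_bilinear_cinner] P tendsto_const)
  ultimately show ?thesis by (simp add: LIMSEQ_unique)
qed

text \<open>Riemann--Stieltjes sums whose integrator has a density: on each cell the first argument of \<open>\<Phi>\<close> is frozen at the left
  end point.\<close>

lemma frozen_riemann_sums:
  fixes \<Phi> :: "real \<Rightarrow> real \<Rightarrow> complex"
  assumes ab: "a < b" and diag: "(\<lambda>t. \<Phi> t t) integrable_on {a..b}"
    and int: "\<And>s c d. s \<in> {a..b} \<Longrightarrow> a \<le> c \<Longrightarrow> d \<le> b \<Longrightarrow> \<Phi> s integrable_on {c..d}"
    and unif: "\<And>e. e > 0 \<Longrightarrow> \<exists>\<delta>>0. \<forall>s\<in>{a..b}. \<forall>t\<in>{a..b}. \<bar>s - t\<bar> < \<delta> \<longrightarrow> cmod (\<Phi> s t - \<Phi> t t) \<le> e"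
  shows "(\<lambda>n. \<Sum>i<Suc n. integral {grid a b n i..grid a b n (Suc i)} (\<Phi> (grid a b n i))) \<longlonglongrightarrow> integral {a..b} (\<lambda>t. \<Phi> t t)"
proof (rule LIMSEQ_I)
  fix r :: real assume r: "r > 0"
  define e where "e = r / 2 / (b - a)"
  have "e * (b - a) = r / 2"
    unfolding e_def by (rule nonzero_eq_divide_eq[THEN iffD1, OF _ refl]) (use ab in simp)
  then have e: "e * (b - a) < r" "e > 0" using r ab by (linarith, simp add: e_def)
  note e = e(2,1)
  obtain \<delta> where \<delta>: "\<delta> > 0" "\<And>s t. s \<in> {a..b} \<Longrightarrow> t \<in> {a..b} \<Longrightarrow> \<bar>s - t\<bar> < \<delta> \<Longrightarrow> cmod (\<Phi> s t - \<Phi> t t) \<le> e"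
    using unif[OF e(1)] by metis
  obtain N where N: "\<And>n. n \<ge> N \<Longrightarrow> (b - a) / real (Suc n) < \<delta>"
    using grid_mesh[OF \<delta>(1), of b a] unfolding eventually_sequentially by blast
  have "norm ((\<Sum>i<Suc n. integral {grid a b n i..grid a b n (Suc i)} (\<Phi> (grid a b n i))) - integral {a..b} (\<lambda>t. \<Phi> t t)) < r" if n: "n \<ge> N" for n
  proof -
    let ?t = "grid a b n"
    have sub: "(\<lambda>t. \<Phi> t t) integrable_on {c..d}" if "a \<le> c" "d \<le> b" for c d
      by (rule integrable_subinterval_real[OF diag]) (use that in auto)
    have tb: "?t i \<in> {a..b}" if "i \<le> Suc n" for i using grid_bounds[OF less_imp_le[OF ab] that] .
    have "integral {a..?t k} (\<lambda>t. \<Phi> t t) = (\<Sum>i<k. integral {?t i..?t (Suc i)} (\<lambda>t. \<Phi> t t))" if "k \<le> Suc n" for k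
      using that
    proof (induction k)
      case (Suc k)
      have "integral {a..?t k} (\<lambda>t. \<Phi> t t) + integral {?t k..?t (Suc k)} (\<lambda>t. \<Phi> t t) = integral {a..?t (Suc k)} (\<lambda>t. \<Phi> t t)"
        using tb[of k] tb[of "Suc k"] Suc.prems grid_less[OF ab, of n k]
        by (intro Henstock_Kurzweil_Integration.integral_combine sub) auto
      then show ?case using Suc by simp
    qed (simp add: grid_simps)
    from this[of "Suc n"] have split: "integral {a..b} (\<lambda>t. \<Phi> t t) = (\<Sum>i<Suc n. integral {?t i..?t (Suc i)} (\<lambda>t. \<Phi> t t))"
      by (simp add: grid_simps)
    have "cmod (integral {?t i..?t (Suc i)} (\<Phi> (?t i)) - integral {?t i..?t (Suc i)} (\<lambda>t. \<Phi> t t)) \<le> e * ((b - a) / real (Suc n))"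
      if i: "i < Suc n" for i
    proof -
      have b1: "?t i \<in> {a..b}" "?t (Suc i) \<in> {a..b}" "?t i \<le> ?t (Suc i)"
        using tb[of i] tb[of "Suc i"] i grid_less[OF ab, of n i] by auto
      have 1: "\<Phi> (?t i) integrable_on {?t i..?t (Suc i)}" "(\<lambda>t. \<Phi> t t) integrable_on {?t i..?t (Suc i)}"
        using b1 by (auto intro!: int sub)
      have "integral {?t i..?t (Suc i)} (\<Phi> (?t i)) - integral {?t i..?t (Suc i)} (\<lambda>t. \<Phi> t t)
        = integral {?t i..?t (Suc i)} (\<lambda>t. \<Phi> (?t i) t - \<Phi> t t)"
        by (rule Henstock_Kurzweil_Integration.integral_diff[OF 1, symmetric])
      also have "cmod \<dots> \<le> integral {?t i..?t (Suc i)} (\<lambda>t. e)"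
      proof (rule integral_norm_bound_integral[OF integrable_diff[OF 1] integrable_const_ivl])
        fix t assume t: "t \<in> {?t i..?t (Suc i)}"
        have "\<bar>?t i - t\<bar> < \<delta>" using t grid_step[of a b n i] N[OF n] by (simp add: abs_less_iff)
        then show "cmod (\<Phi> (?t i) t - \<Phi> t t) \<le> e" using b1 t by (intro \<delta>(2)) auto
      qed
      also have "\<dots> = e * ((b - a) / real (Suc n))" using b1(3) grid_step[of a b n i] by (simp add: mult.commute)
      finally show ?thesis .
    qed
    then have "cmod (\<Sum>i<Suc n. integral {?t i..?t (Suc i)} (\<Phi> (?t i)) - integral {?t i..?t (Suc i)} (\<lambda>t. \<Phi> t t)) \<le> (\<Sum>i<Suc n. e * ((b - a) / real (Suc n)))"
      by (intro sum_norm_le) auto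
    also have "\<dots> = e * (b - a)" by simp
    finally show ?thesis unfolding split sum_subtractf[symmetric] using e(2) by simp
  qed
  then show "\<exists>N. \<forall>n\<ge>N. norm ((\<Sum>i<Suc n. integral {grid a b n i..grid a b n (Suc i)} (\<Phi> (grid a b n i))) - integral {a..b} (\<lambda>t. \<Phi> t t)) < r" by blast
qed

text \<open>Moving \<open>B\<close> to the left factor turns the spectral projections of the cells into increments of \<open>K\<^sub>B\<close>.\<close>

lemma strong_integral_eq_integral:
  fixes B :: "'b::complex_hilbert \<Rightarrow>\<^sub>L 'a::complex_hilbert"
  assumes E: "projection_valued_measure E" and B: "clin B" and Z: "clin Z" and ab: "a < b"
    and res: "\<And>t. t \<in> {a..b} \<Longrightarrow> complex_of_real t \<notin> spec Z"
    and K: "\<And>t. t \<in> {a..b} \<Longrightarrow> (K_B B E has_vector_derivative K' (complex_of_real t)) (at t)"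
    and contK: "continuous_on {a..b} (\<lambda>t. K' (complex_of_real t))"
    and J: "has_strong_integral_compact E (\<lambda>\<mu>. B o\<^sub>L resolvent Z (complex_of_real \<mu>)) a b J"
  shows "cinner (J u) (B u) = integral {a..b} (\<lambda>t. cinner (K' (complex_of_real t) (resolvent Z (complex_of_real t) u)) u)"
proof -
  define \<Phi> where "\<Phi> s t = cinner (K' (complex_of_real t) (resolvent Z (complex_of_real s) u)) u" for s t :: real
  have blv: "bounded_linear (\<lambda>T :: 'b \<Rightarrow>\<^sub>L 'b. cinner (T v) u)" for v
    by (rule bounded_linear_compose[OF bounded_bilinear.bounded_linear_left[OF bounded_bilinear_cinner] blinfun.bounded_linear_left])
  have contR: "continuous_on {a..b} (\<lambda>t. resolvent Z (complex_of_real t))"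
    by (rule continuous_on_compose2[OF continuous_on_resolvent[OF Z, of "complex_of_real ` {a..b}"]]) (use res in \<open>auto intro!: continuous_intros\<close>)
  have cs: "continuous_on S (\<Phi> s)" if "S \<subseteq> {a..b}" for S s
    unfolding \<Phi>_def by (intro bounded_linear.continuous_on[OF blv] continuous_on_subset[OF contK that])
  have cd: "continuous_on {a..b} (\<lambda>t. \<Phi> t t)"
    unfolding \<Phi>_def by (intro bounded_bilinear.continuous_on[OF bounded_bilinear_cinner] bounded_bilinear.continuous_on[OF bounded_bilinear_blinfun_apply] contK contR continuous_on_const)
  have lim: "(\<lambda>n. \<Sum>i<Suc n. integral {grid a b n i..grid a b n (Suc i)} (\<Phi> (grid a b n i))) \<longlonglongrightarrow> integral {a..b} (\<lambda>t. \<Phi> t t)"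
  proof (rule frozen_riemann_sums[OF ab])
    show "(\<lambda>t. \<Phi> t t) integrable_on {a..b}" by (rule integrable_continuous_interval[OF cd])
    show "\<Phi> s integrable_on {c..d}" if "a \<le> c" "d \<le> b" for s c d
      by (rule integrable_continuous_interval[OF cs]) (use that in auto)
    fix e :: real assume e: "e > 0"
    have "bounded ((\<lambda>t. K' (complex_of_real t)) ` {a..b})" by (intro compact_imp_bounded compact_continuous_image contK compact_Icc)
    then obtain M where M: "\<And>t. t \<in> {a..b} \<Longrightarrow> norm (K' (complex_of_real t)) \<le> M" unfolding bounded_iff by blast
    have M0: "0 \<le> M" using order_trans[OF norm_ge_zero M[of a]] ab by simp
    define Q where "Q = M * (norm u * norm u) + 1"
    have Q: "Q > 0" unfolding Q_def using M0 by (simp add: add_nonneg_pos)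
    have "uniformly_continuous_on {a..b} (\<lambda>t. resolvent Z (complex_of_real t))"
      by (rule compact_uniformly_continuous[OF contR compact_Icc])
    then obtain \<delta> where \<delta>: "\<delta> > 0" "\<And>s t. s \<in> {a..b} \<Longrightarrow> t \<in> {a..b} \<Longrightarrow> dist s t < \<delta> \<Longrightarrow> dist (resolvent Z (complex_of_real s)) (resolvent Z (complex_of_real t)) < e / Q"
      unfolding uniformly_continuous_on_def using e Q by (metis divide_pos_pos dist_commute)
    have "cmod (\<Phi> s t - \<Phi> t t) \<le> e" if st: "s \<in> {a..b}" "t \<in> {a..b}" "\<bar>s - t\<bar> < \<delta>" for s t
    proof -
      let ?D = "resolvent Z (complex_of_real s) - resolvent Z (complex_of_real t)"
      have "\<Phi> s t - \<Phi> t t = cinner (K' (complex_of_real t) (?D u)) u"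
        unfolding \<Phi>_def by (simp add: blinfun.diff_left blinfun.diff_right cinner_diff_left)
      also have "cmod \<dots> \<le> norm (K' (complex_of_real t) (?D u)) * norm u" by (rule cinner_Cauchy_Schwarz)
      also have "\<dots> \<le> (M * (norm ?D * norm u)) * norm u"
      proof (rule mult_right_mono)
        have "norm (K' (complex_of_real t) (?D u)) \<le> norm (K' (complex_of_real t)) * norm (?D u)" by (rule norm_blinfun)
        also have "\<dots> \<le> M * (norm ?D * norm u)" using M[OF st(2)] M0 norm_blinfun[of ?D u] by (intro mult_mono) auto
        finally show "norm (K' (complex_of_real t) (?D u)) \<le> M * (norm ?D * norm u)" .
      qed simp
      also have "\<dots> = norm ?D * (M * (norm u * norm u))" by (simp add: mult_ac)
      also have "\<dots> \<le> (e / Q) * Q" using \<delta>(2)[OF st(1,2)] st(3) M0 e Q unfolding Q_def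
        by (intro mult_mono) (auto simp: dist_norm dist_real_def)
      also have "\<dots> = e" using Q by simp
      finally show ?thesis .
    qed
    then show "\<exists>\<delta>>0. \<forall>s\<in>{a..b}. \<forall>t\<in>{a..b}. \<bar>s - t\<bar> < \<delta> \<longrightarrow> cmod (\<Phi> s t - \<Phi> t t) \<le> e" using \<delta>(1) by blast
  qed
  have term_eq: "cinner (E {grid a b n i..<grid a b n (Suc i)} (B (resolvent Z (complex_of_real (grid a b n i)) u))) (B u)
     = integral {grid a b n i..grid a b n (Suc i)} (\<Phi> (grid a b n i))" if i: "i < Suc n" for n i
  proof -
    let ?c = "grid a b n i" and ?d = "grid a b n (Suc i)"
    let ?v = "resolvent Z (complex_of_real ?c) u"
    have cd': "?c \<in> {a..b}" "?d \<in> {a..b}" "?c \<le> ?d"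
      using grid_bounds[OF less_imp_le[OF ab], of i n] grid_bounds[OF less_imp_le[OF ab], of "Suc i" n] i grid_less[OF ab, of n i] by auto
    have "((\<lambda>t. cinner (K_B B E t ?v) u) has_vector_derivative \<Phi> ?c t) (at t within {?c..?d})" if "t \<in> {?c..?d}" for t
      unfolding \<Phi>_def
      by (rule bounded_linear.has_vector_derivative[OF blv], rule has_vector_derivative_at_within, rule K) (use that cd' in auto)
    from fundamental_theorem_of_calculus[OF cd'(3) this]
    have "integral {?c..?d} (\<Phi> ?c) = cinner (K_B B E ?d ?v) u - cinner (K_B B E ?c ?v) u" by (simp add: integral_unique)
    also have "\<dots> = cinner (E {..<?d} (B ?v)) (B u) - cinner (E {..<?c} (B ?v)) (B u)"
    proof -
      have "cinner (K_B B E \<mu> ?v) u = cinner (E {..<\<mu>} (B ?v)) (B u)" for \<mu>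
      proof -
        have "cinner (K_B B E \<mu> ?v) u = cnj (cinner u (adj B (E {..<\<mu>} (B ?v))))" by (subst cinner_commute) (simp add: K_B_def)
        also have "\<dots> = cnj (cinner (B u) (E {..<\<mu>} (B ?v)))" by (simp add: adj_works[OF B])
        also have "\<dots> = cinner (E {..<\<mu>} (B ?v)) (B u)" by (rule cinner_commute[symmetric])
        finally show ?thesis .
      qed
      then show ?thesis by simp
    qed
    finally have "integral {?c..?d} (\<Phi> ?c) = cinner (E {..<?d} (B ?v)) (B u) - cinner (E {..<?c} (B ?v)) (B u)" .
    then show ?thesis unfolding pvm_lessThan_split[OF E cd'(3)] cinner_add_left by simp
  qed
  have "(\<lambda>n. cinner (\<Sum>i<Suc n. E {grid a b n i..<grid a b n (Suc i)} ((B o\<^sub>L resolvent Z (complex_of_real (grid a b n i))) u)) (B u)) \<longlonglongrightarrow> cinner (J u) (B u)"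
    by (rule bounded_bilinear.tendsto[OF bounded_bilinear_cinner strong_integral_riemann_sums[OF J ab] tendsto_const])
  moreover have "cinner (\<Sum>i<Suc n. E {grid a b n i..<grid a b n (Suc i)} ((B o\<^sub>L resolvent Z (complex_of_real (grid a b n i))) u)) (B u)
     = (\<Sum>i<Suc n. integral {grid a b n i..grid a b n (Suc i)} (\<Phi> (grid a b n i)))" for n
    unfolding cinner_sum_left by (rule sum.cong[OF refl]) (simp only: term_eq lessThan_iff blinfun_apply_blinfun_compose)
  ultimately have "(\<lambda>n. \<Sum>i<Suc n. integral {grid a b n i..grid a b n (Suc i)} (\<Phi> (grid a b n i))) \<longlonglongrightarrow> cinner (J u) (B u)"
    by (simp only:)
  from LIMSEQ_unique[OF this lim] show ?thesis unfolding \<Phi>_def .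
qed

section \<open>The spectrum of the solution\<close>

text \<open>Transfers the growth bounds for \<open>K\<^sub>B'\<close>, which are assumed on the open domain, to the interval in its boundary.\<close>

lemma le_at_closure_point:
  fixes p q :: "complex \<Rightarrow> real"
  assumes "isCont p w" "isCont q w" "w \<in> closure A" "open V" "w \<in> V" and le: "\<And>v. v \<in> A \<Longrightarrow> v \<in> V \<Longrightarrow> p v \<le> q v"
  shows "p w \<le> q w"
proof -
  obtain x where x: "\<And>n. x n \<in> A" "x \<longlonglongrightarrow> w" using assms(3) unfolding closure_sequential by blast
  have "(\<lambda>n. p (x n)) \<longlonglongrightarrow> p w" "(\<lambda>n. q (x n)) \<longlonglongrightarrow> q w"
    using assms(1,2) x(2) by (auto intro: isCont_tendsto_compose)
  moreover have "\<forall>\<^sub>F n in sequentially. x n \<in> V" using topological_tendstoD[OF x(2) assms(4,5)] .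
  then have "\<forall>\<^sub>F n in sequentially. p (x n) \<le> q (x n)" by eventually_elim (use le x(1) in blast)
  ultimately show ?thesis using tendsto_le[OF sequentially_bot] by blast
qed

lemma op_analytic_on_open:
  assumes "op_analytic_on F S"
  obtains U where "open U" "S \<subseteq> U" "\<And>w. w \<in> U \<Longrightarrow> clin (F w) \<and> (\<exists>F'. (F has_derivative (\<lambda>h. cmul h o\<^sub>L F')) (at w))"
proof
  let ?P = "\<lambda>w. clin (F w) \<and> (\<exists>F'. (F has_derivative (\<lambda>h. cmul h o\<^sub>L F')) (at w))"
  let ?U = "\<Union>{ball z e | z e. \<forall>w\<in>ball z e. ?P w}"
  show "open ?U" by (intro open_Union) auto
  show "S \<subseteq> ?U"
  proof
    fix z assume "z \<in> S"
    then obtain e where e: "e > 0" "\<forall>w\<in>ball z e. ?P w" using assms unfolding op_analytic_on_def by blast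
    then have "z \<in> ball z e" by simp
    with e(2) show "z \<in> ?U" by blast
  qed
qed blast

lemma resolvent_form_holomorphic:
  fixes K :: "complex \<Rightarrow> 'b::complex_hilbert \<Rightarrow>\<^sub>L 'b"
  assumes Z: "clin Z" and K: "\<And>w. w \<in> U \<Longrightarrow> clin (K w) \<and> (\<exists>K'. (K has_derivative (\<lambda>h. cmul h o\<^sub>L K')) (at w))"
    and U: "U \<inter> spec Z = {}"
  shows "(\<lambda>w. cinner (K w (resolvent Z w x)) x) holomorphic_on U"
  unfolding holomorphic_on_def field_differentiable_def
proof
  fix w assume w: "w \<in> U"
  obtain K' where K': "clin (K w)" "(K has_derivative (\<lambda>h. cmul h o\<^sub>L K')) (at w)" using K[OF w] by blast
  let ?r = "resolvent Z w x" and ?y = "resolvent Z w (resolvent Z w x)"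
  have wz: "w \<notin> spec Z" using U w by blast
  have "((\<lambda>w. K w (resolvent Z w x)) has_derivative (\<lambda>h. K w (h *\<^sub>C ?y) + (cmul h o\<^sub>L K') ?r)) (at w)"
    by (rule bounded_bilinear.FDERIV[OF bounded_bilinear_blinfun_apply K'(2) resolvent_has_derivative[OF Z wz]])
  then have "((\<lambda>w. cinner (K w (resolvent Z w x)) x) has_derivative (\<lambda>h. cinner (K w (h *\<^sub>C ?y) + (cmul h o\<^sub>L K') ?r) x)) (at w)"
    by (rule bounded_linear.has_derivative[OF bounded_bilinear.bounded_linear_left[OF bounded_bilinear_cinner]])
  moreover have "cinner (K w (h *\<^sub>C ?y) + (cmul h o\<^sub>L K') ?r) x = (cinner (K w ?y) x + cinner (K' ?r) x) * h" for h
    using K'(1) by (simp add: clin_def cinner_add_left cinner_scaleC_left algebra_simps)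
  ultimately have "((\<lambda>w. cinner (K w (resolvent Z w x)) x) has_field_derivative (cinner (K w ?y) x + cinner (K' ?r) x)) (at w)"
    unfolding has_field_derivative_def by simp
  then show "\<exists>f'. ((\<lambda>w. cinner (K w (resolvent Z w x)) x) has_field_derivative f') (at w within U)"
    using has_field_derivative_at_within by blast
qed

text \<open>With \<open>G = 1 - Y\<^sup>* Y > 0\<close>, the form of \<open>G (Z - z)\<close> has the imaginary part \<open>- Im z \<langle>G x, x\<rangle>\<close>, so a multiple of
  this operator is coercive if \<open>Im z \<noteq> 0\<close>.\<close>

lemma spec_real_if_contractive_graph:
  fixes Z :: "'b::complex_hilbert \<Rightarrow>\<^sub>L 'b" and Y :: "'b \<Rightarrow>\<^sub>L 'a::complex_hilbert"
  assumes Z: "clin Z" and Y: "clin Y" "norm Y < 1"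
    and form: "\<And>x. Im (cinner (Z x) x) = Im (cinner (Y (Z x)) (Y x))" and z: "z \<in> spec Z"
  shows "Im z = 0"
proof (rule ccontr)
  assume im: "Im z \<noteq> 0"
  define s where "s = sgn (Im z)"
  have s: "s * Im z = \<bar>Im z\<bar>" "s \<noteq> 0" using im by (auto simp: s_def sgn_if)
  define c where "c = 1 - (norm Y)\<^sup>2"
  have c: "c > 0" unfolding c_def using Y(2) by (simp add: abs_square_less_1)
  have low: "c * (norm x)\<^sup>2 \<le> (norm x)\<^sup>2 - (norm (Y x))\<^sup>2" for x
  proof -
    have "(norm (Y x))\<^sup>2 \<le> (norm Y * norm x)\<^sup>2" by (intro power_mono norm_blinfun) simp
    then show ?thesis by (simp add: c_def power_mult_distrib algebra_simps)
  qed
  define G where "G = id_blinfun - (adj Y o\<^sub>L Y)"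
  have clG: "clin G" unfolding G_def by (intro clin_simps clin_adj Y(1))
  have Gf: "cinner (G u) v = cinner u v - cinner (Y u) (Y v)" for u v
  proof -
    have "cinner (adj Y (Y u)) v = cnj (cinner v (adj Y (Y u)))" by (rule cinner_commute)
    also have "\<dots> = cnj (cinner (Y v) (Y u))" by (simp add: adj_works[OF Y(1)])
    also have "\<dots> = cinner (Y u) (Y v)" by (rule cinner_commute[symmetric])
    finally show ?thesis by (simp add: G_def blinfun.diff_left cinner_diff_left)
  qed
  have injG: "y = y'" if "G y = G y'" for y y'
  proof -
    have "G (y - y') = 0" using that by (simp add: blinfun.diff_right)
    then have "Re (cinner (G (y - y')) (y - y')) = 0" using cinner_Cauchy_Schwarz[of 0 "y - y'"] by simp
    then have "c * (norm (y - y'))\<^sup>2 \<le> 0" using low[of "y - y'"] unfolding Gf cinner_self by simp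
    then have "(norm (y - y'))\<^sup>2 \<le> 0" using c by (simp add: mult_le_0_iff)
    then show ?thesis by simp
  qed
  let ?\<omega> = "\<i> * complex_of_real s"
  define T where "T = cmul ?\<omega> o\<^sub>L (G o\<^sub>L (Z - cmul z))"
  have clT: "clin T" unfolding T_def by (intro clin_simps clG Z)
  have "\<exists>R. inverse_ops T R"
  proof (rule inverse_ops_if_coercive[OF clT])
    show "\<bar>Im z\<bar> * c > 0" using im c by simp
    fix x
    have "cinner (G ((Z - cmul z) x)) x = cinner (Z x) x - cinner (Y (Z x)) (Y x) - z * of_real ((norm x)\<^sup>2 - (norm (Y x))\<^sup>2)"
      using Y(1) unfolding Gf
      by (simp add: blinfun.diff_left blinfun.diff_right cinner_diff_left clin_def cinner_scaleC_left cinner_self algebra_simps)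
    then have "Im (cinner (G ((Z - cmul z) x)) x) = - (Im z * ((norm x)\<^sup>2 - (norm (Y x))\<^sup>2))"
      using form[of x] by simp
    moreover have "Re (cinner (T x) x) = - (s * Im (cinner (G ((Z - cmul z) x)) x))"
      by (simp add: T_def cinner_scaleC_left)
    ultimately have "Re (cinner (T x) x) = s * Im z * ((norm x)\<^sup>2 - (norm (Y x))\<^sup>2)" by simp
    then show "\<bar>Im z\<bar> * c * (norm x)\<^sup>2 \<le> Re (cinner (T x) x)"
      unfolding s(1) using mult_left_mono[OF low[of x], of "\<bar>Im z\<bar>"] by (simp add: mult.assoc)
  qed
  then obtain R where R: "inverse_ops T R" by blast
  have "inverse_ops (Z - cmul z) (R o\<^sub>L (cmul ?\<omega> o\<^sub>L G))"
    unfolding inverse_ops_def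
  proof (intro conjI allI)
    show "clin (R o\<^sub>L (cmul ?\<omega> o\<^sub>L G))" using R clG unfolding inverse_ops_def by (intro clin_simps) auto
    show "(R o\<^sub>L (cmul ?\<omega> o\<^sub>L G)) ((Z - cmul z) x) = x" for x
      using R unfolding inverse_ops_def T_def by simp
    show "(Z - cmul z) ((R o\<^sub>L (cmul ?\<omega> o\<^sub>L G)) x) = x" for x
    proof (rule injG)
      let ?r = "(R o\<^sub>L (cmul ?\<omega> o\<^sub>L G)) x"
      have "T ?r = ?\<omega> *\<^sub>C G x" using R unfolding inverse_ops_def by simp
      then have "?\<omega> *\<^sub>C G ((Z - cmul z) ?r) = ?\<omega> *\<^sub>C G x" by (simp add: T_def)
      then have "(1 / ?\<omega>) *\<^sub>C (?\<omega> *\<^sub>C G ((Z - cmul z) ?r)) = (1 / ?\<omega>) *\<^sub>C (?\<omega> *\<^sub>C G x)" by simp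
      then show "G ((Z - cmul z) ?r) = G x" using s(2) unfolding scaleC_scaleC by simp
    qed
  qed
  then have "z \<notin> spec Z" unfolding notin_spec_iff by blast
  then show False using z by simp
qed

text \<open>If \<open>t\<close> lies at or beyond an end point of the interval, the form of \<open>A - t\<close> or of its negative is at least
  \<open>d > \<parallel>X\<parallel>\<close>, since the extreme values of the form of \<open>A\<close> are spectral points of \<open>A\<close>. Thus \<open>\<plusminus> (A + X - t)\<close> is coercive.\<close>

lemma real_spec_in_interval:
  fixes A X :: "'b::complex_hilbert \<Rightarrow>\<^sub>L 'b"
  assumes A: "clin A" "self_adjoint UNIV (blinfun_apply A)" and ne: "\<exists>x::'b. x \<noteq> 0"
    and specA: "spec A \<subseteq> complex_of_real ` interval0 m1 m2"
    and X: "clin X" "norm X < d"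
    and end1: "\<And>r \<mu>. m1 = ereal r \<Longrightarrow> complex_of_real \<mu> \<in> spec A \<Longrightarrow> d \<le> dist \<mu> r"
    and end2: "\<And>r \<mu>. m2 = ereal r \<Longrightarrow> complex_of_real \<mu> \<in> spec A \<Longrightarrow> d \<le> dist \<mu> r"
    and t: "complex_of_real t \<in> spec (A + X)"
  shows "t \<in> interval0 m1 m2"
proof -
  have sym: "cinner (A x) y = cinner x (A y)" for x y
    using A(2) unfolding self_adjoint_def by blast
  have far: False if s: "s \<in> {1, -1::real}" and \<mu>: "complex_of_real \<mu> \<in> spec A" 
    "\<And>x. s * \<mu> * (norm x)\<^sup>2 \<le> s * Re (cinner (A x) x)" and gap: "d \<le> s * (\<mu> - t)" for s \<mu>
  proof -
    have ss: "\<bar>s\<bar> = 1" "s \<noteq> 0" using s by auto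
    have "of_real t \<notin> spec (A + X)"
    proof (rule notin_spec_if_coercive[where \<omega> = "of_real s" and c = "d - norm X"])
      show "clin (A + X)" by (intro clin_simps A X)
      fix x
      have "\<bar>s * Re (cinner (X x) x)\<bar> \<le> norm X * (norm x)\<^sup>2"
      proof -
        have "\<bar>s * Re (cinner (X x) x)\<bar> \<le> cmod (cinner (X x) x)" unfolding abs_mult ss(1) using abs_Re_le_cmod by simp
        also have "\<dots> \<le> norm (X x) * norm x" by (rule cinner_Cauchy_Schwarz)
        also have "\<dots> \<le> norm X * norm x * norm x" by (intro mult_right_mono norm_blinfun) simp
        finally show ?thesis by (simp add: power2_eq_square mult.assoc)
      qed
      moreover have "d * (norm x)\<^sup>2 \<le> s * (\<mu> - t) * (norm x)\<^sup>2" using gap by (intro mult_right_mono) auto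
      moreover have "Re (of_real s * cinner ((A + X - cmul (of_real t)) x) x) = s * Re (cinner (A x) x) + s * Re (cinner (X x) x) - s * t * (norm x)\<^sup>2"
        by (simp add: blinfun.add_left blinfun.diff_left cinner_diff_left cinner_add_left cinner_scaleC_left cinner_self algebra_simps)
      ultimately show "(d - norm X) * (norm x)\<^sup>2 \<le> Re (of_real s * cinner ((A + X - cmul (of_real t)) x) x)"
        using \<mu>(2)[of x] by (simp add: algebra_simps abs_le_iff)
    qed (use ss X in auto)
    then show False using t by simp
  qed
  have "m1 < ereal t"
  proof (rule ccontr)
    assume n: "\<not> m1 < ereal t"
    obtain \<mu> where \<mu>: "complex_of_real \<mu> \<in> spec A" "\<And>x. 1 * \<mu> * (norm x)\<^sup>2 \<le> 1 * Re (cinner (A x) x)"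
      using extreme_of_numerical_range_in_spec[OF A(1) sym ne, of 1] by auto
    have \<mu>D: "m1 < ereal \<mu>" using \<mu>(1) specA by (auto simp: interval0_def)
    then obtain r where r: "m1 = ereal r" using n by (cases m1) auto
    have "d \<le> 1 * (\<mu> - t)" using end1[OF r \<mu>(1)] \<mu>D n r by (simp add: dist_real_def)
    then show False using far[of 1 \<mu>] \<mu> by simp
  qed
  moreover have "ereal t < m2"
  proof (rule ccontr)
    assume n: "\<not> ereal t < m2"
    obtain \<mu> where \<mu>: "complex_of_real \<mu> \<in> spec A" "\<And>x. (-1) * \<mu> * (norm x)\<^sup>2 \<le> (-1) * Re (cinner (A x) x)"
      using extreme_of_numerical_range_in_spec[OF A(1) sym ne, of "-1"] by auto
    have \<mu>D: "ereal \<mu> < m2" using \<mu>(1) specA by (auto simp: interval0_def)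
    then obtain r where r: "m2 = ereal r" using n by (cases m2) auto
    have "d \<le> (-1) * (\<mu> - t)" using end2[OF r \<mu>(1)] \<mu>D n r by (simp add: dist_real_def)
    then show False using far[of "-1" \<mu>] \<mu> by simp
  qed
  ultimately show ?thesis by (simp add: interval0_def)
qed

text \<open>The contour tends to its end point, which therefore is not closer to \<open>S\<close> than the contour.\<close>

lemma dist_to_contour_end:
  fixes m :: ereal
  assumes lim: "filterlim h (end_filter m) (F \<times>\<^sub>F principal {0..1::real})" "F \<noteq> bot" "\<forall>\<^sub>F s in F. s \<in> {0<..<1::real}"
    and h1: "\<And>s. s \<in> {0<..<1} \<Longrightarrow> h (s, 1) = \<gamma> s" and m: "m = ereal r" and z: "z \<in> S"
  shows "setdist S (\<gamma> ` {0<..<1}) \<le> dist z (complex_of_real r)"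
proof (rule field_le_epsilon)
  fix e :: real assume e: "e > 0"
  have "\<forall>\<^sub>F w in end_filter m. w \<in> ball (complex_of_real r) e"
    using e m by (auto simp: end_filter_def simp del: mem_ball intro!: eventually_nhds_in_open)
  from eventually_happens'[OF lim(2) eventually_conj[OF eventually_end[OF lim(1) this] lim(3)]]
  obtain s where "\<forall>t\<in>{0..1}. h (s, t) \<in> ball (complex_of_real r) e" "s \<in> {0<..<1}" by blast
  then have s: "s \<in> {0<..<1}" "h (s, 1) \<in> ball (complex_of_real r) e" by simp_all
  have "setdist S (\<gamma> ` {0<..<1}) \<le> dist z (\<gamma> s)" using z s(1) by (intro setdist_le_dist) auto
  also have "\<dots> \<le> dist z (complex_of_real r) + dist (complex_of_real r) (\<gamma> s)" by (rule dist_triangle)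
  finally show "setdist S (\<gamma> ` {0<..<1}) \<le> dist z (complex_of_real r) + e" using s h1[OF s(1)] by simp
qed

theorem mainTheorem6:
  fixes dA0 :: "'a::complex_hilbert set" and A0 :: "'a \<Rightarrow> 'a"
    and E0 :: "real set \<Rightarrow> 'a \<Rightarrow>\<^sub>L 'a"
    and A1 :: "'b::complex_hilbert \<Rightarrow>\<^sub>L 'b" and B :: "'b \<Rightarrow>\<^sub>L 'a"
    and m1 m2 :: ereal and D :: "complex set"
    and K' :: "complex \<Rightarrow> 'b \<Rightarrow>\<^sub>L 'b"
    and l :: int and \<gamma> :: "real \<Rightarrow> complex"
    and X Z :: "'b \<Rightarrow>\<^sub>L 'b" and Y :: "'b \<Rightarrow>\<^sub>L 'a" and Yhat :: "'a \<Rightarrow>\<^sub>L 'b"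
  assumes nonzero: "\<exists>x::'a. x \<noteq> 0" "\<exists>x::'b. x \<noteq> 0"
    and A0: "self_adjoint dA0 A0" "spectral_measure_of dA0 A0 E0"
    and A1: "clin A1" "self_adjoint UNIV (blinfun_apply A1)"
    and B: "clin B"
    and spec_A0: "m1 < m2" "spectrum dA0 A0 = complex_of_real ` closure (interval0 m1 m2)"
      "abs_continuous_spectral E0"
    and spec_A1: "spec A1 \<subseteq> complex_of_real ` interval0 m1 m2"
    and D: "open D" "connected D" "simply_connected D" "D \<subseteq> {z. Im z < 0}"
      "complex_of_real ` interval0 m1 m2 \<subseteq> frontier D"
    and K': "K_continuation B E0 m1 m2 D K'"
    and K'_finite_end: "endpoint_bound K' D m1" "endpoint_bound K' D m2"
    and K'_infinite_end: "infinity_bound K' D m1" "infinity_bound K' D m2"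
    and l: "l \<in> {1, -1}"
    and \<gamma>: "admissible_contour K' (domain_side D l) m1 m2 \<gamma>"
      "V0 K' \<gamma> < (contour_dist A1 \<gamma>)\<^sup>2 / 4"
    and X: "basic_solution K' \<gamma> A1 X"
    and Z: "Z = A1 + X"
    and dist: "setdist (spec Z) (domain_side D l) > 0"
    and Y: "clin Y"
      "has_strong_integral E0 (\<lambda>\<mu>. B o\<^sub>L inv_op (Z - cmul (complex_of_real \<mu>))) m1 m2 Y"
    and Yhat: "Yhat = adj Y"
  shows "norm Y \<ge> 1 \<and> norm Yhat = norm Y \<and> norm Yhat \<ge> 1"
proof -
  define D' where "D' = domain_side D l"
  define \<Delta> where "\<Delta> = interval0 m1 m2"
  define S where "S = D' \<union> complex_of_real ` \<Delta>"
  \<comment> \<open>Dividing by \<open>\<omega>\<close> turns the half plane that contains \<open>D'\<close> into the right half plane.\<close>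
  define \<omega> where "\<omega> = (if l = 1 then \<i> else - \<i>)"
  have \<omega>: "cmod \<omega> = 1" "Re (1 / \<omega>) = 0" by (auto simp: \<omega>_def)
  have D'sub: "D' \<subseteq> D \<union> cnj ` D" by (auto simp: D'_def domain_side_def)
  have side: "0 < Re (w / \<omega>)" if "w \<in> D'" for w
    using that D(4) by (auto simp: D'_def domain_side_def \<omega>_def split: if_splits)
  have Re_shift: "Re ((w - complex_of_real c) / \<omega>) = Re (w / \<omega>)" for w c
    by (simp add: \<omega>_def)
  have S_side: "0 \<le> Re ((w - complex_of_real c) / \<omega>)" if "w \<in> S" for w c
    unfolding Re_shift using that side[of w] by (auto simp: S_def \<omega>_def)
  have real_notin_S: "complex_of_real r \<in> S \<Longrightarrow> r \<in> \<Delta>" for r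
    using side[of "complex_of_real r"] by (auto simp: S_def \<omega>_def split: if_splits)
  have closD: "complex_of_real t \<in> closure D" if "t \<in> \<Delta>" for t
    using that D(5) unfolding \<Delta>_def frontier_def by blast
  have closD': "complex_of_real t \<in> closure D'" if t: "t \<in> \<Delta>" for t
    unfolding closure_approachable
  proof (intro allI impI)
    fix e :: real assume "e > 0"
    then obtain v where v: "v \<in> D" "dist v (complex_of_real t) < e"
      using closD[OF t] unfolding closure_approachable by blast
    have "dist (cnj v) (complex_of_real t) = dist v (complex_of_real t)"
      unfolding dist_norm by (metis complex_cnj_complex_of_real complex_cnj_diff complex_mod_cnj)
    then show "\<exists>y\<in>D'. dist y (complex_of_real t) < e"
      using v unfolding D'_def domain_side_def
      by (cases "l = 1") (auto intro!: bexI[of _ "cnj v"] bexI[of _ v])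
  qed
  have clX: "clin X" and W1: "has_W1 K' \<gamma> Z X" and normX: "norm X \<le> contour_dist A1 \<gamma> / 2 - sqrt ((contour_dist A1 \<gamma>)\<^sup>2 / 4 - V0 K' \<gamma>)"
    using X unfolding basic_solution_def Z[symmetric] by blast+
  have clZ: "clin Z" unfolding Z by (intro clin_simps A1 clX)
  have notspec: "z \<notin> spec Z" if z: "z \<in> closure D'" for z
  proof
    assume zs: "z \<in> spec Z"
    have "\<exists>v\<in>D'. dist v z < setdist (spec Z) D'" using z dist unfolding closure_approachable D'_def by blast
    then obtain v where v: "v \<in> D'" "dist v z < setdist (spec Z) D'" by blast
    then show False using setdist_le_dist[OF zs v(1)] by (simp add: dist_commute)
  qed
  have Sclos: "S \<subseteq> closure D'" unfolding S_def using closD' closure_subset by auto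
  have S_spec: "z \<notin> spec Z" if "z \<in> S" for z using notspec Sclos that by blast
  obtain M where M: "\<And>z. z \<in> closure D' \<Longrightarrow> norm (resolvent Z z) \<le> M"
    using resolvent_bounded_on_closed[OF clZ closed_closure, of D'] notspec by blast
  have MS: "norm (resolvent Z z) \<le> \<bar>M\<bar>" if "z \<in> S" for z using M[of z] Sclos that by fastforce
  have K'an: "op_analytic_on K' (complex_of_real ` \<Delta> \<union> D \<union> cnj ` D)"
    and K'der: "\<And>t. t \<in> \<Delta> \<Longrightarrow> (K_B B E0 has_vector_derivative K' (complex_of_real t)) (at t)"
    using K' unfolding K_continuation_def \<Delta>_def by auto
  obtain UK where UK: "open UK" "complex_of_real ` \<Delta> \<union> D \<union> cnj ` D \<subseteq> UK"
    "\<And>w. w \<in> UK \<Longrightarrow> clin (K' w) \<and> (\<exists>F'. (K' has_derivative (\<lambda>h. cmul h o\<^sub>L F')) (at w))"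
    using op_analytic_on_open[OF K'an] by blast
  have K'cont: "isCont K' w" if "w \<in> UK" for w using UK(3)[OF that] has_derivative_continuous by blast
  define U where "U = UK \<inter> - spec Z"
  have U: "open U" unfolding U_def using UK(1) open_resolvent_set[OF clZ] by blast
  have SU: "S \<subseteq> U" using S_spec UK(2) D'sub unfolding U_def S_def by blast
  define f where "f x w = cinner (K' w (resolvent Z w x)) x" for x w
  have f_hol: "f x holomorphic_on U" for x
    unfolding f_def by (rule resolvent_form_holomorphic[OF clZ UK(3)]) (auto simp: U_def)
  have f_le: "cmod (f x w) \<le> norm (K' w) * (\<bar>M\<bar> * (norm x)\<^sup>2)" if "w \<in> S" for x w
  proof -
    have "cmod (f x w) \<le> norm (K' w (resolvent Z w x)) * norm x" unfolding f_def by (rule cinner_Cauchy_Schwarz)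
    also have "\<dots> \<le> (norm (K' w) * (\<bar>M\<bar> * norm x)) * norm x"
    proof (rule mult_right_mono)
      have "norm (K' w (resolvent Z w x)) \<le> norm (K' w) * norm (resolvent Z w x)" by (rule norm_blinfun)
      also have "norm (resolvent Z w x) \<le> \<bar>M\<bar> * norm x"
        using norm_blinfun[of "resolvent Z w" x] MS[OF that] by (meson mult_right_mono norm_ge_zero order_trans)
      finally show "norm (K' w (resolvent Z w x)) \<le> norm (K' w) * (\<bar>M\<bar> * norm x)" by (simp add: mult_left_mono)
    qed simp
    finally show ?thesis by (simp add: power2_eq_square mult_ac)
  qed
  \<comment> \<open>The bounds on \<open>K'\<close> hold on \<open>D\<^sup>\<plusminus>\<close> and extend to the interval by continuity.\<close>
  have to_S: "norm (K' w) \<le> q w"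
    if w: "w \<in> S" "w \<in> V" and V: "open V" and q: "isCont q w" "\<And>v. v \<in> D \<union> cnj ` D \<Longrightarrow> v \<in> V \<Longrightarrow> norm (K' v) \<le> q v" for w V q
  proof -
    have "w \<in> UK" using SU w(1) by (auto simp: U_def)
    then have "isCont (\<lambda>v. norm (K' v)) w" by (intro continuous_norm K'cont)
    then show ?thesis
      by (rule le_at_closure_point[where A = D', OF _ q(1) _ V w(2)]) (use q(2) D'sub Sclos w(1) in auto)
  qed
  have fin: "\<exists>C g. -1 < g \<and> (\<exists>\<delta>>0. \<forall>w\<in>S. dist w (of_real (real_of_ereal m)) < \<delta> \<longrightarrow>
       cmod (f x w) \<le> C * dist w (of_real (real_of_ereal m)) powr g)" if m: "m \<in> {m1, m2}" "\<bar>m\<bar> \<noteq> \<infinity>" for m x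
  proof -
    let ?m = "complex_of_real (real_of_ereal m)"
    have "endpoint_bound K' D m" using m(1) K'_finite_end by auto
    then obtain C g \<delta> where C: "C > 0" "-1 < g" "\<delta> > 0" "\<And>\<mu>. \<mu> \<in> D \<union> cnj ` D \<Longrightarrow> dist \<mu> ?m < \<delta> \<Longrightarrow> norm (K' \<mu>) \<le> C * dist \<mu> ?m powr g"
      using m(2) unfolding endpoint_bound_def by blast
    have mS: "?m \<notin> S"
    proof
      assume "?m \<in> S"
      then have "real_of_ereal m \<in> interval0 m1 m2" using real_notin_S unfolding \<Delta>_def by blast
      then show False using m by (auto simp: interval0_def ereal_real')
    qed
    have "cmod (f x w) \<le> (C * (\<bar>M\<bar> * (norm x)\<^sup>2)) * dist w ?m powr g" if w: "w \<in> S" "dist w ?m < \<delta>" for w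
    proof -
      have wm: "dist w ?m \<noteq> 0" using mS w(1) by auto
      have "norm (K' w) \<le> C * dist w ?m powr g"
      proof (rule to_S[OF w(1), of "ball ?m \<delta>"])
        show "isCont (\<lambda>v. C * dist v ?m powr g) w"
          using wm by (intro continuous_intros) auto
      qed (use w C(4) in \<open>auto simp: dist_commute\<close>)
      then have "norm (K' w) * (\<bar>M\<bar> * (norm x)\<^sup>2) \<le> C * dist w ?m powr g * (\<bar>M\<bar> * (norm x)\<^sup>2)"
        by (rule mult_right_mono) simp
      then show ?thesis using f_le[OF w(1), of x] by (simp add: mult_ac)
    qed
    then show ?thesis using C(2,3) by blast
  qed
  have inf: "\<exists>C \<alpha>. \<alpha> < 1 \<and> (\<exists>R. \<forall>w\<in>S. R < cmod w \<longrightarrow> cmod (f x w) \<le> C * exp (cmod w powr \<alpha>))"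
    if m: "m \<in> {m1, m2}" "\<bar>m\<bar> = \<infinity>" for m x
  proof -
    have "infinity_bound K' D m" using m(1) K'_infinite_end by auto
    then obtain C \<alpha> R where C: "C > 0" "\<alpha> < 1" "\<And>\<mu>. \<mu> \<in> D \<union> cnj ` D \<Longrightarrow> R < cmod \<mu> \<Longrightarrow> norm (K' \<mu>) \<le> C * exp (cmod \<mu> powr \<alpha>)"
      using m(2) unfolding infinity_bound_def by blast
    have "cmod (f x w) \<le> (C * (\<bar>M\<bar> * (norm x)\<^sup>2)) * exp (cmod w powr \<alpha>)" if w: "w \<in> S" "max R 0 < cmod w" for w
    proof -
      have "norm (K' w) \<le> C * exp (cmod w powr \<alpha>)"
      proof (rule to_S[OF w(1), of "{v. max R 0 < cmod v}"])
        show "isCont (\<lambda>v. C * exp (cmod v powr \<alpha>)) w"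
          using w(2) by (intro continuous_intros) auto
        show "open {v::complex. max R 0 < cmod v}" by (intro open_Collect_less continuous_intros)
      qed (use w C(3) in auto)
      then have "norm (K' w) * (\<bar>M\<bar> * (norm x)\<^sup>2) \<le> C * exp (cmod w powr \<alpha>) * (\<bar>M\<bar> * (norm x)\<^sup>2)"
        by (rule mult_right_mono) simp
      then show ?thesis using f_le[OF w(1), of x] by (simp add: mult_ac)
    qed
    then show ?thesis using C(2) by blast
  qed
  have m_S: "of_real (real_of_ereal m) \<notin> S" if m: "m \<in> {m1, m2}" "\<bar>m\<bar> \<noteq> \<infinity>" for m
  proof
    assume "of_real (real_of_ereal m) \<in> S"
    then have "real_of_ereal m \<in> interval0 m1 m2" using real_notin_S unfolding \<Delta>_def by blast
    then show False using m by (auto simp: interval0_def ereal_real')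
  qed
  have con: "contour D' m1 m2 \<gamma>" and V0i: "V0_integrand K' \<gamma> integrable_on {0<..<1}"
    using \<gamma>(1) unfolding admissible_contour_def D'_def by auto
  have lip: "\<exists>L. L-lipschitz_on {a..b} \<gamma>" if "0 < a" "b < 1" for a b
    using con that unfolding contour_def by blast
  have \<gamma>D: "\<gamma> t \<in> S" if "t \<in> {0<..<1}" for t using con that unfolding contour_def S_def by blast
  have "deformation_of_interval D' m1 m2 \<gamma>" using con unfolding contour_def by blast
  then obtain h :: "real \<times> real \<Rightarrow> complex" and \<phi> :: "real \<Rightarrow> real" where
    h0: "continuous_on ({0<..<1} \<times> {0..1}) h \<and>
        h ` ({0<..<1} \<times> {0..1}) \<subseteq> D' \<union> complex_of_real ` interval0 m1 m2 \<and>
        strict_mono_on {0<..<1} \<phi> \<and> \<phi> ` {0<..<1} = interval0 m1 m2 \<and>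
        (\<forall>s\<in>{0<..<1}. h (s, 0) = complex_of_real (\<phi> s) \<and> h (s, 1) = \<gamma> s) \<and>
        filterlim h (end_filter m1) (at_right 0 \<times>\<^sub>F principal {0..1}) \<and>
        filterlim h (end_filter m2) (at_left 1 \<times>\<^sub>F principal {0..1})"
    unfolding deformation_of_interval_def by (elim exE)
  then have h: "continuous_on ({0<..<1} \<times> {0..1}) h" "h ` ({0<..<1} \<times> {0..1}) \<subseteq> S"
      "strict_mono_on {0<..<1} \<phi>" "\<phi> ` {0<..<1} = interval0 m1 m2"
      "filterlim h (end_filter m1) (at_right 0 \<times>\<^sub>F principal {0..1})"
      "filterlim h (end_filter m2) (at_left 1 \<times>\<^sub>F principal {0..1})"
    unfolding S_def \<Delta>_def by - (elim conjE, assumption)+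
  have h1: "h (s, 0) = complex_of_real (\<phi> s) \<and> h (s, 1) = \<gamma> s" if "s \<in> {0<..<1}" for s
    using h0 that by (elim conjE) (erule bspec)
  from Y(2)[unfolded has_strong_integral_def, folded resolvent_def]
  obtain J :: "real \<Rightarrow> real \<Rightarrow> 'b \<Rightarrow>\<^sub>L 'a" where
    J0: "(\<forall>a b. m1 < ereal a \<and> a < b \<and> ereal b < m2 \<longrightarrow>
         has_strong_integral_compact E0 (\<lambda>\<mu>. B o\<^sub>L resolvent Z (complex_of_real \<mu>)) a b (J a b)) \<and>
      (\<forall>u. \<forall>e>0. \<exists>a0 b0. m1 < ereal a0 \<and> a0 < b0 \<and> ereal b0 < m2 \<and>
         (\<forall>a b. m1 < ereal a \<and> a \<le> a0 \<and> b0 \<le> b \<and> ereal b < m2 \<longrightarrow> norm (J a b u - Y u) < e))"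
    by (elim exE)
  have J: "has_strong_integral_compact E0 (\<lambda>\<mu>. B o\<^sub>L resolvent Z (complex_of_real \<mu>)) a b (J a b)"
    if "m1 < ereal a" "a < b" "ereal b < m2" for a b
    using J0[THEN conjunct1, THEN spec, THEN spec, THEN mp] that by simp
  have JY: "\<exists>a0 b0. m1 < ereal a0 \<and> a0 < b0 \<and> ereal b0 < m2 \<and>
         (\<forall>a b. m1 < ereal a \<and> a \<le> a0 \<and> b0 \<le> b \<and> ereal b < m2 \<longrightarrow> norm (J a b u - Y u) < e)" if "e > 0" for u e
    using J0[THEN conjunct2, THEN spec, THEN spec, THEN mp, OF that] .
  have pvm: "projection_valued_measure E0" using A0(2) unfolding spectral_measure_of_def by blast
  have between: "t \<in> \<Delta>" if "m1 < ereal a" "ereal b < m2" "t \<in> {a..b}" for a b t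
    using that less_le_trans[of m1 "ereal a" "ereal t"] le_less_trans[of "ereal t" "ereal b" m2] by (simp add: \<Delta>_def interval0_def)
  have res: "complex_of_real t \<notin> spec Z" if "t \<in> \<Delta>" for t using S_spec[of "complex_of_real t"] that by (simp add: S_def)
  have J_int: "cinner (J a b u) (B u) = integral {a..b} (\<lambda>t. f u (complex_of_real t))"
    if ab: "m1 < ereal a" "a < b" "ereal b < m2" for a b u
    unfolding f_def
  proof (rule strong_integral_eq_integral[OF pvm B clZ ab(2) _ _ _ J[OF ab]])
    fix t assume "t \<in> {a..b}"
    then have t: "t \<in> \<Delta>" using between ab by blast
    show "complex_of_real t \<notin> spec Z" by (rule res[OF t])
    show "(K_B B E0 has_vector_derivative K' (complex_of_real t)) (at t)" by (rule K'der[OF t])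
  next
    have "continuous_on UK K'" using K'cont by (simp add: continuous_at_imp_continuous_on)
    then show "continuous_on {a..b} (\<lambda>t. K' (complex_of_real t))"
      by (rule continuous_on_compose2) (use between[OF ab(1,3)] UK(2) in \<open>auto intro!: continuous_intros\<close>)
  qed
  have J_real: "Im (cinner (J a b (Z u)) (J a b u)) = Im (cinner (B u) (J a b u))" if ab: "m1 < ereal a" "a < b" "ereal b < m2" for a b u
    by (rule strong_integral_form_real[OF pvm B ab(2) _ J[OF ab]]) (use between[OF ab(1,3)] res in blast)
  have X_form: "cinner (X x) x = - cinner (Y x) (B x)" for x
  proof -
    have "- cinner (X x) x = cinner (Y x) (B x)"
    proof (rule contour_integral_eq_real_integral[OF U f_hol SU \<omega> S_side spec_A0(1) h(1-4) h1 h(5,6) m_S fin inf lip])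
      have bl: "bounded_linear (\<lambda>T :: 'b \<Rightarrow>\<^sub>L 'b. cinner (T x) x)"
        by (rule bounded_linear_compose[OF bounded_bilinear.bounded_linear_left[OF bounded_bilinear_cinner] blinfun.bounded_linear_left])
      have "((\<lambda>t. cmul (vector_derivative \<gamma> (at t)) o\<^sub>L K' (\<gamma> t) o\<^sub>L resolvent Z (\<gamma> t)) has_integral (- X)) {0<..<1}"
        using W1 unfolding has_W1_def resolvent_def by blast
      from has_integral_linear[OF this bl]
      have 1: "((\<lambda>t. f x (\<gamma> t) * vector_derivative \<gamma> (at t)) has_integral - cinner (X x) x) {0<..<1}"
        by (simp add: o_def f_def cinner_scaleC_left mult.commute blinfun.minus_left cinner_minus_left)
      then show "((\<lambda>t. f x (\<gamma> t) * vector_derivative \<gamma> (at t)) has_integral - cinner (X x) x) {0<..<1}" .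
      have "(\<lambda>t. (\<bar>M\<bar> * (norm x)\<^sup>2) * V0_integrand K' \<gamma> t) integrable_on {0<..<1}" using integrable_on_cmult_left[OF V0i] by simp
      moreover have "cmod (f x (\<gamma> t) * vector_derivative \<gamma> (at t)) \<le> (\<bar>M\<bar> * (norm x)\<^sup>2) * V0_integrand K' \<gamma> t" if "t \<in> {0<..<1}" for t
        using mult_right_mono[OF f_le[OF \<gamma>D[OF that], of x] norm_ge_zero[of "vector_derivative \<gamma> (at t)"]]
        by (simp add: norm_mult V0_integrand_def mult_ac)
      ultimately have "(\<lambda>t. f x (\<gamma> t) * vector_derivative \<gamma> (at t)) absolutely_integrable_on {0<..<1}"
        using 1 by (intro absolutely_integrable_integrable_bound) auto
      then show "(\<lambda>t. cmod (f x (\<gamma> t) * vector_derivative \<gamma> (at t))) integrable_on {0<..<1}"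
        unfolding absolutely_integrable_on_def by blast
    next
      fix \<eta> :: real assume \<eta>: "\<eta> > 0"
      define e where "e = \<eta> / (norm (B x) + 1)"
      have nB: "norm (B x) + 1 > 0" by (simp add: add_nonneg_pos)
      have e: "e > 0" unfolding e_def using \<eta> nB by simp
      obtain a0 b0 where ab0: "m1 < ereal a0" "a0 < b0" "ereal b0 < m2"
        "\<And>a b. m1 < ereal a \<Longrightarrow> a \<le> a0 \<Longrightarrow> b0 \<le> b \<Longrightarrow> ereal b < m2 \<Longrightarrow> norm (J a b x - Y x) < e" using JY[OF e] by blast
      have "cmod (integral {a..b} (\<lambda>t. f x (complex_of_real t)) - cinner (Y x) (B x)) < \<eta>"
        if "a \<in> interval0 m1 m2 \<and> b \<in> interval0 m1 m2 \<and> a \<le> a0 \<and> b0 \<le> b" for a b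
      proof -
        have ab: "m1 < ereal a" "a < b" "ereal b < m2" using that ab0(2) by (auto simp: interval0_def)
        have "integral {a..b} (\<lambda>t. f x (complex_of_real t)) - cinner (Y x) (B x) = cinner (J a b x - Y x) (B x)"
          unfolding J_int[OF ab, symmetric] cinner_diff_left ..
        also have "cmod \<dots> \<le> norm (J a b x - Y x) * norm (B x)" by (rule cinner_Cauchy_Schwarz)
        also have "\<dots> \<le> e * norm (B x)" using ab0(4)[OF ab(1) _ _ ab(3)] that by (intro mult_right_mono) auto
        also have "\<dots> < e * (norm (B x) + 1)" using e by simp
        also have "\<dots> = \<eta>" unfolding e_def using nB by simp
        finally show ?thesis .
      qed
      moreover have "a0 \<in> interval0 m1 m2" "b0 \<in> interval0 m1 m2"
        using between[OF ab0(1,3)] ab0(2) by (auto simp: \<Delta>_def)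
      ultimately show "\<exists>a0 b0. a0 \<in> interval0 m1 m2 \<and> b0 \<in> interval0 m1 m2 \<and> a0 < b0 \<and>
        (\<forall>a b. a \<in> interval0 m1 m2 \<and> b \<in> interval0 m1 m2 \<and> a \<le> a0 \<and> b0 \<le> b \<longrightarrow>
         cmod (integral {a..b} (\<lambda>t. f x (complex_of_real t)) - cinner (Y x) (B x)) < \<eta>)"
        using ab0(2) by blast
    qed
    then show ?thesis by (metis minus_minus)
  qed
  have Y_form: "Im (cinner (Y (Z u)) (Y u)) = Im (cinner (B u) (Y u))" for u
  proof -
    have "\<exists>T :: 'b \<Rightarrow>\<^sub>L 'a. norm (T u - Y u) < inverse (real (Suc n)) \<and> norm (T (Z u) - Y (Z u)) < inverse (real (Suc n)) \<and>
       Im (cinner (T (Z u)) (T u)) = Im (cinner (B u) (T u))" for n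
    proof -
      have p: "inverse (real (Suc n)) > 0" by simp
      obtain a1 b1 where 1: "m1 < ereal a1" "a1 < b1" "ereal b1 < m2"
        "\<And>a b. m1 < ereal a \<Longrightarrow> a \<le> a1 \<Longrightarrow> b1 \<le> b \<Longrightarrow> ereal b < m2 \<Longrightarrow> norm (J a b u - Y u) < inverse (real (Suc n))" using JY[OF p] by blast
      obtain a2 b2 where 2: "m1 < ereal a2" "a2 < b2" "ereal b2 < m2"
        "\<And>a b. m1 < ereal a \<Longrightarrow> a \<le> a2 \<Longrightarrow> b2 \<le> b \<Longrightarrow> ereal b < m2 \<Longrightarrow> norm (J a b (Z u) - Y (Z u)) < inverse (real (Suc n))" using JY[OF p] by blast
      let ?a = "min a1 a2" and ?b = "max b1 b2"
      have ab: "m1 < ereal ?a" "?a < ?b" "ereal ?b < m2" using 1(1-3) 2(1-3) by (auto simp: min_def max_def)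
      show ?thesis
        by (intro exI[of _ "J ?a ?b"] conjI 1(4) 2(4) J_real ab) auto
    qed
    then obtain T :: "nat \<Rightarrow> 'b \<Rightarrow>\<^sub>L 'a" where T: "\<And>n. norm (T n u - Y u) < inverse (real (Suc n))" "\<And>n. norm (T n (Z u) - Y (Z u)) < inverse (real (Suc n))"
       "\<And>n. Im (cinner (T n (Z u)) (T n u)) = Im (cinner (B u) (T n u))" by metis
    have lim: "(\<lambda>n. T n v) \<longlonglongrightarrow> Y v" if "\<And>n. norm (T n v - Y v) < inverse (real (Suc n))" for v
    proof -
      have "(\<lambda>n. T n v - Y v) \<longlonglongrightarrow> 0"
        by (rule Lim_null_comparison[OF _ LIMSEQ_inverse_real_of_nat]) (use that less_imp_le in \<open>auto intro!: always_eventually\<close>)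
      then show ?thesis by (rule LIM_zero_cancel)
    qed
    have "(\<lambda>n. Im (cinner (T n (Z u)) (T n u))) \<longlonglongrightarrow> Im (cinner (Y (Z u)) (Y u))"
      by (intro tendsto_Im bounded_bilinear.tendsto[OF bounded_bilinear_cinner] lim T(1,2))
    moreover have "(\<lambda>n. Im (cinner (B u) (T n u))) \<longlonglongrightarrow> Im (cinner (B u) (Y u))"
      by (intro tendsto_Im bounded_bilinear.tendsto[OF bounded_bilinear_cinner] lim T(1) tendsto_const)
    ultimately show ?thesis unfolding T(3) by (rule LIMSEQ_unique)
  qed
  have form: "Im (cinner (Z x) x) = Im (cinner (Y (Z x)) (Y x))" for x
  proof -
    have "cinner (A1 x) x = cinner x (A1 x)" using A1(2) unfolding self_adjoint_def by blast
    then have "Im (cinner (A1 x) x) = 0" by (metis cinner_commute complex_cnj_cancel_iff Im_complex_of_real Reals_cnj_iff complex_is_Real_iff)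
    moreover have "Im (cinner (X x) x) = Im (cinner (B x) (Y x))"
      unfolding X_form by (subst cinner_commute) simp
    ultimately have "Im (cinner (Z x) x) = Im (cinner (B x) (Y x))" unfolding Z by (simp add: blinfun.add_left cinner_add_left)
    then show ?thesis unfolding Y_form .
  qed
  have "norm Y \<ge> 1"
  proof (rule ccontr)
    assume "\<not> norm Y \<ge> 1"
    then have lt: "norm Y < 1" by simp
    define d where "d = contour_dist A1 \<gamma>"
    have "0 \<le> V0 K' \<gamma>" unfolding V0_def by (rule integral_nonneg[OF V0i]) (simp add: V0_integrand_def)
    then have d2: "0 < d\<^sup>2 / 4 - V0 K' \<gamma>" "0 < d\<^sup>2" using \<gamma>(2) unfolding d_def by auto
    have "0 \<le> d" unfolding d_def contour_dist_def by (rule setdist_pos_le)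
    then have d: "d > 0" using d2(2) by (cases "d = 0") auto
    have "norm X \<le> d / 2 - sqrt (d\<^sup>2 / 4 - V0 K' \<gamma>)" using normX unfolding d_def .
    moreover have "0 \<le> sqrt (d\<^sup>2 / 4 - V0 K' \<gamma>)" using d2(1) by simp
    ultimately have Xd: "norm X < d" using d by linarith
    have "spec Z \<noteq> {}" using dist by auto
    then obtain z where z: "z \<in> spec Z" by blast
    have "Im z = 0" by (rule spec_real_if_contractive_graph[OF clZ Y(1) lt form z])
    then have zt: "z = complex_of_real (Re z)" by (simp add: complex_eq_iff)
    have "Re z \<in> interval0 m1 m2"
    proof (rule real_spec_in_interval[OF A1 nonzero(2) spec_A1 clX Xd])
      show "complex_of_real (Re z) \<in> spec (A1 + X)" using z zt Z by simp
      show "d \<le> dist \<mu> r" if "m1 = ereal r" "complex_of_real \<mu> \<in> spec A1" for r \<mu>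
        using dist_to_contour_end[OF h(5) _ _ h1[THEN conjunct2] that] eventually_at_right_real[of 0 "1::real"]
        by (simp add: d_def contour_dist_def dist_of_real)
      show "d \<le> dist \<mu> r" if "m2 = ereal r" "complex_of_real \<mu> \<in> spec A1" for r \<mu>
        using dist_to_contour_end[OF h(6) _ _ h1[THEN conjunct2] that] eventually_at_left_real[of 0 "1::real"]
        by (simp add: d_def contour_dist_def dist_of_real)
    qed
    then show False using res[of "Re z"] z zt unfolding \<Delta>_def by simp
  qed
  moreover have "norm Yhat = norm Y" unfolding Yhat by (rule norm_adj[OF Y(1)])
  ultimately show ?thesis by simp
qed

end
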